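(* Let $0<p<\infty$, $\omega\in\mathcal D=\widehat{\mathcal D}\cap\check{\mathcal D}$, and let $\nu$ be a positive Borel measure on $\mathbb D$. Suppose $\varphi$ and $\psi$ are analytic self-maps of $\mathbb D$, and let $\sigma(z)=\delta(\varphi(z),\psi(z))$. Then the difference operator $C_\varphi-C_\psi:A^p_\omega\to L^p_\nu$ is bounded if and only if both weighted composition operators $\sigma C_\varphi$ and $\sigma C_\psi$ are bounded from $A^p_\omega$ to $L^p_\nu$. Moreover, there exists $\gamma_0=\gamma_0(\omega)$ such that for all $\gamma>\gamma_0$ $$\|C_\varphi-C_\psi\|^p_{A^p_\omega\to L^p_\nu}\asymp\sup_{a\in\mathbb D}\frac{(1-|a|)^{\gamma}}{\widehat\omega(a)}\int_{\mathbb D}\left(\frac{\sigma(z)^p}{|1-\bar a\varphi(z)|^{\gamma+1}}+\frac{\sigma(z)^p}{|1-\bar a\psi(z)|^{\gamma+1}}\right)d\nu(z).$$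
   Context: $\mathbb D=\{z\in\mathbb C:|z|<1\}$, $dA=\frac{dx\,dy}{\pi}$. A radial weight is a non-negative $\omega\in L^1(\mathbb D)$ with $\omega(z)=\omega(|z|)$. Put $\widehat\omega(z)=\int_{|z|}^1\omega(s)\,ds$; throughout, $\widehat\omega(z)>0$ for all $z\in\mathbb D$. A radial weight $\omega$ belongs to $\widehat{\mathcal D}$ if there is $C\ge1$ with $\widehat\omega(r)\le C\,\widehat\omega(\frac{1+r}{2})$ for all $0\le r<1$; it belongs to $\check{\mathcal D}$ if there are $K>1$ and $C>1$ with $\widehat\omega(r)\ge C\,\widehat\omega(1-\frac{1-r}{K})$ for all $0\le r<1$. $A^p_\omega$ consists of the analytic functions $f$ on $\mathbb D$ with $\|f\|_{A^p_\omega}^p=\int_{\mathbb D}|f|^p\omega\,dA<\infty$. $L^p_\nu$ is the Lebesgue space with $\|f\|_{L^p_\nu}^p=\int_{\mathbb D}|f|^p\,d\nu$. $C_\varphi f=f\circ\varphi$ and $(\sigma C_\varphi)f=\sigma\cdot(f\circ\varphi)$. The pseudohyperbolic distance is $\delta(a,z)=\left|\frac{a-z}{1-\overline a z}\right|$. $\|T\|_{A^p_\omega\to L^p_\nu}=\sup\{\|Tf\|_{L^p_\nu}:\|f\|_{A^p_\omega}\le1\}$. The relation $A\asymp B$ means $C^{-1}B\le A\le CB$ with a constant $C>0$ not depending on $\varphi,\psi,\nu$ (it may depend on $p,\omega,\gamma$). *)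

theory Defs
  imports "HOL-Complex_Analysis.Complex_Analysis"
begin

abbreviation unit_disc :: "complex set" where
  "unit_disc \<equiv> ball 0 1"

text \<open>The normalized area measure \<open>dA = dx dy / \<pi>\<close>, as a measure whose space is the disc.\<close>

definition area_measure :: "complex measure" where
  "area_measure = scale_measure (ennreal (1 / pi)) (restrict_space lebesgue unit_disc)"

text \<open>Weights are total functions; only their values in the disc matter.\<close>

definition radial_weight :: "(complex \<Rightarrow> real) \<Rightarrow> bool" where
  "radial_weight \<omega> \<longleftrightarrow>
     (\<forall>z\<in>unit_disc. 0 \<le> \<omega> z) \<and>
     (\<forall>z\<in>unit_disc. \<omega> z = \<omega> (complex_of_real (cmod z))) \<and>
     integrable area_measure \<omega>"

text \<open>The tail integral is \<open>ennreal\<close>-valued because integrability over the disc does not rule out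
  the value \<open>\<infinity>\<close> at the origin (e.g. \<open>\<omega>(z) = 1/|z|\<close>).\<close>

definition tail_integral :: "(complex \<Rightarrow> real) \<Rightarrow> complex \<Rightarrow> ennreal" where
  "tail_integral \<omega> z =
     (\<integral>\<^sup>+ s\<in>{cmod z<..<1}. ennreal (\<omega> (complex_of_real s)) \<partial>lebesgue)"

definition D_hat :: "(complex \<Rightarrow> real) set" where
  "D_hat = {\<omega>. radial_weight \<omega> \<and>
     (\<exists>C\<ge>1. \<forall>r\<in>{0..<1}. tail_integral \<omega> (complex_of_real r)
        \<le> ennreal C * tail_integral \<omega> (complex_of_real ((1 + r) / 2)))}"

definition D_check :: "(complex \<Rightarrow> real) set" where
  "D_check = {\<omega>. radial_weight \<omega> \<and>
     (\<exists>K>1. \<exists>C>1. \<forall>r\<in>{0..<1}. tail_integral \<omega> (complex_of_real r)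
        \<ge> ennreal C * tail_integral \<omega> (complex_of_real (1 - (1 - r) / K)))}"

text \<open>Real powers of extended nonnegative numbers, used for positive exponents only.\<close>

definition epowr :: "ennreal \<Rightarrow> real \<Rightarrow> ennreal" where
  "epowr x a = (if x = \<infinity> then \<infinity> else ennreal (enn2real x powr a))"

definition bergman_norm :: "real \<Rightarrow> (complex \<Rightarrow> real) \<Rightarrow> (complex \<Rightarrow> complex) \<Rightarrow> ennreal" where
  "bergman_norm p \<omega> f = epowr (\<integral>\<^sup>+ z. ennreal (cmod (f z) powr p * \<omega> z) \<partial>area_measure) (1 / p)"

definition bergman_space :: "real \<Rightarrow> (complex \<Rightarrow> real) \<Rightarrow> (complex \<Rightarrow> complex) set" where
  "bergman_space p \<omega> = {f. f holomorphic_on unit_disc \<and> bergman_norm p \<omega> f < \<infinity>}"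

definition Lp_norm :: "real \<Rightarrow> complex measure \<Rightarrow> (complex \<Rightarrow> complex) \<Rightarrow> ennreal" where
  "Lp_norm p \<nu> f = epowr (\<integral>\<^sup>+ z. ennreal (cmod (f z) powr p) \<partial>\<nu>) (1 / p)"

definition Lp_space :: "real \<Rightarrow> complex measure \<Rightarrow> (complex \<Rightarrow> complex) set" where
  "Lp_space p \<nu> = {f. f \<in> borel_measurable \<nu> \<and> Lp_norm p \<nu> f < \<infinity>}"

definition borel_measure_on_disc :: "complex measure \<Rightarrow> bool" where
  "borel_measure_on_disc \<nu> \<longleftrightarrow> sets \<nu> = sets (restrict_space borel unit_disc)"

definition analytic_self_map :: "(complex \<Rightarrow> complex) \<Rightarrow> bool" where
  "analytic_self_map \<phi> \<longleftrightarrow> \<phi> holomorphic_on unit_disc \<and> \<phi> ` unit_disc \<subseteq> unit_disc"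

definition pseudohyperbolic_dist :: "complex \<Rightarrow> complex \<Rightarrow> real" where
  "pseudohyperbolic_dist a z = cmod ((a - z) / (1 - cnj a * z))"

type_synonym fun_operator = "(complex \<Rightarrow> complex) \<Rightarrow> complex \<Rightarrow> complex"

definition composition_op :: "(complex \<Rightarrow> complex) \<Rightarrow> fun_operator" where
  "composition_op \<phi> f = f \<circ> \<phi>"

definition weighted_composition_op :: "(complex \<Rightarrow> real) \<Rightarrow> (complex \<Rightarrow> complex) \<Rightarrow> fun_operator" where
  "weighted_composition_op \<sigma> \<phi> f = (\<lambda>z. complex_of_real (\<sigma> z) * (f \<circ> \<phi>) z)"

definition difference_op :: "(complex \<Rightarrow> complex) \<Rightarrow> (complex \<Rightarrow> complex) \<Rightarrow> fun_operator" where
  "difference_op \<phi> \<psi> f = (\<lambda>z. composition_op \<phi> f z - composition_op \<psi> f z)"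

definition bounded_op ::
    "real \<Rightarrow> (complex \<Rightarrow> real) \<Rightarrow> complex measure \<Rightarrow> fun_operator \<Rightarrow> bool" where
  "bounded_op p \<omega> \<nu> T \<longleftrightarrow>
     (\<exists>C\<ge>0. \<forall>f\<in>bergman_space p \<omega>.
        T f \<in> Lp_space p \<nu> \<and> Lp_norm p \<nu> (T f) \<le> ennreal C * bergman_norm p \<omega> f)"

definition op_norm ::
    "real \<Rightarrow> (complex \<Rightarrow> real) \<Rightarrow> complex measure \<Rightarrow> fun_operator \<Rightarrow> ennreal" where
  "op_norm p \<omega> \<nu> T =
     (SUP f\<in>{f \<in> bergman_space p \<omega>. bergman_norm p \<omega> f \<le> 1}. Lp_norm p \<nu> (T f))"

text \<open>Two-sided comparability with constant \<open>C\<close>; if one side is \<open>\<infinity>\<close>, so is the other.\<close>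

definition comparable :: "real \<Rightarrow> ennreal \<Rightarrow> ennreal \<Rightarrow> bool" where
  "comparable C A B \<longleftrightarrow> ennreal (1 / C) * B \<le> A \<and> A \<le> ennreal C * B"

end

theory Submission
  imports Defs
begin

text \<open>Let \<open>\<mu>\<close> be the push-forward of \<open>\<sigma>\<^sup>p d\<nu>\<close> under \<open>\<phi>\<close> or \<open>\<psi>\<close>. All the conditions are equivalent to the
  Carleson condition that \<open>\<mu>\<close> charges the points whose Whitney ball contains \<open>u\<close> with at most
  \<open>K T(|u|) (1 - |u|)\<close>, where \<open>T\<close> is the tail integral of the weight.

  If it holds, then \<open>|f(z) - f(w)|\<^sup>p \<le> C \<delta>(z, w)\<^sup>p (I(z) + I(w))\<close>, with \<open>I\<close> the mean of \<open>|f|\<^sup>p\<close> over the Whitney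
  ball, and Tonelli bound the \<open>L\<^sup>p(\<nu>)\<close> norm by the integral of \<open>|f(u)|\<^sup>p T(|u|) / (1 - |u|)\<close>. Since circular means
  of \<open>|f|\<^sup>p\<close> increase with the radius, the two doubling conditions bound this by the Bergman norm.

  Conversely, the condition at \<open>a\<close> follows by testing on \<open>f = (1 - cnj a w) powr (-(\<gamma> + 1) / p)\<close> and on
  \<open>f\<close> times the disc automorphism exchanging \<open>0\<close> and \<open>a\<close>; for large \<open>\<gamma>\<close> the upper doubling condition
  gives \<open>\<parallel>f\<parallel>\<^sup>p \<le> C T(|a|) (1 - |a|) powr -\<gamma>\<close>.\<close>

text \<open>The weight may vanish on whole annuli, so a mean of |f|^p over a Whitney ball cannot be
  compared with an integral against the weight on the same ball. The density T(|u|) / (1 - |u|) has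
  no such gaps, and monotone circular means move |f|^p outwards to radii where the weight has mass;
  so subharmonicity is needed on concentric circles and not only on small balls.

  One test function does not suffice: it may take equal values at \<open>\<phi> z\<close> and
  \<open>\<psi> z\<close> while these are far apart (for a = 0 it is constant). The automorphism
  factor has modulus at most 1, so it costs nothing in norm, and it separates points.

  The threshold is log 2 C, with C the constant in \<open>D_hat\<close>: a geometric series of ratio
  C * 2 powr -\<gamma> must converge. The p-th power of the modulus of the test function is free of
  p, so the threshold depends on the weight alone.

  The measure \<nu> may fail to be sigma-finite; the Carleson condition itself makes the
  push-forward sigma-finite, as Tonelli requires. Bounds are kept linear in the Carleson constant
  and stated for p-th powers, so that p < 1 needs no separate treatment.\<close>

section \<open>Subharmonicity of powers of holomorphic functions\<close>

text \<open>Where \<open>f\<close> does not vanish, \<open>g\<close> is exp (p log f) for a local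
  logarithm. At a zero no branch exists, but the zero function does the job; this is why only an
  inequality is asserted away from the centre.\<close>

lemma holomorphic_norm_powr_branch:
  fixes f :: "complex \<Rightarrow> complex"
  assumes f: "f holomorphic_on S" and S: "open S" "z\<^sub>0 \<in> S" and p: "p > 0"
  obtains g r where "r > 0" "ball z\<^sub>0 r \<subseteq> S" "g holomorphic_on ball z\<^sub>0 r"
    "\<And>z. z \<in> ball z\<^sub>0 r \<Longrightarrow> cmod (g z) \<le> cmod (f z) powr p"
    "cmod (g z\<^sub>0) = cmod (f z\<^sub>0) powr p"
proof (cases "f z\<^sub>0 = 0")
  case True
  obtain r where "r > 0" "ball z\<^sub>0 r \<subseteq> S"
    using S openE by blast
  then show ?thesis
    using True p by (intro that[of r "\<lambda>_. 0"]) auto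
next
  case False
  have "continuous_on S f"
    using f holomorphic_on_imp_continuous_on by blast
  then have "open {z \<in> S. f z \<in> - {0}}"
    using S(1) by (intro continuous_open_preimage[of S f "- {0}", simplified vimage_def Int_def mem_Collect_eq]) auto
  then obtain r where r: "r > 0" "ball z\<^sub>0 r \<subseteq> {z \<in> S. f z \<in> - {0}}"
    using S(2) False by (auto elim!: openE)
  obtain g where g: "g holomorphic_on ball z\<^sub>0 r" "\<And>z. z \<in> ball z\<^sub>0 r \<Longrightarrow> exp (g z) = f z"
    by (rule holomorphic_logarithm_exists[of "ball z\<^sub>0 r" f z\<^sub>0])
      (use r f in \<open>auto intro: holomorphic_on_subset\<close>)
  have eq: "cmod (exp (complex_of_real p * g z)) = cmod (f z) powr p" if "z \<in> ball z\<^sub>0 r" for z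
    using g(2)[OF that, symmetric] by (simp add: powr_def)
  show ?thesis
    by (rule that[of r "\<lambda>z. exp (complex_of_real p * g z)"])
      (use r eq in \<open>auto intro!: holomorphic_intros g(1) simp: subset_iff\<close>)
qed

lemma continuous_on_norm_powr:
  fixes f :: "'a::topological_space \<Rightarrow> 'b::real_normed_vector"
  assumes "continuous_on S f" "p > 0"
  shows "continuous_on S (\<lambda>z. norm (f z) powr p)"
  using assms by (intro continuous_on_powr') (auto intro!: continuous_intros)

text \<open>At a maximum point of largest modulus, the functions are replaced by branches of their
  \<open>p\<close>-th powers, rotated so as to add up to the maximal value there; the maximum modulus principle
  for this single holomorphic function then makes the sum constant nearby.\<close>

lemma sum_norm_powr_le_sphere:
  fixes f :: "'i \<Rightarrow> complex \<Rightarrow> complex"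
  assumes I: "finite I" and f: "\<And>i. i \<in> I \<Longrightarrow> f i holomorphic_on ball 0 1"
    and c: "\<And>i. i \<in> I \<Longrightarrow> c i \<ge> 0"
    and p: "p > 0" and s: "0 < s" "s < 1" and z: "z \<in> cball 0 s"
  shows "\<exists>w\<in>sphere 0 s. (\<Sum>i\<in>I. c i * cmod (f i z) powr p) \<le> (\<Sum>i\<in>I. c i * cmod (f i w) powr p)"
proof -
  define v where "v = (\<lambda>z. \<Sum>i\<in>I. c i * cmod (f i z) powr p)"
  have sub: "cball 0 s \<subseteq> ball (0::complex) 1"
    using s by auto
  have cont: "continuous_on (cball 0 s) v"
    unfolding v_def using f sub p
    by (intro continuous_intros continuous_on_norm_powr)
      (auto intro: holomorphic_on_imp_continuous_on[THEN continuous_on_subset])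
  obtain z\<^sub>1 where z1: "z\<^sub>1 \<in> cball 0 s" "\<And>y. y \<in> cball 0 s \<Longrightarrow> v y \<le> v z\<^sub>1"
    using continuous_attains_sup[OF compact_cball _ cont] z by blast
  define Z where "Z = {y \<in> cball 0 s. v y = v z\<^sub>1}"
  have "closed Z"
  proof -
    have "Z = cball 0 s \<inter> v -` {v z\<^sub>1}" by (auto simp: Z_def)
    then show ?thesis
      using continuous_closed_preimage[OF cont, of "{v z\<^sub>1}"] by auto
  qed
  then have "compact Z"
    by (metis (no_types, lifting) Z_def bounded_cball bounded_subset compact_eq_bounded_closed mem_Collect_eq subsetI)
  moreover have "Z \<noteq> {}" using z1 by (auto simp: Z_def)
  ultimately obtain z\<^sub>0 where z0: "z\<^sub>0 \<in> Z" "\<And>y. y \<in> Z \<Longrightarrow> cmod y \<le> cmod z\<^sub>0"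
    using continuous_attains_sup[of Z cmod] by (auto intro: continuous_intros)
  have max: "v y \<le> v z\<^sub>0" if "y \<in> cball 0 s" for y
    using z1 z0 that by (auto simp: Z_def)
  have "cmod z\<^sub>0 = s"
  proof (rule ccontr)
    assume "cmod z\<^sub>0 \<noteq> s"
    then have zs: "cmod z\<^sub>0 < s" using z0 by (auto simp: Z_def)
    have "\<exists>g r. r > 0 \<and> g holomorphic_on ball z\<^sub>0 r \<and>
        (\<forall>z\<in>ball z\<^sub>0 r. cmod (g z) \<le> cmod (f i z) powr p) \<and>
        cmod (g z\<^sub>0) = cmod (f i z\<^sub>0) powr p" if i: "i \<in> I" for i
    proof -
      have "z\<^sub>0 \<in> ball 0 1" using zs s by auto
      then show ?thesis
        using holomorphic_norm_powr_branch[OF f[OF i] open_ball _ p] by metis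
    qed
    then obtain g r where gr: "\<And>i. i \<in> I \<Longrightarrow> r i > (0::real)"
      "\<And>i. i \<in> I \<Longrightarrow> g i holomorphic_on ball z\<^sub>0 (r i)"
      "\<And>i z. i \<in> I \<Longrightarrow> z \<in> ball z\<^sub>0 (r i) \<Longrightarrow> cmod (g i z) \<le> cmod (f i z) powr p"
      "\<And>i. i \<in> I \<Longrightarrow> cmod (g i z\<^sub>0) = cmod (f i z\<^sub>0) powr p"
      by metis
    define R where "R = Min (insert (s - cmod z\<^sub>0) (r ` I))"
    have R: "R > 0" "R \<le> s - cmod z\<^sub>0" "\<And>i. i \<in> I \<Longrightarrow> R \<le> r i"
      using I gr(1) zs by (auto simp: R_def)
    define G where "G = (\<lambda>z. \<Sum>i\<in>I. of_real (c i) * (cnj (sgn (g i z\<^sub>0)) * g i z))"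
    have holG: "G holomorphic_on ball z\<^sub>0 R"
      unfolding G_def using R(3)
      by (intro holomorphic_intros holomorphic_on_subset[OF gr(2)] subset_ball)
    have unim: "cnj (sgn w) * w = of_real (cmod w)" for w :: complex
    proof -
      have "cnj (sgn w) * w = of_real ((cmod w)\<^sup>2) / of_real (cmod w)"
        by (simp add: sgn_eq complex_norm_square mult.commute del: of_real_power)
      then show ?thesis by (simp add: power2_eq_square)
    qed
    have G0: "G z\<^sub>0 = of_real (v z\<^sub>0)"
      using gr(4) by (simp add: G_def unim v_def)
    have Gle: "cmod (G z) \<le> v z" if z: "z \<in> ball z\<^sub>0 R" for z
    proof -
      have "cmod (G z) \<le> (\<Sum>i\<in>I. cmod (of_real (c i) * (cnj (sgn (g i z\<^sub>0)) * g i z)))"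
        unfolding G_def by (rule norm_sum)
      also have "\<dots> \<le> v z"
        unfolding v_def
      proof (intro sum_mono)
        fix i assume i: "i \<in> I"
        have "cmod (cnj (sgn (g i z\<^sub>0)) * g i z) \<le> cmod (g i z)"
          by (simp add: norm_mult norm_sgn)
        also have "\<dots> \<le> cmod (f i z) powr p"
          using gr(3)[OF i] R(3)[OF i] z by auto
        finally show "cmod (of_real (c i) * (cnj (sgn (g i z\<^sub>0)) * g i z)) \<le> c i * cmod (f i z) powr p"
          using c[OF i] by (simp add: norm_mult mult_left_mono)
      qed
      finally show ?thesis .
    qed
    have inb: "z \<in> cball 0 s" if "z \<in> ball z\<^sub>0 R" for z
      using that R(2) norm_triangle_ineq2[of z z\<^sub>0] by (auto simp: dist_norm norm_minus_commute)
    have v0: "v z\<^sub>0 \<ge> 0" unfolding v_def using c by (intro sum_nonneg) auto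
    have "G constant_on ball z\<^sub>0 R"
    proof (rule maximum_modulus_principle[OF holG])
      fix z assume z: "z \<in> ball z\<^sub>0 R"
      show "cmod (G z) \<le> cmod (G z\<^sub>0)"
        using Gle[OF z] max[OF inb[OF z]] v0 G0 by simp
    qed (use R in auto)
    then have Gc: "G z = G z\<^sub>0" if "z \<in> ball z\<^sub>0 R" for z
      using that R(1) unfolding constant_on_def by (metis centre_in_ball)
    \<comment> \<open>A point of the ball farther from 0 than \<open>z\<^sub>0\<close> by R / 2;
      constancy puts it into \<open>Z\<close>, against the choice of \<open>z\<^sub>0\<close>. At
      the origin there is no radial direction, so 1 is taken.\<close>
    define y where "y = z\<^sub>0 + (R / 2) *\<^sub>R (if z\<^sub>0 = 0 then 1 else sgn z\<^sub>0)"
    have y: "y \<in> ball z\<^sub>0 R" using R(1) by (auto simp: y_def dist_norm norm_sgn)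
    have "v y = v z\<^sub>0"
      using Gle[OF y] max[OF inb[OF y]] Gc[OF y] G0 v0 by simp
    then have "y \<in> Z" using inb[OF y] z0(1) by (simp add: Z_def)
    then have "cmod y \<le> cmod z\<^sub>0" by (rule z0(2))
    moreover have "cmod y = cmod z\<^sub>0 + R / 2"
    proof (cases "z\<^sub>0 = 0")
      case False
      have "y = (cmod z\<^sub>0 + R / 2) *\<^sub>R sgn z\<^sub>0"
        using False by (simp add: y_def sgn_div_norm distrib_right flip: scaleR_add_left) (simp add: algebra_simps)
      then show ?thesis using False R(1) by (simp add: norm_sgn)
    qed (use R(1) in \<open>simp add: y_def\<close>)
    ultimately show False using R(1) by simp
  qed
  then show ?thesis
    using max[OF z] by (intro bexI[of _ z\<^sub>0]) (auto simp: v_def)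
qed

section \<open>Integral means over circles\<close>

lemma norm_cis_diff_le: "cmod (cis a - cis b) \<le> \<bar>a - b\<bar>"
proof -
  have "dist (cis a) (cis b) \<le> 1 * dist a b"
  proof (rule lipschitz_onD[of 1 UNIV cis])
    show "1-lipschitz_on UNIV cis"
    proof (rule bounded_derivative_imp_lipschitz[where f'="\<lambda>t h. h *\<^sub>R (\<i> * cis t)"])
      show "(cis has_derivative (\<lambda>h. h *\<^sub>R (\<i> * cis t))) (at t within UNIV)" for t
        by (auto intro!: derivative_eq_intros)
      show "onorm (\<lambda>h. h *\<^sub>R (\<i> * cis t)) \<le> 1" for t
        by (rule onorm_le) (simp add: norm_mult)
    qed auto
  qed auto
  then show ?thesis by (simp add: dist_norm)
qed

text \<open>The argument is a point and not a radius: with fixed nodes x, a Riemann sum is then a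
  combination of the p-th powers of the moduli of the holomorphic functions z \<mapsto> f (z * cis
  x), to which the maximum principle for sums applies.\<close>

definition circle_integral :: "(complex \<Rightarrow> real) \<Rightarrow> complex \<Rightarrow> real" where
  "circle_integral u z = integral {-pi..pi} (\<lambda>t. u (z * cis t))"

text \<open>Uniform continuity on the closed disc makes one tagged division serve all
  \<open>z\<close> at once. This is essential, because the point of the sphere at which the sum is
  compared is found only after the division is fixed.\<close>

lemma circle_integral_approx:
  assumes u: "continuous_on (cball 0 s) u" and s: "0 < s" "s \<le> 1" and e: "e > 0"
  shows "\<exists>P :: (real \<times> real set) set. finite P \<and> (\<forall>z\<in>cball 0 s.
    \<bar>circle_integral u z - (\<Sum>(x, k)\<in>P. measure lborel k * u (z * cis x))\<bar> \<le> e)"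
proof -
  have "uniformly_continuous_on (cball 0 s) u"
    using u by (simp add: compact_uniformly_continuous)
  \<comment> \<open>The tolerance is divided by the length 2 * pi of the interval.\<close>
  then obtain d where d: "d > 0"
    "\<And>x y. x \<in> cball 0 s \<Longrightarrow> y \<in> cball 0 s \<Longrightarrow> dist y x < d \<Longrightarrow> dist (u y) (u x) < e / (2 * pi)"
    using e pi_gt_zero unfolding uniformly_continuous_on_def by (metis divide_pos_pos mult_pos_pos zero_less_numeral)
  have "gauge (\<lambda>x::real. ball x d)"
    using d(1) by (simp add: gauge_def)
  then obtain P where P: "P tagged_division_of {-pi..pi}" "(\<lambda>x. ball x d) fine P"
    using fine_division_exists_real by blast
  show ?thesis
  proof (intro exI[of _ P] conjI ballI)
    show "finite P" using P(1) by auto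
    fix z :: complex assume z: "z \<in> cball 0 s"
    define h where "h = (\<lambda>t. u (z * cis t))"
    have in_s: "z * cis t \<in> cball 0 s" for t
      using z by (simp add: norm_mult)
    have contc: "continuous_on A cis" for A by (intro continuous_intros)
    have conth: "continuous_on A h" for A
      unfolding h_def
      by (rule continuous_on_compose2[OF u]) (use in_s in \<open>auto intro!: continuous_intros contc\<close>)
    have int: "h integrable_on {-pi..pi}"
      by (intro integrable_continuous_interval conth)
    have "circle_integral u z = (\<Sum>(x, k)\<in>P. integral k h)"
      unfolding circle_integral_def h_def[symmetric]
      using integral_combine_tagged_division_topdown[of h "-pi" pi P] int P by simp
    also have "\<bar>\<dots> - (\<Sum>(x, k)\<in>P. measure lborel k * u (z * cis x))\<bar>
        = \<bar>\<Sum>(x, k)\<in>P. integral k h - measure lborel k * h x\<bar>"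
      by (simp add: h_def sum_subtractf split_def)
    also have "\<dots> \<le> (\<Sum>(x, k)\<in>P. \<bar>integral k h - measure lborel k * h x\<bar>)"
      by (rule order_trans[OF sum_abs]) (simp add: split_def)
    also have "\<dots> \<le> (\<Sum>(x, k)\<in>P. measure lborel k * (e / (2 * pi)))"
    proof (intro sum_mono, clarify)
      fix x k assume xk: "(x, k) \<in> P"
      obtain a b where k: "k = {a..b}" "x \<in> k" "k \<subseteq> {-pi..pi}"
        using tagged_division_ofD(2,3,4)[OF P(1) xk] by (auto simp: box_real)
      have ab: "a \<le> b" using k by auto
      have kb: "k \<subseteq> ball x d" using P(2) xk by (auto simp: fine_def)
      have "integral k h - measure lborel k * h x = integral {a..b} (\<lambda>t. h t - h x)"
        using ab k by (subst integral_diff) (auto intro!: integrable_continuous_interval conth)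
      also have "\<bar>\<dots>\<bar> \<le> e / (2 * pi) * (b - a)"
      proof (subst real_norm_def[symmetric], rule integral_bound[OF ab])
        show "continuous_on {a..b} (\<lambda>t. h t - h x)"
          by (intro continuous_intros conth)
        fix t assume "t \<in> {a..b}"
        then have "\<bar>t - x\<bar> < d" using kb k by (auto simp: dist_real_def subset_iff abs_minus_commute)
        moreover have "dist (z * cis t) (z * cis x) \<le> \<bar>t - x\<bar>"
        proof -
          have "dist (z * cis t) (z * cis x) = cmod z * cmod (cis t - cis x)"
            by (simp add: dist_norm norm_mult flip: right_diff_distrib)
          also have "\<dots> \<le> 1 * \<bar>t - x\<bar>"
            using z s by (intro mult_mono norm_cis_diff_le) auto
          finally show ?thesis by simp
        qed
        ultimately show "norm (h t - h x) \<le> e / (2 * pi)"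
          using d(2)[OF in_s in_s, of t x] by (simp add: h_def dist_norm)
      qed
      finally show "\<bar>integral k h - measure lborel k * h x\<bar> \<le> measure lborel k * (e / (2 * pi))"
        using ab k by (simp add: mult.commute)
    qed
    also have "\<dots> = (\<Sum>(x, k)\<in>P. measure lborel k) * (e / (2 * pi))"
      by (simp add: sum_distrib_right sum_divide_distrib split_def)
    also have "(\<Sum>(x, k)\<in>P. measure lborel k) = 2 * pi"
      using additive_content_tagged_division[of P "-pi" pi] P(1) by simp
    finally show "\<bar>circle_integral u z - (\<Sum>(x, k)\<in>P. measure lborel k * u (z * cis x))\<bar> \<le> e"
      by simp
  qed
qed

text \<open>Riemann sums at \<open>z\<close> are dominated by those at some \<open>w\<close> on the
  sphere, with an error of e / 2 at either point. Since \<open>w\<close> depends on the division and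
  hence on \<open>e\<close>, hypothesis \<open>rot\<close> is what gives a bound free of
  \<open>e\<close>.\<close>

lemma circle_integral_le:
  assumes f: "f holomorphic_on ball 0 1" and p: "p > 0" and s: "0 < s" "s < 1" and z: "cmod z \<le> s"
    and rot: "\<And>w. cmod w = s \<Longrightarrow> circle_integral (\<lambda>z. cmod (f z) powr p) w = V"
  shows "circle_integral (\<lambda>z. cmod (f z) powr p) z \<le> V"
proof (rule field_le_epsilon)
  fix e :: real assume e: "e > 0"
  let ?u = "\<lambda>z. cmod (f z) powr p"
  have "continuous_on (cball 0 s) f"
    using f s by (auto intro: holomorphic_on_imp_continuous_on[THEN continuous_on_subset])
  then have u: "continuous_on (cball 0 s) ?u"
    using p by (rule continuous_on_norm_powr)
  obtain P :: "(real \<times> real set) set" where P: "finite P"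
    "\<And>z. z \<in> cball 0 s \<Longrightarrow>
      \<bar>circle_integral ?u z - (\<Sum>(x, k)\<in>P. measure lborel k * ?u (z * cis x))\<bar> \<le> e / 2"
    using circle_integral_approx[OF u s(1) less_imp_le[OF s(2)] half_gt_zero[OF e]] by blast
  have "\<exists>w\<in>sphere 0 s. (\<Sum>i\<in>P. measure lborel (snd i) * ?u (z * cis (fst i)))
      \<le> (\<Sum>i\<in>P. measure lborel (snd i) * ?u (w * cis (fst i)))"
  proof (rule sum_norm_powr_le_sphere)
    show "(\<lambda>z. f (z * cis (fst i))) holomorphic_on ball 0 1" for i :: "real \<times> real set"
      by (rule holomorphic_on_compose_gen[OF _ f, unfolded o_def])
        (auto intro!: holomorphic_intros simp: norm_mult)
  qed (use P(1) z s p in simp_all)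
  then obtain w where w: "w \<in> sphere 0 s"
    "(\<Sum>i\<in>P. measure lborel (snd i) * ?u (z * cis (fst i)))
      \<le> (\<Sum>i\<in>P. measure lborel (snd i) * ?u (w * cis (fst i)))" ..
  have app: "\<bar>circle_integral ?u x - (\<Sum>i\<in>P. measure lborel (snd i) * ?u (x * cis (fst i)))\<bar> \<le> e / 2"
    if "cmod x \<le> s" for x
    using P(2)[of x] that by (simp add: split_def)
  have "circle_integral ?u z \<le> (\<Sum>i\<in>P. measure lborel (snd i) * ?u (z * cis (fst i))) + e / 2"
    using app[OF z] by linarith
  also have "\<dots> \<le> (\<Sum>i\<in>P. measure lborel (snd i) * ?u (w * cis (fst i))) + e / 2"
    using w by simp
  also have "\<dots> \<le> circle_integral ?u w + e"
    using app[of w] w(1) unfolding mem_sphere dist_0_norm by linarith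
  finally show "circle_integral ?u z \<le> V + e"
    using rot[of w] w by simp
qed

section \<open>Polar coordinates on the disc\<close>

lemma ball_in_sets_borel [measurable]: "ball x r \<in> sets borel"
  by (rule borel_open[OF open_ball])

lemma cis_measurable [measurable]: "cis \<in> borel_measurable borel"
  by (intro borel_measurable_continuous_onI continuous_intros)

text \<open>A double integral over both measures of \<open>f x * g (x + y)\<close>, evaluated in two ways,
  shows that translation invariant measures are proportional.\<close>

lemma nn_integral_isometry:
  fixes T :: "'a::euclidean_space \<Rightarrow> 'a" and h :: "'a \<Rightarrow> ennreal"
  assumes T: "linear T" "\<And>x. norm (T x) = norm x" and S: "\<And>x. T (S x) = x"
    and h[measurable]: "h \<in> borel_measurable borel"
  shows "(\<integral>\<^sup>+x. h (T x) \<partial>lborel) = (\<integral>\<^sup>+x. h x \<partial>lborel)"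
proof -
  interpret T: linear T by fact
  have mT[measurable]: "T \<in> borel_measurable borel"
    by (intro borel_measurable_continuous_onI linear_continuous_on linear_conv_bounded_linear[THEN iffD1] T)
  have shift: "(\<integral>\<^sup>+x. k (c + x) \<partial>lborel) = (\<integral>\<^sup>+x. k x \<partial>lborel)"
    if [measurable]: "k \<in> borel_measurable borel" for k :: "'a \<Rightarrow> ennreal" and c
    by (subst (2) lborel_distr_plus[symmetric, of c]) (simp add: nn_integral_distr)
  \<comment> \<open>The unit ball is invariant under \<open>T\<close> and under x \<mapsto> -x, and
    its measure is positive and finite, so its integral can be cancelled at the end.\<close>
  define b where "b = (indicator (ball 0 1) :: 'a \<Rightarrow> ennreal)"
  have [measurable]: "b \<in> borel_measurable borel" by (simp add: b_def)
  have bT: "b (T x) = b x" "b (- x) = b x" for x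
    by (auto simp: b_def T indicator_def)
  let ?I = "\<integral>\<^sup>+x. \<integral>\<^sup>+y. b x * h (x + T y) \<partial>lborel \<partial>lborel"
  have "?I = (\<integral>\<^sup>+x. b x * (\<integral>\<^sup>+y. h (T (S x + y)) \<partial>lborel) \<partial>lborel)"
    by (simp add: nn_integral_cmult T.add S)
  also have "\<dots> = (\<integral>\<^sup>+x. b x * (\<integral>\<^sup>+y. h (T y) \<partial>lborel) \<partial>lborel)"
    by (subst shift[where k = "\<lambda>y. h (T y)"]) auto
  finally have 1: "?I = (\<integral>\<^sup>+x. b x \<partial>lborel) * (\<integral>\<^sup>+y. h (T y) \<partial>lborel)"
    by (simp add: nn_integral_multc)
  have "?I = (\<integral>\<^sup>+y. \<integral>\<^sup>+x. b x * h (x + T y) \<partial>lborel \<partial>lborel)"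
    by (rule lborel_pair.Fubini') measurable
  also have "\<dots> = (\<integral>\<^sup>+y. \<integral>\<^sup>+x. b (T y + - x) * h x \<partial>lborel \<partial>lborel)"
  proof (rule nn_integral_cong)
    fix y :: 'a
    have "(\<integral>\<^sup>+x. b x * h (x + T y) \<partial>lborel) = (\<integral>\<^sup>+x. b (- T y + (T y + x)) * h (T y + x) \<partial>lborel)"
      by (simp add: add.commute)
    also have "\<dots> = (\<integral>\<^sup>+x. b (- T y + x) * h x \<partial>lborel)"
      by (rule shift[where k = "\<lambda>x. b (- T y + x) * h x"]) measurable
    also have "\<dots> = (\<integral>\<^sup>+x. b (T y + - x) * h x \<partial>lborel)"
      using bT(2)[of "- T y + _"] by (simp add: algebra_simps)
    finally show "(\<integral>\<^sup>+x. b x * h (x + T y) \<partial>lborel) = \<dots>" .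
  qed
  also have "\<dots> = (\<integral>\<^sup>+x. \<integral>\<^sup>+y. b (T y + - x) * h x \<partial>lborel \<partial>lborel)"
    by (rule lborel_pair.Fubini') measurable
  also have "\<dots> = (\<integral>\<^sup>+x. (\<integral>\<^sup>+y. b (T (S (- x) + y)) \<partial>lborel) * h x \<partial>lborel)"
    by (simp add: nn_integral_multc T.add S add.commute)
  also have "\<dots> = (\<integral>\<^sup>+x. (\<integral>\<^sup>+y. b y \<partial>lborel) * h x \<partial>lborel)"
    unfolding bT by (subst shift) auto
  finally have 2: "?I = (\<integral>\<^sup>+x. b x \<partial>lborel) * (\<integral>\<^sup>+x. h x \<partial>lborel)"
    by (simp add: nn_integral_cmult)
  have "(\<integral>\<^sup>+x. b x \<partial>lborel) = ennreal (unit_ball_vol DIM('a))"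
    by (simp add: b_def emeasure_ball)
  then have "(\<integral>\<^sup>+x. b x \<partial>lborel) \<noteq> 0 \<and> (\<integral>\<^sup>+x. b x \<partial>lborel) \<noteq> top"
    by (simp add: ennreal_eq_0_iff not_le)
  with 1 2 show ?thesis
    by (metis ennreal_mult_cancel_left)
qed

lemma nn_integral_rotate:
  fixes h :: "complex \<Rightarrow> ennreal"
  assumes h: "h \<in> borel_measurable borel"
  shows "(\<integral>\<^sup>+z. h (z * cis t) \<partial>lborel) = (\<integral>\<^sup>+z. h z \<partial>lborel)"
  by (rule nn_integral_isometry[where S = "\<lambda>z. z * cis (- t)"])
    (use h in \<open>auto simp: norm_mult mult.assoc cis_mult bounded_linear.linear[OF bounded_linear_mult_left]\<close>)

text \<open>Both sides integrate \<open>g\<close> against a measure on the line: the distribution of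
  the modulus on the disc, and the density 2 * pi * r on (0, 1). The two agree on half-lines, where
  each gives the area pi * (1 - x^2) of an annulus.\<close>

lemma nn_integral_cmod_disc:
  fixes g :: "real \<Rightarrow> ennreal"
  assumes g[measurable]: "g \<in> borel_measurable borel"
  shows "(\<integral>\<^sup>+z\<in>ball 0 1. g (cmod z) \<partial>lborel) = (\<integral>\<^sup>+r\<in>{0<..<1}. ennreal (2 * pi * r) * g r \<partial>lborel)"
proof -
  define M where "M = distr (density lborel (indicator (ball (0::complex) 1))) borel cmod"
  define N where "N = density lborel (\<lambda>r. ennreal (2 * pi * r) * indicator {0<..<1} r)"
  have M: "emeasure M {x<..} = ennreal (if x < 0 then pi else if x < 1 then pi * (1 - x\<^sup>2) else 0)" for x
  proof -
    have "emeasure M {x<..} = emeasure lborel (ball (0::complex) 1 - cball 0 x)"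
    proof -
      have "emeasure M {x<..} = (\<integral>\<^sup>+r. indicator {x<..} r \<partial>M)"
        by (simp add: M_def)
      also have "\<dots> = (\<integral>\<^sup>+z. indicator (ball 0 1) z * indicator {x<..} (cmod z) \<partial>lborel)"
        unfolding M_def by (subst nn_integral_distr, simp, simp, subst nn_integral_density) auto
      also have "\<dots> = (\<integral>\<^sup>+z. indicator (ball (0::complex) 1 - cball 0 x) z \<partial>lborel)"
        by (intro nn_integral_cong) (auto simp: indicator_def)
      finally show ?thesis by simp
    qed
    also have "\<dots> = ennreal (if x < 0 then pi else if x < 1 then pi * (1 - x\<^sup>2) else 0)"
    proof -
      consider "x < 0" | "0 \<le> x" "x < 1" | "x \<ge> 1" by linarith
      then show ?thesis
      proof cases
        case 2
        then have "emeasure lborel (ball (0::complex) 1 - cball 0 x) = emeasure lborel (ball (0::complex) 1) - emeasure lborel (cball (0::complex) x)"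
          by (intro emeasure_Diff) (auto simp: emeasure_cball)
        also have "\<dots> = ennreal pi - ennreal (pi * x\<^sup>2)"
          using 2 by (simp add: emeasure_ball emeasure_cball unit_ball_vol_2)
        also have "\<dots> = ennreal (pi * (1 - x\<^sup>2))"
          using 2 by (subst ennreal_minus) (auto simp: algebra_simps)
        finally show ?thesis using 2 by simp
      next
        case 3
        then have "ball (0::complex) 1 - cball 0 x = {}" by auto
        then show ?thesis using 3 by (simp only: emeasure_empty) simp
      qed (simp add: emeasure_ball unit_ball_vol_2)
    qed
    finally show ?thesis .
  qed
  have N: "emeasure N {x<..} = ennreal (if x < 0 then pi else if x < 1 then pi * (1 - x\<^sup>2) else 0)" for x
  proof -
    \<comment> \<open>Clamping x to [0, 1] treats x < 0, 0 \<le> x < 1 and x \<ge> 1 at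
      once.\<close>
    define m where "m = max 0 (min x 1)"
    have "emeasure N {x<..} = (\<integral>\<^sup>+r. ennreal (2 * pi * r) * indicator {0<..<1} r * indicator {x<..} r \<partial>lborel)"
      unfolding N_def by (subst emeasure_density) auto
    also have "\<dots> = (\<integral>\<^sup>+r. ennreal (2 * pi * r) * indicator {m..1} r \<partial>lborel)"
    proof (rule nn_integral_cong_AE)
      show "AE r in lborel. ennreal (2 * pi * r) * indicator {0<..<1} r * indicator {x<..} r =
          ennreal (2 * pi * r) * indicator {m..1} r"
        using AE_lborel_singleton[of m] AE_lborel_singleton[of "1::real"]
        by eventually_elim (auto simp: m_def indicator_def)
    qed
    also have "\<dots> = ennreal (pi * 1\<^sup>2 - pi * m\<^sup>2)"
      by (rule nn_integral_FTC_Icc) (auto simp: m_def intro!: derivative_eq_intros)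
    also have "pi * 1\<^sup>2 - pi * m\<^sup>2 = (if x < 0 then pi else if x < 1 then pi * (1 - x\<^sup>2) else 0)"
      by (auto simp: m_def algebra_simps)
    finally show ?thesis .
  qed
  have "M = N"
  proof (rule measure_eqI_lessThan)
    show "sets M = sets borel" "sets N = sets borel" by (simp_all add: M_def N_def)
  qed (simp_all add: M N)
  have "(\<integral>\<^sup>+z\<in>ball 0 1. g (cmod z) \<partial>lborel) = (\<integral>\<^sup>+r. g r \<partial>M)"
    by (simp add: M_def nn_integral_distr nn_integral_density mult.commute)
  also have "\<dots> = (\<integral>\<^sup>+r\<in>{0<..<1}. ennreal (2 * pi * r) * g r \<partial>lborel)"
    unfolding \<open>M = N\<close> by (simp add: N_def nn_integral_density ac_simps)
  finally show ?thesis .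
qed

text \<open>The substitution t + Arg z moves the window [-pi, pi] by Arg z, and the integrand has
  period 2 * pi. The window is made half-open first, so that the piece pushed out at one end,
  translated by a period, fits the gap at the other end without overlap.\<close>

lemma nn_integral_circle_rotate:
  fixes h :: "complex \<Rightarrow> ennreal"
  assumes h[measurable]: "h \<in> borel_measurable borel"
  shows "(\<integral>\<^sup>+t\<in>{-pi..pi}. h (z * cis t) \<partial>lborel) = (\<integral>\<^sup>+t\<in>{-pi..pi}. h (of_real (cmod z) * cis t) \<partial>lborel)"
proof -
  define a where "a = Arg z"
  have a: "-pi < a" "a \<le> pi" using Arg_bounded[of z] by (auto simp: a_def)
  have z: "z = of_real (cmod z) * cis a"
    by (metis a_def rcis_def rcis_cmod_Arg)
  define k where "k = (\<lambda>t. h (of_real (cmod z) * cis t))"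
  have k[measurable]: "k \<in> borel_measurable borel" by (simp add: k_def)
  have per: "k (t + 2 * pi) = k t" for t
    by (simp add: k_def cis.code)
  have "(\<integral>\<^sup>+t\<in>{-pi..pi}. h (z * cis t) \<partial>lborel) = (\<integral>\<^sup>+t. k (t + a) * indicator {-pi..pi} t \<partial>lborel)"
    by (subst z) (simp add: k_def mult.assoc cis_mult add.commute)
  also have "\<dots> = (\<integral>\<^sup>+t. k t * indicator {-pi..pi} (t - a) \<partial>lborel)"
    by (subst nn_integral_real_affine[where c = 1 and t = "-a"]) auto
  also have "\<dots> = (\<integral>\<^sup>+t. k t * indicator {-pi<..pi} (t - a) \<partial>lborel)"
    by (intro nn_integral_cong_AE, use AE_lborel_singleton[of "a - pi"] in eventually_elim)
      (auto simp: indicator_def)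
  also have "\<dots> = (\<integral>\<^sup>+t. k t * indicator {-pi<..pi} t \<partial>lborel)"
  proof -
    let ?J = "\<lambda>A. \<integral>\<^sup>+t. k t * indicator A t \<partial>lborel"
    have split: "?J (A \<union> B) = ?J A + ?J B" if "A \<inter> B = {}" "A \<in> sets borel" "B \<in> sets borel" for A B
      using that by (subst nn_integral_add[symmetric]) (auto simp: indicator_def intro!: nn_integral_cong)
    have tr: "?J {u<..v} = ?J {u + 2 * pi<..v + 2 * pi}" for u v
      by (subst nn_integral_real_affine[where c = 1 and t = "2 * pi"])
        (auto simp: per add.commute[of "2 * pi"] indicator_def intro!: nn_integral_cong)
    have "(\<integral>\<^sup>+t. k t * indicator {-pi<..pi} (t - a) \<partial>lborel) = ?J {a - pi<..a + pi}"
      by (intro nn_integral_cong) (auto simp: indicator_def)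
    also have "\<dots> = ?J {-pi<..pi}"
    proof (cases "a \<ge> 0")
      case True
      have "?J {a - pi<..a + pi} = ?J ({a - pi<..pi} \<union> {pi<..a + pi})"
        using True a by (intro arg_cong[where f = ?J]) auto
      also have "\<dots> = ?J {a - pi<..pi} + ?J {pi<..a + pi}"
        using True by (intro split) auto
      also have "?J {pi<..a + pi} = ?J {-pi<..a - pi}"
        by (subst tr[of "-pi"]) (simp add: algebra_simps)
      also have "?J {a - pi<..pi} + ?J {-pi<..a - pi} = ?J ({a - pi<..pi} \<union> {-pi<..a - pi})"
        using True by (intro split[symmetric]) auto
      also have "{a - pi<..pi} \<union> {-pi<..a - pi} = {-pi<..pi}"
        using True a by auto
      finally show ?thesis .
    next
      case False
      have "?J {a - pi<..a + pi} = ?J ({a - pi<..-pi} \<union> {-pi<..a + pi})"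
        using False a by (intro arg_cong[where f = ?J]) auto
      also have "\<dots> = ?J {a - pi<..-pi} + ?J {-pi<..a + pi}"
        using False by (intro split) auto
      also have "?J {a - pi<..-pi} = ?J {a + pi<..pi}"
        by (subst tr) (simp add: algebra_simps)
      also have "?J {a + pi<..pi} + ?J {-pi<..a + pi} = ?J ({a + pi<..pi} \<union> {-pi<..a + pi})"
        using False by (intro split[symmetric]) auto
      also have "{a + pi<..pi} \<union> {-pi<..a + pi} = {-pi<..pi}"
        using False a by auto
      finally show ?thesis .
    qed
    finally show ?thesis .
  qed
  also have "\<dots> = (\<integral>\<^sup>+t\<in>{-pi..pi}. k t \<partial>lborel)"
    by (intro nn_integral_cong_AE, use AE_lborel_singleton[of "-pi"] in eventually_elim)
      (auto simp: indicator_def)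
  finally show ?thesis by (simp add: k_def)
qed

text \<open>Rotation invariance integrated over all angles. It replaces \<open>h\<close> by a
  function of the modulus alone and so reduces polar coordinates to the radial case.\<close>

lemma nn_integral_disc_mean:
  fixes h :: "complex \<Rightarrow> ennreal"
  assumes h[measurable]: "h \<in> borel_measurable borel"
  shows "ennreal (2 * pi) * (\<integral>\<^sup>+z\<in>ball 0 1. h z \<partial>lborel) =
    (\<integral>\<^sup>+z\<in>ball 0 1. (\<integral>\<^sup>+t\<in>{-pi..pi}. h (z * cis t) \<partial>lborel) \<partial>lborel)"
proof -
  have "(\<integral>\<^sup>+z\<in>ball 0 1. (\<integral>\<^sup>+t\<in>{-pi..pi}. h (z * cis t) \<partial>lborel) \<partial>lborel) =
     (\<integral>\<^sup>+z. \<integral>\<^sup>+t. h (z * cis t) * indicator {-pi..pi} t * indicator (ball 0 1) z \<partial>lborel \<partial>lborel)"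
    by (simp add: nn_integral_multc)
  also have "\<dots> = (\<integral>\<^sup>+t. \<integral>\<^sup>+z. h (z * cis t) * indicator {-pi..pi} t * indicator (ball 0 1) z \<partial>lborel \<partial>lborel)"
    by (rule lborel_pair.Fubini') measurable
  also have "\<dots> = (\<integral>\<^sup>+t. (\<integral>\<^sup>+z\<in>ball 0 1. h z \<partial>lborel) * indicator {-pi..pi} t \<partial>lborel)"
  proof (intro nn_integral_cong)
    fix t :: real
    have "(\<integral>\<^sup>+z. h (z * cis t) * indicator {-pi..pi} t * indicator (ball 0 1) z \<partial>lborel)
        = (\<integral>\<^sup>+z. h (z * cis t) * indicator (ball 0 1) (z * cis t) * indicator {-pi..pi} t \<partial>lborel)"
      by (intro nn_integral_cong) (auto simp: indicator_def norm_mult)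
    also have "\<dots> = (\<integral>\<^sup>+z. h (z * cis t) * indicator (ball 0 1) (z * cis t) \<partial>lborel) * indicator {-pi..pi} t"
      by (simp add: nn_integral_multc)
    also have "(\<integral>\<^sup>+z. h (z * cis t) * indicator (ball 0 1) (z * cis t) \<partial>lborel) = (\<integral>\<^sup>+z\<in>ball 0 1. h z \<partial>lborel)"
      by (rule nn_integral_rotate[where h = "\<lambda>z. h z * indicator (ball 0 1) z"]) measurable
    finally show "(\<integral>\<^sup>+z. h (z * cis t) * indicator {-pi..pi} t * indicator (ball 0 1) z \<partial>lborel) =
      (\<integral>\<^sup>+z\<in>ball 0 1. h z \<partial>lborel) * indicator {-pi..pi} t" .
  qed
  also have "\<dots> = ennreal (2 * pi) * (\<integral>\<^sup>+z\<in>ball 0 1. h z \<partial>lborel)"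
    by (subst nn_integral_cmult) (simp_all add: mult.commute)
  finally show ?thesis ..
qed

lemma nn_integral_polar_disc:
  fixes h :: "complex \<Rightarrow> ennreal"
  assumes h[measurable]: "h \<in> borel_measurable borel"
  shows "(\<integral>\<^sup>+z\<in>ball 0 1. h z \<partial>lborel) =
    (\<integral>\<^sup>+r\<in>{0<..<1}. ennreal r * (\<integral>\<^sup>+t\<in>{-pi..pi}. h (of_real r * cis t) \<partial>lborel) \<partial>lborel)"
proof -
  define H where "H = (\<lambda>r. \<integral>\<^sup>+t\<in>{-pi..pi}. h (of_real r * cis t) \<partial>lborel)"
  have H[measurable]: "H \<in> borel_measurable borel"
    unfolding H_def by measurable
  have "ennreal (2 * pi) * (\<integral>\<^sup>+z\<in>ball 0 1. h z \<partial>lborel) = (\<integral>\<^sup>+z\<in>ball 0 1. H (cmod z) \<partial>lborel)"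
    by (subst nn_integral_disc_mean[OF h], subst nn_integral_circle_rotate[OF h]) (simp add: H_def)
  also have "\<dots> = (\<integral>\<^sup>+r\<in>{0<..<1}. ennreal (2 * pi * r) * H r \<partial>lborel)"
    by (rule nn_integral_cmod_disc[OF H])
  also have "\<dots> = (\<integral>\<^sup>+r. ennreal (2 * pi) * (ennreal r * H r * indicator {0<..<1} r) \<partial>lborel)"
    by (intro nn_integral_cong) (auto simp: indicator_def ennreal_mult mult.assoc)
  also have "\<dots> = ennreal (2 * pi) * (\<integral>\<^sup>+r\<in>{0<..<1}. ennreal r * H r \<partial>lborel)"
    by (rule nn_integral_cmult) measurable
  finally show ?thesis
    using pi_gt_zero by (subst (asm) ennreal_mult_cancel_left) (auto simp: H_def ennreal_eq_0_iff)
qed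

section \<open>Local estimates\<close>

text \<open>Cut off at the disc because \<open>f\<close> is arbitrary, and possibly not measurable,
  outside it.\<close>

definition disc_powr :: "real \<Rightarrow> (complex \<Rightarrow> complex) \<Rightarrow> complex \<Rightarrow> ennreal" where
  "disc_powr p f z = ennreal (cmod (f z) powr p) * indicator unit_disc z"

lemma holomorphic_disc_measurable:
  assumes "f holomorphic_on unit_disc"
  shows "(\<lambda>z. f z * indicator unit_disc z) \<in> borel_measurable borel"
proof -
  have "(\<lambda>z. indicator unit_disc z *\<^sub>R f z) \<in> borel_measurable borel"
    by (rule borel_measurable_continuous_on_indicator)
      (use assms in \<open>auto intro: holomorphic_on_imp_continuous_on\<close>)
  also have "(\<lambda>z. indicator unit_disc z *\<^sub>R f z) = (\<lambda>z. f z * indicator unit_disc z)"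
    by (auto simp: indicator_def fun_eq_iff)
  finally show ?thesis .
qed

lemma disc_powr_measurable [measurable]:
  assumes f: "f holomorphic_on unit_disc"
  shows "disc_powr p f \<in> borel_measurable borel"
proof -
  note [measurable] = holomorphic_disc_measurable[OF f]
  have "disc_powr p f = (\<lambda>z. ennreal (cmod (f z * indicator unit_disc z) powr p) * indicator unit_disc z)"
    by (auto simp: disc_powr_def fun_eq_iff indicator_def)
  then show ?thesis by simp
qed

lemma nn_circle_integral:
  assumes u: "continuous_on (cball 0 (cmod z)) u" and nonneg: "\<And>w. 0 \<le> u w"
  shows "(\<integral>\<^sup>+t\<in>{-pi..pi}. ennreal (u (z * cis t)) \<partial>lborel) = ennreal (circle_integral u z)"
proof -
  let ?g = "\<lambda>t. indicator {-pi..pi} t * u (z * cis t)"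
  have c: "continuous_on {-pi..pi} (\<lambda>t. u (z * cis t))"
    by (rule continuous_on_compose2[OF u]) (auto intro!: continuous_intros simp: norm_mult)
  have "(\<integral>\<^sup>+t\<in>{-pi..pi}. ennreal (u (z * cis t)) \<partial>lborel) = (\<integral>\<^sup>+t. ennreal (?g t) \<partial>lborel)"
    by (intro nn_integral_cong) (auto simp: indicator_def)
  also have "\<dots> = ennreal (circle_integral u z)"
  proof (rule nn_integral_has_integral_lborel)
    show "?g \<in> borel_measurable borel"
      using borel_measurable_continuous_on_indicator[OF _ c] by simp
    have "((\<lambda>t. u (z * cis t)) has_integral circle_integral u z) {-pi..pi}"
      unfolding circle_integral_def
      by (intro integrable_integral integrable_continuous_interval c)
    then show "(?g has_integral circle_integral u z) UNIV"
      by (subst (asm) has_integral_restrict_UNIV[symmetric])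
        (auto elim!: has_integral_eq[rotated] simp: indicator_def)
  qed (use nonneg in auto)
  finally show ?thesis .
qed

text \<open>Hardy's monotonicity of integral means. The radius |w| is the sphere in
  \<open>circle_integral_le\<close>, whose hypothesis \<open>rot\<close> is the rotation invariance
  of circle integrals; w = 0 is set apart since that sphere needs a positive radius.\<close>

lemma circle_mean_mono:
  assumes f: "f holomorphic_on unit_disc" and p: "p > 0" and zw: "cmod z \<le> cmod w" "cmod w < 1"
  shows "(\<integral>\<^sup>+t\<in>{-pi..pi}. disc_powr p f (z * cis t) \<partial>lborel)
    \<le> (\<integral>\<^sup>+t\<in>{-pi..pi}. disc_powr p f (w * cis t) \<partial>lborel)"
proof (cases "cmod w = 0")
  case True
  then show ?thesis using zw by simp
next
  case False
  let ?u = "\<lambda>z. cmod (f z) powr p"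
  have cont: "continuous_on (cball 0 (cmod v)) ?u" if "cmod v < 1" for v
    using that f p
    by (intro continuous_on_norm_powr) (auto intro: holomorphic_on_imp_continuous_on[THEN continuous_on_subset])
  have eq: "(\<integral>\<^sup>+t\<in>{-pi..pi}. disc_powr p f (v * cis t) \<partial>lborel) = ennreal (circle_integral ?u v)"
    if "cmod v < 1" for v
    using nn_circle_integral[OF cont[OF that]] that by (simp add: disc_powr_def norm_mult)
  have nn: "circle_integral ?u v \<ge> 0" for v
    by (cases "(\<lambda>t. cmod (f (v * cis t)) powr p) integrable_on {-pi..pi}")
      (auto simp: circle_integral_def not_integrable_integral intro: integral_nonneg)
  have "circle_integral ?u z \<le> circle_integral ?u w"
  proof (rule circle_integral_le[OF f p])
    fix v assume v: "cmod v = cmod w"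
    have "ennreal (circle_integral ?u v) = ennreal (circle_integral ?u w)"
      using eq[of v] eq[of w] v zw
        nn_integral_circle_rotate[OF disc_powr_measurable[OF f, of p], of v]
        nn_integral_circle_rotate[OF disc_powr_measurable[OF f, of p], of w] by simp
    then show "circle_integral ?u v = circle_integral ?u w"
      using nn by simp
  qed (use zw False in auto)
  then show ?thesis
    using zw by (simp add: eq ennreal_leI)
qed

text \<open>The area version of the mean value inequality: the circle of radius 0 has the smallest
  mean, and this is integrated against r dr.\<close>

lemma norm_powr_le_unit_disc:
  assumes f: "f holomorphic_on unit_disc" and p: "p > 0"
  shows "ennreal (pi * cmod (f 0) powr p) \<le> (\<integral>\<^sup>+z. disc_powr p f z \<partial>lborel)"
proof -
  let ?c = "cmod (f 0) powr p"
  have "ennreal (pi * ?c) = ennreal (pi * ?c * 1\<^sup>2 - pi * ?c * 0\<^sup>2)" by simp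
  also have "\<dots> = (\<integral>\<^sup>+r. ennreal (2 * pi * ?c * r) * indicator {0..1} r \<partial>lborel)"
    by (rule nn_integral_FTC_Icc[symmetric]) (auto intro!: derivative_eq_intros)
  also have "\<dots> = (\<integral>\<^sup>+r\<in>{0<..<1}. ennreal r * (ennreal (2 * pi) * disc_powr p f 0) \<partial>lborel)"
    by (intro nn_integral_cong_AE, use AE_lborel_singleton[of 0] AE_lborel_singleton[of 1] in eventually_elim)
      (auto simp: indicator_def disc_powr_def ac_simps simp flip: ennreal_mult')
  also have "\<dots> \<le> (\<integral>\<^sup>+r\<in>{0<..<1}. ennreal r *
      (\<integral>\<^sup>+t\<in>{-pi..pi}. disc_powr p f (of_real r * cis t) \<partial>lborel) \<partial>lborel)"
  proof (rule nn_integral_mono)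
    fix r :: real
    show "ennreal r * (ennreal (2 * pi) * disc_powr p f 0) * indicator {0<..<1} r \<le>
      ennreal r * (\<integral>\<^sup>+t\<in>{-pi..pi}. disc_powr p f (of_real r * cis t) \<partial>lborel) * indicator {0<..<1} r"
    proof (cases "r \<in> {0<..<1}")
      case True
      have "ennreal (2 * pi) * disc_powr p f 0 = (\<integral>\<^sup>+t\<in>{-pi..pi}. disc_powr p f (0 * cis t) \<partial>lborel)"
        by (subst mult_zero_left, subst nn_integral_cmult) (simp_all add: mult.commute)
      also have "\<dots> \<le> (\<integral>\<^sup>+t\<in>{-pi..pi}. disc_powr p f (of_real r * cis t) \<partial>lborel)"
        using True by (intro circle_mean_mono f p) auto
      finally show ?thesis by (intro mult_right_mono mult_left_mono) auto
    qed auto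
  qed
  also have "\<dots> = (\<integral>\<^sup>+z\<in>unit_disc. disc_powr p f z \<partial>lborel)"
    by (rule nn_integral_polar_disc[symmetric]) (use f in measurable)
  also have "\<dots> = (\<integral>\<^sup>+z. disc_powr p f z \<partial>lborel)"
    by (intro nn_integral_cong) (auto simp: disc_powr_def indicator_def)
  finally show ?thesis .
qed

lemma nn_integral_affine:
  fixes h :: "'a::euclidean_space \<Rightarrow> ennreal"
  assumes [measurable]: "h \<in> borel_measurable borel" and c: "c \<noteq> 0"
  shows "(\<integral>\<^sup>+x. h x \<partial>lborel) = ennreal (\<bar>c\<bar> ^ DIM('a)) * (\<integral>\<^sup>+x. h (t + c *\<^sub>R x) \<partial>lborel)"
  by (subst lborel_affine[OF c, of t])
    (simp add: nn_integral_density nn_integral_distr nn_integral_cmult)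

text \<open>Rescaling to the unit disc. A Borel majorant \<open>h\<close> replaces |f|^p, so that
  the integral may be taken over a larger set than the ball, such as a Whitney ball containing
  it.\<close>

lemma norm_powr_le_ball:
  assumes f: "f holomorphic_on ball w \<rho>" and p: "p > 0" and r: "\<rho> > 0"
    and h[measurable]: "h \<in> borel_measurable borel"
    and fh: "\<And>z. z \<in> ball w \<rho> \<Longrightarrow> ennreal (cmod (f z) powr p) \<le> h z"
  shows "ennreal (pi * \<rho>\<^sup>2 * cmod (f w) powr p) \<le> (\<integral>\<^sup>+z. h z \<partial>lborel)"
proof -
  let ?F = "\<lambda>z. f (w + \<rho> *\<^sub>R z)"
  have in_ball: "w + \<rho> *\<^sub>R z \<in> ball w \<rho>" if "z \<in> unit_disc" for z
    using that r by (simp add: dist_norm)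
  have F: "?F holomorphic_on unit_disc"
    by (rule holomorphic_on_compose_gen[OF _ f, unfolded o_def])
      (use in_ball in \<open>auto intro!: holomorphic_intros simp: scaleR_conv_of_real\<close>)
  have "ennreal (pi * \<rho>\<^sup>2 * cmod (f w) powr p) = ennreal (\<rho>\<^sup>2) * ennreal (pi * cmod (?F 0) powr p)"
    by (simp add: ac_simps flip: ennreal_mult')
  also have "\<dots> \<le> ennreal (\<rho>\<^sup>2) * (\<integral>\<^sup>+z. disc_powr p ?F z \<partial>lborel)"
    by (intro mult_left_mono norm_powr_le_unit_disc F p) simp
  also have "\<dots> \<le> ennreal (\<rho>\<^sup>2) * (\<integral>\<^sup>+z. h (w + \<rho> *\<^sub>R z) \<partial>lborel)"
    using fh[OF in_ball] by (intro mult_left_mono nn_integral_mono) (auto simp: disc_powr_def indicator_def)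
  also have "\<dots> = (\<integral>\<^sup>+z. h z \<partial>lborel)"
    using nn_integral_affine[OF h, of \<rho> w] r by simp
  finally show ?thesis .
qed

text \<open>A Euclidean substitute for a pseudohyperbolic disc: on it the distance to the unit
  circle is comparable to that of the centre.\<close>

definition whitney_ball :: "complex \<Rightarrow> complex set" where
  "whitney_ball z = ball z ((1 - cmod z) / 2)"

text \<open>The area of the ball is pi / 4 times (1 - |z|)^2, so this is the true mean up to that
  factor.\<close>

definition whitney_mean :: "real \<Rightarrow> (complex \<Rightarrow> complex) \<Rightarrow> complex \<Rightarrow> ennreal" where
  "whitney_mean p f z = ennreal (1 / (1 - cmod z)\<^sup>2) *
     (\<integral>\<^sup>+u. disc_powr p f u * indicator (whitney_ball z) u \<partial>lborel)"

lemma norm_powr_le_whitney_mean: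
  assumes f: "f holomorphic_on unit_disc" and p: "p > 0" and z: "cmod z < 1"
    and w: "dist z w \<le> (1 - cmod z) / 4"
  shows "ennreal (cmod (f w) powr p) \<le> ennreal (16 / pi) * whitney_mean p f z"
proof -
  define d where "d = 1 - cmod z"
  have d: "d > 0" using z by (simp add: d_def)
  have sub: "ball w (d / 4) \<subseteq> whitney_ball z" "whitney_ball z \<subseteq> unit_disc"
  proof -
    show "ball w (d / 4) \<subseteq> whitney_ball z"
    proof
      fix u assume "u \<in> ball w (d / 4)"
      then show "u \<in> whitney_ball z"
        using w dist_triangle[of z u w] unfolding whitney_ball_def mem_ball d_def by linarith
    qed
    show "whitney_ball z \<subseteq> unit_disc"
      unfolding whitney_ball_def by (intro ball_subset_ball_iff[THEN iffD2]) (use z in \<open>auto simp: field_simps\<close>)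
  qed
  have [measurable]: "whitney_ball z \<in> sets borel" by (simp add: whitney_ball_def)
  have "ennreal (pi * (d / 4)\<^sup>2 * cmod (f w) powr p) \<le>
      (\<integral>\<^sup>+u. disc_powr p f u * indicator (whitney_ball z) u \<partial>lborel)"
  proof (rule norm_powr_le_ball[where f = f and w = w])
    show "f holomorphic_on ball w (d / 4)"
      using f sub by (meson holomorphic_on_subset subset_trans)
    show "(\<lambda>u. disc_powr p f u * indicator (whitney_ball z) u) \<in> borel_measurable borel"
      using f by measurable
    fix u assume "u \<in> ball w (d / 4)"
    then have "u \<in> whitney_ball z" "u \<in> unit_disc" using sub by blast+
    then show "ennreal (cmod (f u) powr p) \<le> disc_powr p f u * indicator (whitney_ball z) u"
      by (simp add: disc_powr_def)
  qed (use p d in auto)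
  then have "ennreal (16 / (pi * d\<^sup>2)) * ennreal (pi * (d / 4)\<^sup>2 * cmod (f w) powr p) \<le>
      ennreal (16 / (pi * d\<^sup>2)) * (\<integral>\<^sup>+u. disc_powr p f u * indicator (whitney_ball z) u \<partial>lborel)"
    by (intro mult_left_mono) auto
  also have "ennreal (16 / (pi * d\<^sup>2)) = ennreal (16 / pi) * ennreal (1 / d\<^sup>2)"
    by (simp flip: ennreal_mult')
  also have "ennreal (16 / pi) * ennreal (1 / d\<^sup>2) * ennreal (pi * (d / 4)\<^sup>2 * cmod (f w) powr p) = ennreal (cmod (f w) powr p)"
    using d by (simp add: power_divide flip: ennreal_mult')
  finally show ?thesis
    by (simp add: whitney_mean_def d_def mult.assoc)
qed

lemma add_powr_le:
  fixes a b :: real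
  assumes "a \<ge> 0" "b \<ge> 0" "p > 0"
  shows "(a + b) powr p \<le> 2 powr p * (a powr p + b powr p)"
proof -
  have "(a + b) powr p \<le> (2 * max a b) powr p"
    using assms by (intro powr_mono2) auto
  also have "\<dots> = 2 powr p * max a b powr p"
    by (simp add: powr_mult)
  also have "\<dots> \<le> 2 powr p * (a powr p + b powr p)"
    by (intro mult_left_mono) (auto simp: max_def)
  finally show ?thesis .
qed

lemma cmod_one_minus_cnj_mult_le:
  assumes "cmod z < 1" "cmod w < 1"
  shows "cmod (1 - cnj z * w) \<le> 2 * (1 - cmod z) + dist z w"
proof -
  have "1 - cnj z * w = of_real (1 - (cmod z)\<^sup>2) + cnj z * (z - w)"
    by (simp only: of_real_diff of_real_1 complex_norm_square) (simp add: algebra_simps)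
  then have "cmod (1 - cnj z * w) \<le> cmod (of_real (1 - (cmod z)\<^sup>2)) + cmod (cnj z * (z - w))"
    by (metis norm_triangle_ineq)
  also have "cmod (of_real (1 - (cmod z)\<^sup>2)) = \<bar>1 - (cmod z)\<^sup>2\<bar>"
    by (rule norm_of_real)
  also have "\<dots> = (1 - cmod z) * (1 + cmod z)"
    using assms power_le_one[of "cmod z" 2] by (simp add: power2_eq_square algebra_simps)
  also have "\<dots> \<le> (1 - cmod z) * 2"
    using assms by (intro mult_left_mono) auto
  also have "cmod (cnj z * (z - w)) \<le> 1 * dist z w"
    unfolding norm_mult dist_norm using assms by (intro mult_right_mono) auto
  finally show ?thesis by simp
qed

lemma cmod_one_minus_cnj_mult_ge:
  assumes "cmod z < 1" "cmod w < 1"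
  shows "1 - cmod z \<le> cmod (1 - cnj z * w)"
proof -
  have "cmod (cnj z * w) \<le> cmod z * 1"
    unfolding norm_mult complex_mod_cnj using assms by (intro mult_left_mono) auto
  then show ?thesis
    using norm_triangle_ineq2[of 1 "cnj z * w"] by simp
qed

lemma pseudohyperbolic_dist_eq:
  "pseudohyperbolic_dist z w = dist z w / cmod (1 - cnj z * w)"
  by (simp add: pseudohyperbolic_dist_def norm_divide dist_norm)

text \<open>Far points, with dist z w > d / 8, have pseudohyperbolic distance at least 1 / 17, and
  the triangle inequality suffices. For near points Cauchy's estimate bounds the derivative by the
  mean at \<open>z\<close> alone. The constants arising are 34 = 2 * 17 and 24, of which the larger
  is stated.\<close>

lemma powr_diff_le_whitney_mean:
  assumes f: "f holomorphic_on unit_disc" and p: "p > 0" and z: "cmod z < 1" and w: "cmod w < 1"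
  shows "ennreal (cmod (f z - f w) powr p) \<le> ennreal (34 powr p * 16 / pi) *
    (ennreal (pseudohyperbolic_dist z w powr p) * (whitney_mean p f z + whitney_mean p f w))"
proof -
  define d where "d = 1 - cmod z"
  have d: "d > 0" using z by (simp add: d_def)
  define s where "s = pseudohyperbolic_dist z w"
  have den: "0 < cmod (1 - cnj z * w)" "cmod (1 - cnj z * w) \<le> 2 * d + dist z w"
    using cmod_one_minus_cnj_mult_ge[OF z w] cmod_one_minus_cnj_mult_le[OF z w] d by (auto simp: d_def)
  have s: "s \<ge> 0" "dist z w \<le> s * (2 * d + dist z w)"
  proof -
    show "s \<ge> 0" by (simp add: s_def pseudohyperbolic_dist_def)
    then have "s * cmod (1 - cnj z * w) \<le> s * (2 * d + dist z w)"
      using den by (intro mult_left_mono) auto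
    then show "dist z w \<le> s * (2 * d + dist z w)"
      using den by (simp add: s_def pseudohyperbolic_dist_eq)
  qed
  show ?thesis
  proof (cases "dist z w \<le> d / 8")
    case False
    \<comment> \<open>Here 2 * d < 16 * dist z w.\<close>
    have "dist z w \<le> s * (16 * dist z w + dist z w)"
      using False s by (intro order_trans[OF s(2)] mult_left_mono) auto
    moreover have "dist z w > 0" using False d by linarith
    ultimately have "1 \<le> 17 * s" by (simp add: field_simps)
    then have s1: "1 \<le> (17 * s) powr p"
      using p by (intro ge_one_powr_ge_zero) auto
    have "cmod (f z - f w) powr p \<le> (cmod (f z) + cmod (f w)) powr p"
      using p by (intro powr_mono2) (auto simp: norm_triangle_ineq4)
    also have "\<dots> \<le> 2 powr p * (cmod (f z) powr p + cmod (f w) powr p)"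
      using p by (intro add_powr_le) auto
    also have "\<dots> \<le> (2 powr p * (cmod (f z) powr p + cmod (f w) powr p)) * (17 * s) powr p"
      using mult_left_mono[OF s1, of "2 powr p * (cmod (f z) powr p + cmod (f w) powr p)"] by simp
    also have "\<dots> = 34 powr p * s powr p * (cmod (f z) powr p + cmod (f w) powr p)"
      using s powr_mult[of 2 17 p] by (simp add: powr_mult)
    finally have "ennreal (cmod (f z - f w) powr p) \<le>
        ennreal (34 powr p * s powr p) * (ennreal (cmod (f z) powr p) + ennreal (cmod (f w) powr p))"
      by (simp add: ennreal_leI flip: ennreal_mult' ennreal_plus)
    also have "\<dots> \<le> ennreal (34 powr p * s powr p) *
        (ennreal (16 / pi) * whitney_mean p f z + ennreal (16 / pi) * whitney_mean p f w)"
      using z w by (intro mult_left_mono add_mono norm_powr_le_whitney_mean f p) auto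
    also have "\<dots> = ennreal (34 powr p * 16 / pi) *
        (ennreal (s powr p) * (whitney_mean p f z + whitney_mean p f w))"
    proof -
      have "ennreal (34 powr p * 16 / pi) = ennreal (34 powr p) * ennreal (16 / pi)"
        "ennreal (34 powr p * s powr p) = ennreal (34 powr p) * ennreal (s powr p)"
        by (simp_all flip: ennreal_mult')
      then show ?thesis by (simp only: distrib_left ac_simps)
    qed
    finally show ?thesis by (simp add: s_def)
  next
    case True
    show ?thesis
    \<comment> \<open>The value infinity is dealt with formally: it makes the right side infinite
      unless z = w, when the left side is 0.\<close>
    proof (cases "whitney_mean p f z = \<infinity>")
      case True
      show ?thesis
      proof (cases "z = w")
        case False
        then have "s > 0" using den by (simp add: s_def pseudohyperbolic_dist_eq)
        then show ?thesis using True p pi_gt_zero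
          by (simp add: s_def[symmetric] ennreal_mult_eq_top_iff ennreal_eq_0_iff not_le)
      qed (use p in auto)
    next
      case False
      then obtain B where B: "B \<ge> 0" "whitney_mean p f z = ennreal B"
        by (cases "whitney_mean p f z") auto
      \<comment> \<open>A bound for |f| on the closed ball of radius d / 4; circles of radius d / 8
        about points of the ball of radius d / 8 stay inside it.\<close>
      define S where "S = (16 / pi * B) powr (1 / p)"
      have S: "cmod (f v) \<le> S" if v: "dist z v \<le> d / 4" for v
      proof -
        have "cmod (f v) powr p \<le> 16 / pi * B"
          using norm_powr_le_whitney_mean[OF f p z, of v] v B by (simp add: d_def ennreal_mult'[symmetric])
        then have "(cmod (f v) powr p) powr (1 / p) \<le> S"
          unfolding S_def using p by (intro powr_mono2) auto
        then show ?thesis using p by (simp add: powr_powr)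
      qed
      have cb: "cball z (d / 4) \<subseteq> unit_disc"
      proof
        fix v assume "v \<in> cball z (d / 4)"
        then have "cmod v \<le> cmod z + d / 4"
          using norm_triangle_ineq2[of v z] by (simp add: dist_norm norm_minus_commute)
        also have "\<dots> < 1" using d by (simp add: d_def field_simps)
        finally show "v \<in> unit_disc" by simp
      qed
      have der: "cmod (deriv f v) \<le> 8 * S / d" if v: "v \<in> cball z (d / 8)" for v
      proof -
        have sub: "cball v (d / 8) \<subseteq> cball z (d / 4)"
          using v by (intro cball_subset_cball_iff[THEN iffD2]) (auto simp: dist_commute)
        have "cmod ((deriv ^^ 1) f v) \<le> fact 1 * S / (d / 8) ^ 1"
        proof (rule Cauchy_inequality)
          show "continuous_on (cball v (d / 8)) f"
            using f sub cb by (meson holomorphic_on_imp_continuous_on continuous_on_subset subset_trans)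
          show "f holomorphic_on ball v (d / 8)"
            using f sub cb ball_subset_cball by (meson holomorphic_on_subset subset_trans)
          show "cmod (f x) \<le> S" if "cmod (v - x) = d / 8" for x
          proof (rule S)
            have "x \<in> cball v (d / 8)" using that by (simp add: dist_norm)
            with sub show "dist z x \<le> d / 4" by auto
          qed
        qed (use d in auto)
        then show ?thesis by (simp add: field_simps)
      qed
      have "cmod (f w - f z) \<le> 8 * S / d * cmod (w - z)"
      proof (rule field_differentiable_bound[of "cball z (d / 8)" f "deriv f"])
        fix v assume v: "v \<in> cball z (d / 8)"
        then have "v \<in> unit_disc" using cb d by (auto simp: subset_iff)
        then show "(f has_field_derivative deriv f v) (at v within cball z (d / 8))"
          using f holomorphic_derivI[of f unit_disc v] by auto
      qed (use True d der in auto)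
      also have "\<dots> \<le> 8 * S / d * (3 * d * s)"
      proof (intro mult_left_mono)
        \<comment> \<open>Here 2 * d + dist z w \<le> 3 * d.\<close>
        have "dist z w \<le> s * (3 * d)"
          using True d s by (intro order_trans[OF s(2)] mult_left_mono) auto
        then show "cmod (w - z) \<le> 3 * d * s" by (simp add: dist_norm norm_minus_commute mult.commute)
        show "0 \<le> 8 * S / d" using d by (simp add: S_def)
      qed
      also have "\<dots> = 24 * S * s" using d by simp
      finally have "cmod (f z - f w) powr p \<le> (24 * S * s) powr p"
        using p by (intro powr_mono2) (auto simp: norm_minus_commute)
      also have "\<dots> = 24 powr p * (16 / pi * B) * s powr p"
        using s p B by (simp add: powr_mult S_def powr_powr)
      also have "\<dots> \<le> 34 powr p * (16 / pi * B) * s powr p"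
        using p B by (intro mult_right_mono powr_mono2) auto
      finally have "ennreal (cmod (f z - f w) powr p) \<le> ennreal (34 powr p * 16 / pi) * (ennreal (s powr p) * ennreal B)"
        using B by (simp add: ennreal_leI ac_simps flip: ennreal_mult')
      also have "\<dots> \<le> ennreal (34 powr p * 16 / pi) * (ennreal (s powr p) * (whitney_mean p f z + whitney_mean p f w))"
        unfolding B by (intro mult_left_mono) auto
      finally show ?thesis by (simp add: s_def)
    qed
  qed
qed

section \<open>Radial weights\<close>

text \<open>A null set has integral 0 in polar coordinates, and the factor r is positive on (0, 1),
  so almost every circle meets the set in a null set of angles.\<close>

lemma AE_disc_polar:
  fixes P :: "complex \<Rightarrow> bool"
  assumes "AE z in lborel. P z"
  shows "AE r in lborel. r \<in> {0<..<1::real} \<longrightarrow> (AE t in lborel. t \<in> {-pi..pi} \<longrightarrow> P (of_real r * cis t))"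
proof -
  obtain N where N: "{z. \<not> P z} \<subseteq> N" "emeasure lborel N = 0" "N \<in> sets borel"
    using assms by (auto elim!: AE_E)
  note [measurable] = N(3)
  let ?J = "\<lambda>r. \<integral>\<^sup>+t\<in>{-pi..pi}. indicator N (of_real r * cis t) \<partial>lborel"
  have "(\<integral>\<^sup>+r\<in>{0<..<1}. ennreal r * ?J r \<partial>lborel) = (\<integral>\<^sup>+z\<in>unit_disc. indicator N z \<partial>lborel)"
    by (rule nn_integral_polar_disc[symmetric]) measurable
  also have "\<dots> \<le> (\<integral>\<^sup>+z. indicator N z \<partial>lborel)"
    by (intro nn_integral_mono) (auto simp: indicator_def)
  finally have "(\<integral>\<^sup>+r\<in>{0<..<1}. ennreal r * ?J r \<partial>lborel) = 0"
    using N by simp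
  then have "AE r in lborel. ennreal r * ?J r * indicator {0<..<1} r = 0"
    by (subst (asm) nn_integral_0_iff_AE) measurable
  then show ?thesis
  proof eventually_elim
    case (elim r)
    show ?case
    proof
      assume "r \<in> {0<..<1}"
      then have "?J r = 0" using elim by (auto simp: ennreal_eq_0_iff)
      then have "AE t in lborel. indicator N (of_real r * cis t) * indicator {-pi..pi} t = (0::ennreal)"
        by (subst (asm) nn_integral_0_iff_AE) measurable
      then show "AE t in lborel. t \<in> {-pi..pi} \<longrightarrow> P (of_real r * cis t)"
        by eventually_elim (use N(1) in \<open>auto simp: indicator_def split: if_splits\<close>)
    qed
  qed
qed

lemma AE_disc_cmod:
  fixes Q :: "real \<Rightarrow> bool"
  assumes "AE r in lborel. r \<in> {0<..<1} \<longrightarrow> Q r"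
  shows "AE z in lborel. z \<in> unit_disc \<longrightarrow> Q (cmod z)"
proof -
  obtain N where N: "{r. \<not> (r \<in> {0<..<1} \<longrightarrow> Q r)} \<subseteq> N" "emeasure lborel N = 0" "N \<in> sets borel"
    using assms by (auto elim!: AE_E)
  note [measurable] = N(3)
  have "AE r in lborel. r \<notin> N"
    using N by (intro AE_not_in) (auto simp: null_sets_def)
  have "(\<integral>\<^sup>+z\<in>unit_disc. indicator N (cmod z) \<partial>lborel) =
      (\<integral>\<^sup>+r\<in>{0<..<1}. ennreal (2 * pi * r) * indicator N r \<partial>lborel)"
    by (rule nn_integral_cmod_disc) measurable
  also have "\<dots> = (\<integral>\<^sup>+r. 0 \<partial>(lborel :: real measure))"
    by (rule nn_integral_cong_AE, use \<open>AE r in lborel. r \<notin> N\<close> in eventually_elim) auto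
  finally have "(\<integral>\<^sup>+z\<in>unit_disc. indicator N (cmod z) \<partial>lborel) = 0"
    by simp
  then have "AE z in lborel. indicator N (cmod z) * indicator unit_disc z = (0::ennreal)"
    by (subst (asm) nn_integral_0_iff_AE) measurable
  then show ?thesis
    \<comment> \<open>Nothing is known about \<open>Q 0\<close>, so the centre is discarded as a
      null set.\<close>
    using AE_lborel_singleton[of "0::complex"]
  proof eventually_elim
    case (elim z)
    show ?case
    proof
      assume "z \<in> unit_disc"
      with elim have "cmod z \<in> {0<..<1}" "cmod z \<notin> N"
        by (auto simp: indicator_def split: if_splits)
      with N(1) show "Q (cmod z)" by blast
    qed
  qed
qed

text \<open>The radial profile of a Lebesgue measurable radial weight is recovered, up to a null set, as
  the circular mean of a Borel version of the weight; in particular it is itself measurable.\<close>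

lemma radial_weight_profile:
  assumes w: "radial_weight \<omega>"
  obtains G :: "real \<Rightarrow> ennreal" where "G \<in> borel_measurable borel"
    "\<And>h. h \<in> borel_measurable borel \<Longrightarrow>
      (\<integral>\<^sup>+z. h z * ennreal (\<omega> z) \<partial>area_measure) = ennreal (1 / pi) * (\<integral>\<^sup>+z\<in>unit_disc. h z * G (cmod z) \<partial>lborel)"
    "\<And>z. tail_integral \<omega> z = (\<integral>\<^sup>+s\<in>{cmod z<..<1}. G s \<partial>lborel)"
proof -
  have rad: "\<omega> z = \<omega> (of_real (cmod z))" if "cmod z < 1" for z
  proof -
    have "z \<in> unit_disc" using that by simp
    with w show ?thesis unfolding radial_weight_def by blast
  qed
  have meas: "\<omega> \<in> borel_measurable (restrict_space lebesgue unit_disc)"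
  proof -
    have "\<omega> \<in> borel_measurable area_measure"
      using w unfolding radial_weight_def by blast
    moreover have "sets area_measure = sets (restrict_space lebesgue unit_disc)"
      by (simp add: area_measure_def)
    ultimately show ?thesis
      using measurable_cong_sets by blast
  qed
  have disc: "unit_disc \<inter> space lebesgue \<in> sets lebesgue" by simp
  have "(\<lambda>z. ennreal (\<omega> z) * indicator unit_disc z) \<in> borel_measurable lebesgue"
    by (subst borel_measurable_restrict_space_iff_ennreal[symmetric]) (use meas disc in auto)
  then obtain k where k[measurable]: "k \<in> borel_measurable borel"
      and "AE z in lborel. ennreal (\<omega> z) * indicator unit_disc z = k z"
    using completion_ex_borel_measurable[of "\<lambda>z. ennreal (\<omega> z) * indicator unit_disc z" lborel] by auto
  note AE1 = AE_disc_polar[OF this(2)]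
  define G where "G = (\<lambda>r. ennreal (1 / (2 * pi)) * (\<integral>\<^sup>+t\<in>{-pi..pi}. k (complex_of_real r * cis t) \<partial>lborel))"
  have G[measurable]: "G \<in> borel_measurable borel"
    unfolding G_def by measurable
  have AE_G: "AE r in lborel. r \<in> {0<..<1} \<longrightarrow> G r = ennreal (\<omega> (of_real r))"
    using AE1
  proof eventually_elim
    case (elim r)
    show ?case
    proof
      assume r: "r \<in> {0<..<1}"
      with elim have "AE t in lborel. t \<in> {-pi..pi} \<longrightarrow>
          ennreal (\<omega> (of_real r * cis t)) * indicator unit_disc (of_real r * cis t) = k (of_real r * cis t)"
        by blast
      moreover have "\<omega> (of_real r * cis t) = \<omega> (of_real r)" for t
        using rad[of "of_real r * cis t"] r by (simp add: norm_mult)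
      ultimately have "(\<integral>\<^sup>+t\<in>{-pi..pi}. k (of_real r * cis t) \<partial>lborel) =
          (\<integral>\<^sup>+t\<in>{-pi..pi}. ennreal (\<omega> (of_real r)) \<partial>lborel)"
        using r by (intro nn_integral_cong_AE) (auto simp: norm_mult indicator_def elim!: eventually_mono)
      also have "\<dots> = ennreal (2 * pi) * ennreal (\<omega> (of_real r))"
        by (subst nn_integral_cmult) (simp_all add: mult.commute)
      finally have "G r = ennreal (1 / (2 * pi)) * ennreal (2 * pi) * ennreal (\<omega> (of_real r))"
        by (simp add: G_def mult.assoc)
      also have "ennreal (1 / (2 * pi)) * ennreal (2 * pi) = 1"
        by (simp flip: ennreal_mult')
      finally show "G r = ennreal (\<omega> (of_real r))" by simp
    qed
  qed
  show ?thesis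
  proof (rule that[OF G])
    fix h :: "complex \<Rightarrow> ennreal" assume h[measurable]: "h \<in> borel_measurable borel"
    have hm: "h \<in> borel_measurable (restrict_space lebesgue unit_disc)"
      by (intro measurable_restrict_space1 measurable_completion) simp
    have "(\<integral>\<^sup>+z. h z * ennreal (\<omega> z) \<partial>area_measure) =
        ennreal (1 / pi) * (\<integral>\<^sup>+z. h z * ennreal (\<omega> z) \<partial>restrict_space lebesgue unit_disc)"
      unfolding area_measure_def
      by (rule nn_integral_scale_measure) (use hm meas in measurable)
    also have "(\<integral>\<^sup>+z. h z * ennreal (\<omega> z) \<partial>restrict_space lebesgue unit_disc) =
        (\<integral>\<^sup>+z\<in>unit_disc. h z * ennreal (\<omega> z) \<partial>lborel)"
      by (subst nn_integral_restrict_space) (simp_all add: nn_integral_completion)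
    also have "\<dots> = (\<integral>\<^sup>+z\<in>unit_disc. h z * G (cmod z) \<partial>lborel)"
      by (rule nn_integral_cong_AE, use AE_disc_cmod[OF AE_G] in eventually_elim)
        (auto simp: indicator_def rad[symmetric])
    finally show "(\<integral>\<^sup>+z. h z * ennreal (\<omega> z) \<partial>area_measure) =
        ennreal (1 / pi) * (\<integral>\<^sup>+z\<in>unit_disc. h z * G (cmod z) \<partial>lborel)" .
  next
    fix z
    show "tail_integral \<omega> z = (\<integral>\<^sup>+s\<in>{cmod z<..<1}. G s \<partial>lborel)"
      unfolding tail_integral_def nn_integral_completion
      by (rule nn_integral_cong_AE, use AE_G in eventually_elim)
        (auto simp: indicator_def intro: less_le_trans le_less_trans dest: le_less_trans[OF norm_ge_zero])
  qed
qed

section \<open>Doubling weights\<close>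

text \<open>\<open>G\<close> is a Borel profile of the merely Lebesgue measurable weight, and
  \<open>T\<close> its tail. \<open>T\<close> is tied to \<open>G\<close> on [0, 1) only, because
  the tail integral at a negative real sees its modulus. Finiteness at 0 is an assumption here;
  integrability over the disc alone would not give it.\<close>

locale doubling_weight =
  fixes G T :: "real \<Rightarrow> ennreal"
  assumes G_measurable [measurable]: "G \<in> borel_measurable borel"
    and T_eq: "\<And>r. r \<in> {0..<1} \<Longrightarrow> T r = (\<integral>\<^sup>+s\<in>{r<..<1}. G s \<partial>lborel)"
    and T_measurable [measurable]: "T \<in> borel_measurable borel"
    and T_finite: "T 0 < \<infinity>"
    and D_hat: "\<exists>C\<ge>1. \<forall>r\<in>{0..<1}. T r \<le> ennreal C * T ((1 + r) / 2)"
    and D_check: "\<exists>K>1. \<exists>C>1. \<forall>r\<in>{0..<1}. ennreal C * T (1 - (1 - r) / K) \<le> T r"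
begin

text \<open>The p-th power of the Bergman norm times pi: plain Lebesgue measure replaces the
  normalized one.\<close>

definition mass :: "real \<Rightarrow> (complex \<Rightarrow> complex) \<Rightarrow> ennreal" where
  "mass p f = (\<integral>\<^sup>+z. disc_powr p f z * G (cmod z) \<partial>lborel)"

text \<open>Two roles meet here: it is the size of the p-th power of the norm of the test function
  at \<open>a\<close>, and the reciprocal of the factor in front of the integral in the supremum to
  be estimated.\<close>

abbreviation kernel_bound :: "real \<Rightarrow> complex \<Rightarrow> ennreal" where
  "kernel_bound \<gamma> a \<equiv> T (cmod a) * ennreal ((1 - cmod a) powr - \<gamma>)"

lemma T_antimono: "0 \<le> r \<Longrightarrow> r \<le> s \<Longrightarrow> s < 1 \<Longrightarrow> T s \<le> T r"
  by (simp add: T_eq) (intro nn_integral_mono, auto simp: indicator_def)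

lemma T_less_top: "r \<in> {0..<1} \<Longrightarrow> T r < \<infinity>"
  using T_antimono[of 0 r] T_finite by (auto simp: less_top[symmetric] top_unique)

lemma T_split:
  assumes "0 \<le> r" "r \<le> s" "s < 1"
  shows "T r = (\<integral>\<^sup>+x\<in>{r<..s}. G x \<partial>lborel) + T s"
proof -
  have "T r = (\<integral>\<^sup>+x. G x * indicator {r<..s} x + G x * indicator {s<..<1} x \<partial>lborel)"
    using assms by (subst T_eq) (auto intro!: nn_integral_cong simp: indicator_def)
  also have "\<dots> = (\<integral>\<^sup>+x\<in>{r<..s}. G x \<partial>lborel) + T s"
    using assms by (subst T_eq, simp) (rule nn_integral_add, measurable)
  finally show ?thesis .
qed

lemma D_hat_iterate:
  obtains C where "C \<ge> 1" "\<And>r n. r \<in> {0..<1} \<Longrightarrow> T r \<le> ennreal (C ^ n) * T (1 - (1 - r) / 2 ^ n)"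
proof -
  obtain C where C: "C \<ge> 1" "\<And>r. r \<in> {0..<1} \<Longrightarrow> T r \<le> ennreal C * T ((1 + r) / 2)"
    using D_hat by blast
  have "T r \<le> ennreal (C ^ n) * T (1 - (1 - r) / 2 ^ n)" if r: "r \<in> {0..<1}" for r n
  proof (induction n)
    case (Suc n)
    have "(1 - r) / 2 ^ n \<le> 1 / 1"
      using r by (intro frac_le) auto
    then have "1 - (1 - r) / 2 ^ n \<in> {0..<1}"
      using r by auto
    from C(2)[OF this] have "T (1 - (1 - r) / 2 ^ n) \<le> ennreal C * T (1 - (1 - r) / 2 ^ Suc n)"
      by (simp add: field_simps)
    then have "ennreal (C ^ n) * T (1 - (1 - r) / 2 ^ n) \<le>
        ennreal (C ^ n) * (ennreal C * T (1 - (1 - r) / 2 ^ Suc n))"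
      by (rule mult_left_mono) simp
    with Suc show ?case
      using C(1) by (simp add: ennreal_mult ac_simps)
  qed simp
  with C(1) show ?thesis using that by blast
qed

text \<open>With \<open>a\<close> the mass in (r, s], s = 1 - (1 - r) / K, and \<open>b\<close> the
  tail beyond s, \<open>D_check\<close> reads C * b \<le> a + b, so b \<le> a / (C - 1). Halving 1 -
  r n times with 2 ^ n > K passes s, so the iterated \<open>D_hat\<close> bounds T r by a multiple
  of b.\<close>

lemma T_le_local:
  obtains c K where "c > 0" "K > 1"
    "\<And>r. r \<in> {0..<1} \<Longrightarrow> T r \<le> ennreal c * (\<integral>\<^sup>+x\<in>{r<..1 - (1 - r) / K}. G x \<partial>lborel)"
proof -
  obtain K C where KC: "K > 1" "C > 1" "\<And>r. r \<in> {0..<1} \<Longrightarrow> ennreal C * T (1 - (1 - r) / K) \<le> T r"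
    using D_check by blast
  obtain D where D: "D \<ge> 1" "\<And>r n. r \<in> {0..<1} \<Longrightarrow> T r \<le> ennreal (D ^ n) * T (1 - (1 - r) / 2 ^ n)"
    by (rule D_hat_iterate) blast
  obtain n where n: "K < 2 ^ n"
    using real_arch_pow[of 2 K] by auto
  show ?thesis
  proof (rule that[of "D ^ n / (C - 1)" K])
    fix r :: real assume r: "r \<in> {0..<1}"
    let ?s = "1 - (1 - r) / K"
    have "(1 - r) / K \<le> (1 - r) / 1"
      using r KC by (intro divide_left_mono) auto
    then have s: "r \<le> ?s" "?s < 1" using r KC by (auto simp: field_simps)
    define A where "A = (\<integral>\<^sup>+x\<in>{r<..?s}. G x \<partial>lborel)"
    have split: "T r = A + T ?s"
      unfolding A_def using r s by (intro T_split) auto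
    have "A < \<infinity>" "T ?s < \<infinity>"
      using T_less_top[OF r] by (auto simp: split less_top)
    then obtain a b where ab: "A = ennreal a" "a \<ge> 0" "T ?s = ennreal b" "b \<ge> 0"
      by (cases A; cases "T ?s") auto
    have "ennreal C * ennreal b \<le> ennreal a + ennreal b"
      using KC(3)[OF r] ab split by simp
    then have "C * b \<le> a + b"
      using ab KC(2) by (simp flip: ennreal_mult ennreal_plus)
    then have "b \<le> a / (C - 1)"
      using KC(2) by (simp add: field_simps)
    have "T r \<le> ennreal (D ^ n) * T (1 - (1 - r) / 2 ^ n)"
      by (rule D(2)[OF r])
    also have "\<dots> \<le> ennreal (D ^ n) * T ?s"
    proof (intro mult_left_mono T_antimono)
      have "(1 - r) / 2 ^ n \<le> (1 - r) / K"
        using n r KC by (intro divide_left_mono) auto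
      then show "?s \<le> 1 - (1 - r) / 2 ^ n" by simp
    qed (use r s in auto)
    also have "\<dots> \<le> ennreal (D ^ n * (a / (C - 1)))"
      using ab D(1) mult_left_mono[OF \<open>b \<le> a / (C - 1)\<close>, of "D ^ n"]
      by (simp add: ennreal_leI flip: ennreal_mult)
    also have "\<dots> = ennreal (D ^ n / (C - 1)) * A"
      using ab KC D(1) by (simp flip: ennreal_mult)
    finally show "T r \<le> ennreal (D ^ n / (C - 1)) * (\<integral>\<^sup>+x\<in>{r<..?s}. G x \<partial>lborel)"
      by (simp add: A_def)
  qed (use KC D in auto)
qed

lemma nn_integral_disc_powr_polar:
  assumes f: "f holomorphic_on unit_disc" and [measurable]: "k \<in> borel_measurable borel"
  shows "(\<integral>\<^sup>+z. disc_powr p f z * k (cmod z) \<partial>lborel) =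
    (\<integral>\<^sup>+r\<in>{0<..<1}. ennreal r * (\<integral>\<^sup>+t\<in>{-pi..pi}. disc_powr p f (of_real r * cis t) \<partial>lborel) * k r \<partial>lborel)"
proof -
  note [measurable] = disc_powr_measurable[OF f]
  have "(\<integral>\<^sup>+z. disc_powr p f z * k (cmod z) \<partial>lborel) = (\<integral>\<^sup>+z\<in>unit_disc. disc_powr p f z * k (cmod z) \<partial>lborel)"
    by (intro nn_integral_cong) (auto simp: disc_powr_def indicator_def)
  also have "\<dots> = (\<integral>\<^sup>+r\<in>{0<..<1}. ennreal r *
      (\<integral>\<^sup>+t\<in>{-pi..pi}. disc_powr p f (of_real r * cis t) * k (cmod (of_real r * cis t)) \<partial>lborel) \<partial>lborel)"
    by (rule nn_integral_polar_disc) measurable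
  also have "\<dots> = (\<integral>\<^sup>+r\<in>{0<..<1}. ennreal r *
      (\<integral>\<^sup>+t\<in>{-pi..pi}. disc_powr p f (of_real r * cis t) \<partial>lborel) * k r \<partial>lborel)"
  proof (rule nn_integral_cong)
    fix r :: real
    have "(\<integral>\<^sup>+t\<in>{-pi..pi}. disc_powr p f (of_real r * cis t) * k (cmod (of_real r * cis t)) \<partial>lborel) =
        (\<integral>\<^sup>+t\<in>{-pi..pi}. disc_powr p f (of_real r * cis t) \<partial>lborel) * k r" if "r \<in> {0<..<1}"
      using that by (subst nn_integral_multc[symmetric]) (auto intro!: nn_integral_cong simp: norm_mult ac_simps)
    then show "ennreal r * (\<integral>\<^sup>+t\<in>{-pi..pi}. disc_powr p f (of_real r * cis t) * k (cmod (of_real r * cis t)) \<partial>lborel) * indicator {0<..<1} r =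
        ennreal r * (\<integral>\<^sup>+t\<in>{-pi..pi}. disc_powr p f (of_real r * cis t) \<partial>lborel) * k r * indicator {0<..<1} r"
      by (auto simp: indicator_def mult.assoc)
  qed
  finally show ?thesis .
qed

text \<open>T r is replaced by the local integral of \<open>G\<close> over s in (r, 1 - (1 - r) /
  K], and the order of integration is exchanged. For fixed s the admissible r fill an interval of
  length (K - 1) * (1 - s), which cancels the factor 1 / (1 - s).\<close>

lemma nn_integral_T_le:
  obtains c where "c > 0"
    "\<And>p f. p > 0 \<Longrightarrow> f holomorphic_on unit_disc \<Longrightarrow>
      (\<integral>\<^sup>+z. disc_powr p f z * (T (cmod z) * ennreal (1 / (1 - cmod z))) \<partial>lborel) \<le>
      ennreal c * mass p f"
proof -
  obtain c K where cK: "c > 0" "K > 1"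
    "\<And>r. r \<in> {0..<1} \<Longrightarrow> T r \<le> ennreal c * (\<integral>\<^sup>+x\<in>{r<..1 - (1 - r) / K}. G x \<partial>lborel)"
    by (rule T_le_local) blast
  show ?thesis
  proof (rule that[of "c * (K - 1)"])
    fix p :: real and f :: "complex \<Rightarrow> complex"
    assume p: "p > 0" and f: "f holomorphic_on unit_disc"
    note [measurable] = disc_powr_measurable[OF f]
    define V where "V = (\<lambda>r. \<integral>\<^sup>+t\<in>{-pi..pi}. disc_powr p f (complex_of_real r * cis t) \<partial>lborel)"
    have V[measurable]: "V \<in> borel_measurable borel" unfolding V_def by measurable
    have Vmono: "V r \<le> V s" if "0 \<le> r" "r \<le> s" "s < 1" for r s
      unfolding V_def using that by (intro circle_mean_mono f p) auto
    \<comment> \<open>For K > 0 the condition s \<le> 1 - (1 - r) / K is equivalent to 1 - K * (1 -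
      s) \<le> r, which displays the fibre over s.\<close>
    define S where "S = {x::real \<times> real. 1 - K * (1 - snd x) \<le> fst x \<and> fst x < snd x}"
    have [measurable]: "S \<in> sets (borel \<Otimes>\<^sub>M borel)"
    proof -
      have "Measurable.pred (borel \<Otimes>\<^sub>M borel) (\<lambda>x::real \<times> real. 1 - K * (1 - snd x) \<le> fst x \<and> fst x < snd x)"
        by measurable
      then show ?thesis by (simp add: pred_def S_def space_pair_measure)
    qed
    have "(\<integral>\<^sup>+z. disc_powr p f z * (T (cmod z) * ennreal (1 / (1 - cmod z))) \<partial>lborel) =
        (\<integral>\<^sup>+r\<in>{0<..<1}. ennreal r * V r * (T r * ennreal (1 / (1 - r))) \<partial>lborel)"
      unfolding V_def by (rule nn_integral_disc_powr_polar[OF f]) measurable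
    also have "\<dots> \<le> (\<integral>\<^sup>+r. \<integral>\<^sup>+s. ennreal c * ((ennreal s * V s * G s * indicator {0<..<1} s) *
        (ennreal (1 / (1 - s)) * indicator S (r, s))) \<partial>lborel \<partial>lborel)"
    proof (rule nn_integral_mono)
      fix r :: real
      show "ennreal r * V r * (T r * ennreal (1 / (1 - r))) * indicator {0<..<1} r \<le>
        (\<integral>\<^sup>+s. ennreal c * ((ennreal s * V s * G s * indicator {0<..<1} s) *
        (ennreal (1 / (1 - s)) * indicator S (r, s))) \<partial>lborel)"
      proof (cases "r \<in> {0<..<1}")
        case True
        let ?u = "1 - (1 - r) / K"
        have u: "?u < 1" using True cK(2) by (simp add: field_simps)
        have "ennreal r * V r * (T r * ennreal (1 / (1 - r))) \<le>
            ennreal r * V r * ((ennreal c * (\<integral>\<^sup>+s\<in>{r<..?u}. G s \<partial>lborel)) * ennreal (1 / (1 - r)))"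
          using True by (intro mult_left_mono mult_right_mono cK(3)) auto
        also have "\<dots> = (\<integral>\<^sup>+s. (ennreal r * V r * (ennreal c * ennreal (1 / (1 - r)))) * (G s * indicator {r<..?u} s) \<partial>lborel)"
          by (subst nn_integral_cmult) (simp_all add: ac_simps)
        also have "\<dots> \<le> (\<integral>\<^sup>+s. ennreal c * ((ennreal s * V s * G s * indicator {0<..<1} s) *
            (ennreal (1 / (1 - s)) * indicator S (r, s))) \<partial>lborel)"
        proof (rule nn_integral_mono)
          fix s :: real
          show "(ennreal r * V r * (ennreal c * ennreal (1 / (1 - r)))) * (G s * indicator {r<..?u} s) \<le>
            ennreal c * ((ennreal s * V s * G s * indicator {0<..<1} s) *
            (ennreal (1 / (1 - s)) * indicator S (r, s)))"
          proof (cases "s \<in> {r<..?u}")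
            case s: True
            then have s1: "s \<in> {0<..<1}" using True u by auto
            have "(r, s) \<in> S"
              using s cK(2) by (auto simp: S_def field_simps)
            \<comment> \<open>All three factors increase with the radius; for \<open>V\<close> this
              is the monotonicity of circular means.\<close>
            moreover have "ennreal r * V r * ennreal (1 / (1 - r)) \<le> ennreal s * V s * ennreal (1 / (1 - s))"
              using s s1 True by (intro mult_mono ennreal_leI Vmono frac_le) auto
            then have "ennreal c * G s * (ennreal r * V r * ennreal (1 / (1 - r))) \<le>
                ennreal c * G s * (ennreal s * V s * ennreal (1 / (1 - s)))"
              by (rule mult_left_mono) simp
            ultimately show ?thesis
              using s s1 by (simp add: ac_simps)
          qed simp
        qed
        finally show ?thesis using True by simp
      qed simp
    qed
    also have "\<dots> = (\<integral>\<^sup>+s. \<integral>\<^sup>+r. ennreal c * ((ennreal s * V s * G s * indicator {0<..<1} s) *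
        (ennreal (1 / (1 - s)) * indicator S (r, s))) \<partial>lborel \<partial>lborel)"
      by (rule lborel_pair.Fubini') measurable
    also have "\<dots> = (\<integral>\<^sup>+s. ennreal (c * (K - 1)) * (ennreal s * V s * G s * indicator {0<..<1} s) \<partial>lborel)"
    proof (rule nn_integral_cong)
      fix s :: real
      show "(\<integral>\<^sup>+r. ennreal c * ((ennreal s * V s * G s * indicator {0<..<1} s) *
          (ennreal (1 / (1 - s)) * indicator S (r, s))) \<partial>lborel) =
          ennreal (c * (K - 1)) * (ennreal s * V s * G s * indicator {0<..<1} s)"
      proof (cases "s \<in> {0<..<1}")
        case True
        have "(\<integral>\<^sup>+r. indicator S (r, s) \<partial>lborel) = (\<integral>\<^sup>+r. indicator {1 - K * (1 - s)..<s} r \<partial>lborel)"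
          by (intro nn_integral_cong) (auto simp: S_def indicator_def)
        also have "\<dots> = ennreal ((K - 1) * (1 - s))"
        proof -
          have "0 \<le> (K - 1) * (1 - s)" using True cK(2) by simp
          then have "1 - K * (1 - s) \<le> s" by (simp add: algebra_simps)
          then show ?thesis by (simp add: algebra_simps)
        qed
        finally have "(\<integral>\<^sup>+r. indicator S (r, s) \<partial>lborel) = ennreal ((K - 1) * (1 - s))" .
        moreover have "ennreal (1 / (1 - s)) * ennreal ((K - 1) * (1 - s)) = ennreal (K - 1)"
          using True cK(2) by (simp flip: ennreal_mult')
        moreover have "(\<integral>\<^sup>+r. ennreal c * ((ennreal s * V s * G s * indicator {0<..<1} s) *
            (ennreal (1 / (1 - s)) * indicator S (r, s))) \<partial>lborel) =
            ennreal c * ((ennreal s * V s * G s * indicator {0<..<1} s) *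
            (ennreal (1 / (1 - s)) * (\<integral>\<^sup>+r. indicator S (r, s) \<partial>lborel)))"
          by (simp add: nn_integral_cmult)
        ultimately show ?thesis
          using cK by (simp add: ennreal_mult ac_simps)
      qed simp
    qed
    also have "\<dots> = ennreal (c * (K - 1)) * (\<integral>\<^sup>+s\<in>{0<..<1}. ennreal s * V s * G s \<partial>lborel)"
      by (rule nn_integral_cmult) measurable
    also have "(\<integral>\<^sup>+s\<in>{0<..<1}. ennreal s * V s * G s \<partial>lborel) = mass p f"
      unfolding V_def mass_def by (rule nn_integral_disc_powr_polar[OF f, symmetric]) measurable
    finally show "(\<integral>\<^sup>+z. disc_powr p f z * (T (cmod z) * ennreal (1 / (1 - cmod z))) \<partial>lborel) \<le>
      ennreal (c * (K - 1)) * mass p f" .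
  qed (use cK in auto)
qed

end

section \<open>Moments of the weight\<close>

context doubling_weight
begin

text \<open>Recursion from x to y = 2 * x - 1, for which x is the midpoint of y and 1. Doubling
  gives T y \<le> C * T x, and the power contributes 2 powr -\<gamma>, so a bound with constant A at
  y yields q * A + C at x, where q = C * 2 powr -\<gamma>. The constant C / (1 - q) is the fixed
  point of this map.\<close>

lemma moment_upto_le:
  assumes C: "C \<ge> 1" "\<And>r. r \<in> {0..<1} \<Longrightarrow> T r \<le> ennreal C * T ((1 + r) / 2)"
    and \<gamma>: "C < 2 powr \<gamma>" "\<gamma> > 0"
    and x: "0 \<le> x" "x < 1"
  shows "(\<integral>\<^sup>+s\<in>{0<..x}. G s * ennreal ((1 - s) powr - \<gamma>) \<partial>lborel)
    \<le> ennreal (C / (1 - C * 2 powr - \<gamma>)) * (T x * ennreal ((1 - x) powr - \<gamma>))"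
proof -
  define q where "q = C * 2 powr - \<gamma>"
  define A where "A = C / (1 - q)"
  have q: "0 \<le> q" "q < 1"
    using C(1) \<gamma> by (auto simp: q_def powr_minus field_simps)
  have A: "A \<ge> C" "q * A + C = A"
    using q C(1) by (auto simp: A_def field_simps)
  let ?J = "\<lambda>x. \<integral>\<^sup>+s\<in>{0<..x}. G s * ennreal ((1 - s) powr - \<gamma>) \<partial>lborel"
  let ?R = "\<lambda>x. T x * ennreal ((1 - x) powr - \<gamma>)"
  have piece: "(\<integral>\<^sup>+s\<in>{y<..x}. G s * ennreal ((1 - s) powr - \<gamma>) \<partial>lborel) \<le> T y * ennreal ((1 - x) powr - \<gamma>)"
    if "0 \<le> y" "x < 1" for x y
  proof -
    have "(\<integral>\<^sup>+s\<in>{y<..x}. G s * ennreal ((1 - s) powr - \<gamma>) \<partial>lborel) \<le>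
        (\<integral>\<^sup>+s. G s * indicator {y<..<1} s * ennreal ((1 - x) powr - \<gamma>) \<partial>lborel)"
      using that \<gamma> by (intro nn_integral_mono)
        (auto simp: indicator_def intro!: mult_left_mono ennreal_leI powr_mono2')
    also have "\<dots> = (\<integral>\<^sup>+s\<in>{y<..<1}. G s \<partial>lborel) * ennreal ((1 - x) powr - \<gamma>)"
      by (rule nn_integral_multc) measurable
    also have "(\<integral>\<^sup>+s\<in>{y<..<1}. G s \<partial>lborel) \<le> T y"
    proof (cases "y < 1")
      case True
      then show ?thesis using that by (simp add: T_eq)
    qed (use that in simp)
    finally show ?thesis by (simp add: mult_right_mono)
  qed
  \<comment> \<open>n bounds the number of doublings of 1 - x needed to reach 1 / 2. In the base
    case x \<le> 1 / 2, and one application of \<open>D_hat\<close> at 0 suffices.\<close>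
  have "?J x \<le> ennreal A * ?R x" if "0 \<le> x" "x < 1" "1 / 2 \<le> (1 - x) * 2 ^ n" for n x
    using that
  proof (induction n arbitrary: x)
    case 0
    have "?J x \<le> T 0 * ennreal ((1 - x) powr - \<gamma>)"
      using 0 by (intro piece) auto
    also have "T 0 \<le> ennreal C * T ((1 + 0) / 2)"
      by (rule C(2)) simp
    also have "T ((1 + 0) / 2) \<le> T x"
      using 0 by (intro T_antimono) auto
    also have "ennreal C * T x * ennreal ((1 - x) powr - \<gamma>) \<le> ennreal A * T x * ennreal ((1 - x) powr - \<gamma>)"
      using A(1) by (intro mult_right_mono ennreal_leI) auto
    finally show ?case by (simp add: mult_left_mono mult_right_mono mult.assoc)
  next
    case (Suc n)
    show ?case
    proof (cases "x < 1 / 2")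
      case True
      then have "1 / 2 \<le> 1 - x" by simp
      also have "\<dots> \<le> (1 - x) * 2 ^ n"
        using Suc.prems by simp
      finally show ?thesis using Suc by blast
    next
      case False
      define y where "y = 2 * x - 1"
      have y: "0 \<le> y" "y \<le> x" "y < 1" "1 - y = 2 * (1 - x)" "(1 + y) / 2 = x"
        using False Suc.prems by (auto simp: y_def)
      have Ty: "T y \<le> ennreal C * T x"
        using C(2)[of y] y by simp
      have "?J x = (\<integral>\<^sup>+s. G s * ennreal ((1 - s) powr - \<gamma>) * indicator {0<..y} s +
          G s * ennreal ((1 - s) powr - \<gamma>) * indicator {y<..x} s \<partial>lborel)"
        using y by (intro nn_integral_cong) (auto simp: indicator_def)
      also have "\<dots> = ?J y + (\<integral>\<^sup>+s\<in>{y<..x}. G s * ennreal ((1 - s) powr - \<gamma>) \<partial>lborel)"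
        by (rule nn_integral_add) measurable
      also have "\<dots> \<le> ennreal A * ?R y + T y * ennreal ((1 - x) powr - \<gamma>)"
      proof (intro add_mono piece Suc.IH)
        have "(1 - y) * 2 ^ n = (1 - x) * 2 ^ Suc n" by (simp add: y(4))
        with Suc.prems(3) show "1 / 2 \<le> (1 - y) * 2 ^ n" by (simp only:)
      qed (use y Suc.prems in auto)
      also have "?R y = T y * (ennreal (2 powr - \<gamma>) * ennreal ((1 - x) powr - \<gamma>))"
        by (subst y(4), subst powr_mult) (simp flip: ennreal_mult')
      also have "ennreal A * (T y * (ennreal (2 powr - \<gamma>) * ennreal ((1 - x) powr - \<gamma>))) + T y * ennreal ((1 - x) powr - \<gamma>)
          = T y * ((ennreal A * ennreal (2 powr - \<gamma>) + 1) * ennreal ((1 - x) powr - \<gamma>))"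
        by (simp add: distrib_left distrib_right ac_simps)
      also have "\<dots> \<le> (ennreal C * T x) * ((ennreal A * ennreal (2 powr - \<gamma>) + 1) * ennreal ((1 - x) powr - \<gamma>))"
        by (intro mult_right_mono Ty) simp
      also have "\<dots> = (ennreal C * (ennreal A * ennreal (2 powr - \<gamma>) + 1)) * ?R x"
        by (simp add: ac_simps)
      also have "ennreal C * (ennreal A * ennreal (2 powr - \<gamma>) + 1) = ennreal (C * (A * 2 powr - \<gamma> + 1))"
        using A(1) C(1) by (simp add: ennreal_mult ennreal_plus)
      also have "C * (A * 2 powr - \<gamma> + 1) = A"
        using A(2) by (simp add: q_def algebra_simps)
      finally show ?thesis .
    qed
  qed
  moreover obtain n where "1 / (1 - x) < 2 ^ n"
    using real_arch_pow[of 2] by auto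
  then have "1 / 2 \<le> (1 - x) * 2 ^ n"
    using x by (simp add: field_simps)
  ultimately show ?thesis
    using x unfolding A_def q_def by blast
qed

text \<open>The integral is split at s = x: below it 1 - x * s \<ge> 1 - s, above it 1 - x * s \<ge>
  1 - x. The threshold log 2 C is where C < 2 powr \<gamma> begins to hold.\<close>

lemma moment_le:
  obtains \<gamma>\<^sub>0 where "\<gamma>\<^sub>0 \<ge> 0" "\<And>\<gamma>. \<gamma> > \<gamma>\<^sub>0 \<Longrightarrow> \<exists>A>0. \<forall>x\<in>{0..<1}.
    (\<integral>\<^sup>+s\<in>{0<..<1}. G s * ennreal ((1 - x * s) powr - \<gamma>) \<partial>lborel) \<le> ennreal A * (T x * ennreal ((1 - x) powr - \<gamma>))"
proof -
  obtain C where C: "C \<ge> 1" "\<And>r. r \<in> {0..<1} \<Longrightarrow> T r \<le> ennreal C * T ((1 + r) / 2)"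
    using D_hat by blast
  show ?thesis
  proof (rule that[of "log 2 C"])
    show "0 \<le> log 2 C" using C by simp
    fix \<gamma> assume "\<gamma> > log 2 C"
    then have \<gamma>: "C < 2 powr \<gamma>" "\<gamma> > 0"
      using C(1) by (simp add: log_less_iff) (use \<open>\<gamma> > log 2 C\<close> \<open>0 \<le> log 2 C\<close> in linarith)
    let ?A = "C / (1 - C * 2 powr - \<gamma>)"
    have A: "?A > 0"
      using C(1) \<gamma> by (auto simp: powr_minus field_simps)
    show "\<exists>A>0. \<forall>x\<in>{0..<1}. (\<integral>\<^sup>+s\<in>{0<..<1}. G s * ennreal ((1 - x * s) powr - \<gamma>) \<partial>lborel)
        \<le> ennreal A * (T x * ennreal ((1 - x) powr - \<gamma>))"
    proof (intro exI[of _ "?A + 1"] conjI ballI)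
      show "?A + 1 > 0" using A by simp
      fix x :: real assume x: "x \<in> {0..<1}"
      have "(\<integral>\<^sup>+s\<in>{0<..<1}. G s * ennreal ((1 - x * s) powr - \<gamma>) \<partial>lborel) \<le>
          (\<integral>\<^sup>+s. G s * ennreal ((1 - s) powr - \<gamma>) * indicator {0<..x} s +
            G s * indicator {x<..<1} s * ennreal ((1 - x) powr - \<gamma>) \<partial>lborel)"
      proof (rule nn_integral_mono)
        fix s :: real
        have "(1 - x * s) powr - \<gamma> \<le> (1 - s) powr - \<gamma>" "(1 - x * s) powr - \<gamma> \<le> (1 - x) powr - \<gamma>" if "0 < s" "s < 1"
        proof -
          have "x * s \<le> 1 * s" by (rule mult_right_mono) (use that x in auto)
          moreover have "x * s \<le> x * 1" by (rule mult_left_mono) (use that x in auto)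
          ultimately show "(1 - x * s) powr - \<gamma> \<le> (1 - s) powr - \<gamma>" "(1 - x * s) powr - \<gamma> \<le> (1 - x) powr - \<gamma>"
            using that x \<gamma> by (auto intro!: powr_mono2')
        qed
        then show "G s * ennreal ((1 - x * s) powr - \<gamma>) * indicator {0<..<1} s \<le>
            G s * ennreal ((1 - s) powr - \<gamma>) * indicator {0<..x} s +
            G s * indicator {x<..<1} s * ennreal ((1 - x) powr - \<gamma>)"
          by (auto simp: indicator_def intro!: mult_left_mono ennreal_leI)
      qed
      also have "\<dots> = (\<integral>\<^sup>+s\<in>{0<..x}. G s * ennreal ((1 - s) powr - \<gamma>) \<partial>lborel) +
          (\<integral>\<^sup>+s\<in>{x<..<1}. G s \<partial>lborel) * ennreal ((1 - x) powr - \<gamma>)"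
        by (subst nn_integral_add, measurable, subst nn_integral_multc) auto
      also have "\<dots> \<le> ennreal ?A * (T x * ennreal ((1 - x) powr - \<gamma>)) + T x * ennreal ((1 - x) powr - \<gamma>)"
        using x C \<gamma> by (intro add_mono moment_upto_le mult_right_mono) (auto simp: T_eq)
      also have "\<dots> = ennreal (?A + 1) * (T x * ennreal ((1 - x) powr - \<gamma>))"
        using A by (simp add: ennreal_plus distrib_right)
      finally show "(\<integral>\<^sup>+s\<in>{0<..<1}. G s * ennreal ((1 - x * s) powr - \<gamma>) \<partial>lborel) \<le>
        ennreal (?A + 1) * (T x * ennreal ((1 - x) powr - \<gamma>))" .
    qed
  qed
qed

end

section \<open>Integrals of the kernel over circles and over the disc\<close>

lemma sin_ge_half:
  fixes x :: real
  assumes "0 \<le> x" "x \<le> pi / 2"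
  shows "x / 2 \<le> sin x"
proof (cases "x \<le> pi / 3")
  case True
  have "sin 0 - 0 / 2 \<le> sin x - x / 2"
  proof (rule DERIV_nonneg_imp_nondecreasing[OF assms(1)])
    fix y assume y: "0 \<le> y" "y \<le> x"
    have "cos (pi / 3) \<le> cos y"
      using y True by (intro cos_monotone_0_pi_le) auto
    then have "0 \<le> cos y - 1 / 2" by (simp add: cos_60)
    moreover have "DERIV (\<lambda>x. sin x - x / 2) y :> cos y - 1 / 2"
      by (auto intro!: derivative_eq_intros)
    ultimately show "\<exists>d. DERIV (\<lambda>x. sin x - x / 2) y :> d \<and> 0 \<le> d" by blast
  qed
  then show ?thesis by simp
next
  case False
  \<comment> \<open>Beyond pi / 3 the sine is at least sqrt 3 / 2 \<ge> pi / 4 \<ge> x / 2; before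
    it the derivative cos y - 1 / 2 is nonnegative.\<close>
  have "pi / 2 / 2 \<le> sqrt 3 / 2"
  proof -
    have "pi / 2 \<le> 17 / 10" using pi_less_4 pi_approx by simp
    also have "17 / 10 \<le> sqrt 3" by (rule real_le_rsqrt) (simp add: power2_eq_square)
    finally show ?thesis by simp
  qed
  also have "sqrt 3 / 2 = sin (pi / 3)" by (simp add: sin_60)
  also have "\<dots> \<le> sin x"
    using False assms by (intro sin_monotone_2pi_le) auto
  finally show ?thesis using assms by simp
qed

lemma abs_le_norm_one_minus_cis:
  assumes "\<bar>t\<bar> \<le> pi"
  shows "\<bar>t\<bar> \<le> 2 * cmod (1 - cis t)"
proof -
  have "(cmod (1 - cis t))\<^sup>2 = (1 - cos t)\<^sup>2 + (sin t)\<^sup>2"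
    by (simp add: cmod_power2)
  also have "\<dots> = 1 - 2 * cos t + ((cos t)\<^sup>2 + (sin t)\<^sup>2)"
    by (simp add: power2_eq_square algebra_simps)
  also have "\<dots> = 2 - 2 * cos (2 * (t / 2))" by simp
  also have "\<dots> = (2 * sin (t / 2))\<^sup>2"
    by (subst cos_double_sin) (simp add: power_mult_distrib)
  finally have eq: "cmod (1 - cis t) = \<bar>2 * sin (t / 2)\<bar>"
    by (metis abs_norm_cancel real_sqrt_abs)
  have "\<bar>t\<bar> / 2 / 2 \<le> sin (\<bar>t\<bar> / 2)"
    using assms by (intro sin_ge_half) auto
  also have "\<dots> \<le> \<bar>sin (t / 2)\<bar>"
    by (cases "t \<ge> 0") auto
  finally show ?thesis by (simp add: eq abs_mult)
qed

text \<open>On the circle the kernel is controlled by b + |t| with b = 1 - \<rho>, and the integral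
  of (b + t) powr -(\<gamma> + 1) over the half-line is b powr -\<gamma> / \<gamma>; the two signs
  of t give the factor 2.\<close>

lemma circle_kernel_integral_le:
  assumes \<gamma>: "\<gamma> > 0" and r: "0 \<le> \<rho>" "\<rho> < 1"
  shows "(\<integral>\<^sup>+t\<in>{-pi..pi}. ennreal (cmod (1 - of_real \<rho> * cis t) powr - (\<gamma> + 1)) \<partial>lborel)
    \<le> ennreal (2 * 5 powr (\<gamma> + 1) / \<gamma>) * ennreal ((1 - \<rho>) powr - \<gamma>)"
proof -
  define b where "b = 1 - \<rho>"
  have b: "b > 0" using r by (simp add: b_def)
  \<comment> \<open>With X the modulus on the right, |t| \<le> 2 * (X + b) and b \<le> X, hence |t|
    + b \<le> 2 * X + 3 * b \<le> 5 * X.\<close>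
  have bound: "(b + \<bar>t\<bar>) / 5 \<le> cmod (1 - of_real \<rho> * cis t)" if "\<bar>t\<bar> \<le> pi" for t
  proof -
    have 1: "b \<le> cmod (1 - of_real \<rho> * cis t)"
      using norm_triangle_ineq2[of 1 "of_real \<rho> * cis t"] r by (simp add: b_def norm_mult)
    have "1 - cis t = (1 - of_real \<rho> * cis t) - of_real b * cis t"
      by (simp add: b_def algebra_simps)
    then have "cmod (1 - cis t) \<le> cmod (1 - of_real \<rho> * cis t) + cmod (of_real b * cis t)"
      by (metis norm_triangle_ineq4)
    then have "cmod (1 - cis t) \<le> cmod (1 - of_real \<rho> * cis t) + b"
      using b by (simp add: norm_mult)
    then have "\<bar>t\<bar> + b \<le> 5 * cmod (1 - of_real \<rho> * cis t)"
      using 1 abs_le_norm_one_minus_cis[OF that] by simp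
    then show ?thesis by simp
  qed
  let ?k = "\<lambda>t. (b + t) powr - (\<gamma> + 1)"
  have half: "(\<integral>\<^sup>+t. ennreal (?k t) * indicator {0..} t \<partial>lborel) = ennreal (b powr - \<gamma> / \<gamma>)"
  proof -
    have "(\<integral>\<^sup>+t. ennreal (?k t) * indicator {0..} t \<partial>lborel) = ennreal (0 - - ((b + 0) powr - \<gamma> / \<gamma>))"
    proof (rule nn_integral_FTC_atLeast[where F = "\<lambda>t. - ((b + t) powr - \<gamma> / \<gamma>)"])
      show "DERIV (\<lambda>t. - ((b + t) powr - \<gamma> / \<gamma>)) t :> ?k t" if "0 \<le> t" for t
      proof -
        have "DERIV (\<lambda>t. (b + t) powr - \<gamma>) t :> - \<gamma> * (b + t) powr (- \<gamma> - 1) * (0 + 1)"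
          using b that by (intro DERIV_chain2[OF has_real_derivative_powr] derivative_intros) auto
        then have "DERIV (\<lambda>t. - ((b + t) powr - \<gamma> / \<gamma>)) t :> - (- \<gamma> * (b + t) powr (- \<gamma> - 1) * (0 + 1) / \<gamma>)"
          by (intro DERIV_minus DERIV_cdivide)
        moreover have e: "- (\<gamma> + 1) = - \<gamma> - 1" by simp
        ultimately show ?thesis unfolding e using \<gamma> by simp
      qed
      have "((\<lambda>t. (b + t) powr - \<gamma>) \<longlongrightarrow> 0) at_top"
        using \<gamma> by (intro tendsto_neg_powr filterlim_tendsto_add_at_top[OF tendsto_const] filterlim_ident) auto
      then show "((\<lambda>t. - ((b + t) powr - \<gamma> / \<gamma>)) \<longlongrightarrow> 0) at_top"
        using tendsto_minus[OF tendsto_divide_zero, of "\<lambda>t. (b + t) powr - \<gamma>" at_top \<gamma>] by simp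
    qed auto
    then show ?thesis by simp
  qed
  have "(\<integral>\<^sup>+t\<in>{-pi..pi}. ennreal (cmod (1 - of_real \<rho> * cis t) powr - (\<gamma> + 1)) \<partial>lborel) \<le>
      (\<integral>\<^sup>+t. ennreal (5 powr (\<gamma> + 1)) * (ennreal (?k t) * indicator {0..} t + ennreal (?k (- t)) * indicator {0..} (- t)) \<partial>lborel)"
  proof (rule nn_integral_mono)
    fix t :: real
    show "ennreal (cmod (1 - of_real \<rho> * cis t) powr - (\<gamma> + 1)) * indicator {-pi..pi} t \<le>
      ennreal (5 powr (\<gamma> + 1)) * (ennreal (?k t) * indicator {0..} t + ennreal (?k (- t)) * indicator {0..} (- t))"
    proof (cases "t \<in> {-pi..pi}")
      case True
      then have t: "\<bar>t\<bar> \<le> pi" by auto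
      have "cmod (1 - of_real \<rho> * cis t) powr - (\<gamma> + 1) \<le> ((b + \<bar>t\<bar>) / 5) powr - (\<gamma> + 1)"
        using \<gamma> b by (intro powr_mono2' bound t) auto
      also have "\<dots> = 5 powr (\<gamma> + 1) * ?k \<bar>t\<bar>"
        by (simp only: powr_divide powr_minus_divide) (simp add: field_simps)
      finally have "ennreal (cmod (1 - of_real \<rho> * cis t) powr - (\<gamma> + 1)) \<le> ennreal (5 powr (\<gamma> + 1)) * ennreal (?k \<bar>t\<bar>)"
        by (simp add: ennreal_leI flip: ennreal_mult')
      also have "\<dots> \<le> ennreal (5 powr (\<gamma> + 1)) * (ennreal (?k t) * indicator {0..} t + ennreal (?k (- t)) * indicator {0..} (- t))"
        by (intro mult_left_mono) (auto simp: indicator_def abs_if)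
      finally show ?thesis using True by simp
    qed simp
  qed
  also have "\<dots> = ennreal (5 powr (\<gamma> + 1)) * ((\<integral>\<^sup>+t. ennreal (?k t) * indicator {0..} t \<partial>lborel) +
      (\<integral>\<^sup>+t. ennreal (?k (- t)) * indicator {0..} (- t) \<partial>lborel))"
    by (subst nn_integral_cmult, measurable, subst nn_integral_add) auto
  also have "(\<integral>\<^sup>+t. ennreal (?k (- t)) * indicator {0..} (- t) \<partial>lborel) = (\<integral>\<^sup>+t. ennreal (?k t) * indicator {0..} t \<partial>lborel)"
    by (subst nn_integral_real_affine[where c = "-1" and t = 0]) auto
  also have "ennreal (5 powr (\<gamma> + 1)) * ((\<integral>\<^sup>+t. ennreal (?k t) * indicator {0..} t \<partial>lborel) +
      (\<integral>\<^sup>+t. ennreal (?k t) * indicator {0..} t \<partial>lborel)) = ennreal (2 * 5 powr (\<gamma> + 1) / \<gamma>) * ennreal (b powr - \<gamma>)"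
    unfolding half using \<gamma> by (simp add: field_simps flip: ennreal_mult' ennreal_plus)
  finally show ?thesis by (simp add: b_def)
qed

context doubling_weight
begin

text \<open>In polar coordinates the circle of radius r contributes at most a multiple of (1 - |a| *
  r) powr -\<gamma>, and what remains is the moment of the weight; the Jacobian r is bounded by
  1.\<close>

lemma kernel_integral_le:
  obtains \<gamma>\<^sub>0 where "\<gamma>\<^sub>0 \<ge> 0" "\<And>\<gamma>. \<gamma> > \<gamma>\<^sub>0 \<Longrightarrow> \<exists>A>0. \<forall>a\<in>unit_disc.
    (\<integral>\<^sup>+z\<in>unit_disc. ennreal (cmod (1 - cnj a * z) powr - (\<gamma> + 1)) * G (cmod z) \<partial>lborel)
      \<le> ennreal A * kernel_bound \<gamma> a"
proof -
  obtain \<gamma>\<^sub>0 where \<gamma>0: "\<gamma>\<^sub>0 \<ge> 0" "\<And>\<gamma>. \<gamma> > \<gamma>\<^sub>0 \<Longrightarrow> \<exists>A>0. \<forall>x\<in>{0..<1}.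
    (\<integral>\<^sup>+s\<in>{0<..<1}. G s * ennreal ((1 - x * s) powr - \<gamma>) \<partial>lborel) \<le> ennreal A * (T x * ennreal ((1 - x) powr - \<gamma>))"
    by (rule moment_le) blast
  show ?thesis
  proof (rule that[of \<gamma>\<^sub>0, OF \<gamma>0(1)])
    fix \<gamma> assume \<gamma>: "\<gamma> > \<gamma>\<^sub>0"
    then obtain A where A: "A > 0" "\<And>x. x \<in> {0..<1} \<Longrightarrow>
      (\<integral>\<^sup>+s\<in>{0<..<1}. G s * ennreal ((1 - x * s) powr - \<gamma>) \<partial>lborel) \<le> ennreal A * (T x * ennreal ((1 - x) powr - \<gamma>))"
      using \<gamma>0(2) by blast
    have \<gamma>pos: "\<gamma> > 0" using \<gamma> \<gamma>0(1) by simp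
    define B where "B = 2 * 5 powr (\<gamma> + 1) / \<gamma>"
    have B: "B > 0" using \<gamma>pos by (simp add: B_def)
    show "\<exists>A>0. \<forall>a\<in>unit_disc.
      (\<integral>\<^sup>+z\<in>unit_disc. ennreal (cmod (1 - cnj a * z) powr - (\<gamma> + 1)) * G (cmod z) \<partial>lborel)
      \<le> ennreal A * kernel_bound \<gamma> a"
    proof (intro exI[of _ "B * A"] conjI ballI)
      show "B * A > 0" using A B by simp
      fix a :: complex assume a: "a \<in> unit_disc"
      define h where "h = (\<lambda>w. ennreal (cmod (1 - w) powr - (\<gamma> + 1)))"
      have h[measurable]: "h \<in> borel_measurable borel" unfolding h_def by measurable
      have "(\<integral>\<^sup>+z\<in>unit_disc. ennreal (cmod (1 - cnj a * z) powr - (\<gamma> + 1)) * G (cmod z) \<partial>lborel) =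
          (\<integral>\<^sup>+r\<in>{0<..<1}. ennreal r * (\<integral>\<^sup>+t\<in>{-pi..pi}. h (cnj a * (of_real r * cis t)) * G (cmod (of_real r * cis t)) \<partial>lborel) \<partial>lborel)"
        unfolding h_def[symmetric] by (subst nn_integral_polar_disc) (auto simp: h_def)
      also have "\<dots> \<le> (\<integral>\<^sup>+r. ennreal B * (G r * ennreal ((1 - cmod a * r) powr - \<gamma>) * indicator {0<..<1} r) \<partial>lborel)"
      proof (rule nn_integral_mono)
        fix r :: real
        show "ennreal r * (\<integral>\<^sup>+t\<in>{-pi..pi}. h (cnj a * (of_real r * cis t)) * G (cmod (of_real r * cis t)) \<partial>lborel) * indicator {0<..<1} r
          \<le> ennreal B * (G r * ennreal ((1 - cmod a * r) powr - \<gamma>) * indicator {0<..<1} r)"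
        proof (cases "r \<in> {0<..<1}")
          case True
          have ar: "0 \<le> cmod a * r" "cmod a * r < 1"
            using True a mult_strict_mono'[of "cmod a" 1 r 1] by auto
          have "(\<integral>\<^sup>+t\<in>{-pi..pi}. h (cnj a * (of_real r * cis t)) * G (cmod (of_real r * cis t)) \<partial>lborel) =
              G r * (\<integral>\<^sup>+t\<in>{-pi..pi}. h ((cnj a * of_real r) * cis t) \<partial>lborel)"
            using True by (subst nn_integral_cmult[symmetric]) (auto intro!: nn_integral_cong simp: norm_mult ac_simps)
          also have "(\<integral>\<^sup>+t\<in>{-pi..pi}. h ((cnj a * of_real r) * cis t) \<partial>lborel) =
              (\<integral>\<^sup>+t\<in>{-pi..pi}. h (of_real (cmod a * r) * cis t) \<partial>lborel)"
            using True by (subst nn_integral_circle_rotate[OF h]) (simp add: norm_mult)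
          also have "\<dots> \<le> ennreal B * ennreal ((1 - cmod a * r) powr - \<gamma>)"
            unfolding h_def B_def by (rule circle_kernel_integral_le[OF \<gamma>pos ar])
          finally have "(\<integral>\<^sup>+t\<in>{-pi..pi}. h (cnj a * (of_real r * cis t)) * G (cmod (of_real r * cis t)) \<partial>lborel) \<le>
              G r * (ennreal B * ennreal ((1 - cmod a * r) powr - \<gamma>))"
            by (simp add: mult_left_mono)
          then have "ennreal r * (\<integral>\<^sup>+t\<in>{-pi..pi}. h (cnj a * (of_real r * cis t)) * G (cmod (of_real r * cis t)) \<partial>lborel) \<le>
              1 * (G r * (ennreal B * ennreal ((1 - cmod a * r) powr - \<gamma>)))"
            using True by (intro mult_mono) (auto simp: ennreal_le_1)
          then show ?thesis using True by (simp add: ac_simps)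
        qed simp
      qed
      also have "\<dots> = ennreal B * (\<integral>\<^sup>+r\<in>{0<..<1}. G r * ennreal ((1 - cmod a * r) powr - \<gamma>) \<partial>lborel)"
        by (rule nn_integral_cmult) measurable
      also have "\<dots> \<le> ennreal B * (ennreal A * kernel_bound \<gamma> a)"
        using a by (intro mult_left_mono A(2)) auto
      also have "\<dots> = ennreal (B * A) * kernel_bound \<gamma> a"
        using A B by (simp add: ennreal_mult mult.assoc)
      finally show "(\<integral>\<^sup>+z\<in>unit_disc. ennreal (cmod (1 - cnj a * z) powr - (\<gamma> + 1)) * G (cmod z) \<partial>lborel)
        \<le> ennreal (B * A) * kernel_bound \<gamma> a" .
    qed
  qed
qed

end

section \<open>Carleson measures\<close>

text \<open>The fibre that appears when a double integral over Whitney balls is taken in the other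
  order; it takes the place of a Carleson square.\<close>

definition whitney_shadow :: "complex \<Rightarrow> complex set" where
  "whitney_shadow u = {w \<in> unit_disc. u \<in> whitney_ball w}"

text \<open>Distances to the unit circle are comparable on a shadow. The last bound says that there
  the kernel at \<open>u\<close> is within a constant of its largest possible size, since |1 - cnj u
  * w| is never below 1 - |u|.\<close>

lemma whitney_shadowD:
  assumes "w \<in> whitney_shadow u"
  shows "cmod w < 1" "cmod u < 1" "dist u w < (1 - cmod w) / 2"
    "(1 - cmod w) / 2 < 1 - cmod u" "1 - cmod u < 3 / 2 * (1 - cmod w)"
    "cmod (1 - cnj u * w) \<le> 3 * (1 - cmod u)"
proof -
  show w: "cmod w < 1" and d: "dist u w < (1 - cmod w) / 2"
    using assms by (auto simp: whitney_shadow_def whitney_ball_def dist_commute)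
  have "\<bar>cmod u - cmod w\<bar> \<le> dist u w"
    by (simp add: dist_norm norm_triangle_ineq3)
  with w d show u: "cmod u < 1" and 1: "(1 - cmod w) / 2 < 1 - cmod u" and "1 - cmod u < 3 / 2 * (1 - cmod w)"
    by auto
  show "cmod (1 - cnj u * w) \<le> 3 * (1 - cmod u)"
  proof -
    have "x \<le> 3 * s" if "x \<le> 2 * s + y" "r / 2 < s" "y < r / 2" for x y r s :: real
      using that by linarith
    from this[OF cmod_one_minus_cnj_mult_le[OF u w] 1 d] show ?thesis .
  qed
qed

lemma whitney_shadow_measurable [measurable]: "whitney_shadow u \<in> sets borel"
proof -
  have "Measurable.pred borel (\<lambda>w. w \<in> unit_disc \<and> dist w u < (1 - cmod w) / 2)"
    by measurable
  moreover have "whitney_shadow u = {w. w \<in> unit_disc \<and> dist w u < (1 - cmod w) / 2}"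
    by (auto simp: whitney_shadow_def whitney_ball_def)
  ultimately show ?thesis by (simp add: pred_def)
qed

lemma whitney_pairs_measurable: "{x::complex \<times> complex. dist (fst x) (snd x) < (1 - cmod (fst x)) / 2} \<in> sets (borel \<Otimes>\<^sub>M borel)"
proof -
  have "Measurable.pred (borel \<Otimes>\<^sub>M borel) (\<lambda>x::complex \<times> complex. dist (fst x) (snd x) < (1 - cmod (fst x)) / 2)"
    by measurable
  then show ?thesis by (simp add: pred_def space_pair_measure)
qed

lemma whitney_mean_measurable [measurable]:
  assumes f: "f holomorphic_on unit_disc"
  shows "whitney_mean p f \<in> borel_measurable borel"
proof -
  note [measurable] = disc_powr_measurable[OF f] whitney_pairs_measurable
  have "whitney_mean p f = (\<lambda>z. ennreal (1 / (1 - cmod z)\<^sup>2) *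
     (\<integral>\<^sup>+u. disc_powr p f u * indicator {x. dist (fst x) (snd x) < (1 - cmod (fst x)) / 2} (z, u) \<partial>lborel))"
    by (auto simp: whitney_mean_def whitney_ball_def indicator_def fun_eq_iff)
  also have "\<dots> \<in> borel_measurable borel"
    by measurable
  finally show ?thesis .
qed

text \<open>Any point of a dense set inside the Whitney ball of \<open>w\<close> has
  \<open>w\<close> in its shadow. The cover serves to prove sigma-finiteness.\<close>

lemma unit_disc_countable_shadows:
  obtains Q :: "complex set" where "countable Q" "Q \<subseteq> unit_disc" "unit_disc \<subseteq> (\<Union>u\<in>Q. whitney_shadow u)"
proof -
  obtain D :: "complex set" where D: "countable D" "\<And>X. open X \<Longrightarrow> X \<noteq> {} \<Longrightarrow> \<exists>d\<in>D. d \<in> X"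
    by (rule countable_dense_setE) blast
  show ?thesis
  proof (rule that[of "D \<inter> unit_disc"])
    show "unit_disc \<subseteq> (\<Union>u\<in>D \<inter> unit_disc. whitney_shadow u)"
    proof
      fix w :: complex assume w: "w \<in> unit_disc"
      then have "whitney_ball w \<noteq> {}" "open (whitney_ball w)" by (auto simp: whitney_ball_def)
      then obtain d where d: "d \<in> D" "d \<in> whitney_ball w" using D(2) by blast
      then have "w \<in> whitney_shadow d" using w by (simp add: whitney_shadow_def)
      with whitney_shadowD(2)[OF this] d(1) show "w \<in> (\<Union>u\<in>D \<inter> unit_disc. whitney_shadow u)" by auto
    qed
  qed (use D in auto)
qed

context doubling_weight
begin

text \<open>By Tonelli the point u receives at most a multiple of the measure of its shadow divided
  by (1 - |u|)^2, that is K * T(|u|) / (1 - |u|), the density handled by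
  \<open>nn_integral_T_le\<close>.\<close>

lemma carleson_whitney_mean:
  obtains c where "c > 0"
    "\<And>p f \<mu> K. p > 0 \<Longrightarrow> f holomorphic_on unit_disc \<Longrightarrow> sets \<mu> = sets borel \<Longrightarrow> K \<ge> 0 \<Longrightarrow>
      emeasure \<mu> (- unit_disc) = 0 \<Longrightarrow>
      (\<And>u. u \<in> unit_disc \<Longrightarrow> emeasure \<mu> (whitney_shadow u) \<le> ennreal K * (T (cmod u) * ennreal (1 - cmod u))) \<Longrightarrow>
      (\<integral>\<^sup>+w\<in>unit_disc. whitney_mean p f w \<partial>\<mu>) \<le> ennreal (c * K) * mass p f"
proof -
  obtain c where c: "c > 0"
    "\<And>p f. p > 0 \<Longrightarrow> f holomorphic_on unit_disc \<Longrightarrow>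
      (\<integral>\<^sup>+z. disc_powr p f z * (T (cmod z) * ennreal (1 / (1 - cmod z))) \<partial>lborel) \<le>
      ennreal c * mass p f"
    by (rule nn_integral_T_le) blast
  show ?thesis
  proof (rule that[of "9 / 4 * c"])
    fix p :: real and f :: "complex \<Rightarrow> complex" and \<mu> :: "complex measure" and K :: real
    assume p: "p > 0" and f: "f holomorphic_on unit_disc" and \<mu>[measurable_cong]: "sets \<mu> = sets borel"
      and K: "K \<ge> 0" and null: "emeasure \<mu> (- unit_disc) = 0"
      and carl: "\<And>u. u \<in> unit_disc \<Longrightarrow> emeasure \<mu> (whitney_shadow u) \<le> ennreal K * (T (cmod u) * ennreal (1 - cmod u))"
    note [measurable] = disc_powr_measurable[OF f] whitney_pairs_measurable
    have space: "space \<mu> = UNIV" using sets_eq_imp_space_eq[OF \<mu>] by simp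
    obtain Q :: "complex set" where Q: "countable Q" "Q \<subseteq> unit_disc" "unit_disc \<subseteq> (\<Union>u\<in>Q. whitney_shadow u)"
      by (rule unit_disc_countable_shadows)
    \<comment> \<open>Each shadow has finite measure by the Carleson bound, since T is finite. The
      complement of the disc is a null set and completes the cover of the plane.\<close>
    interpret sigma_finite_measure \<mu>
    proof
      show "\<exists>A. countable A \<and> A \<subseteq> sets \<mu> \<and> \<Union> A = space \<mu> \<and> (\<forall>a\<in>A. emeasure \<mu> a \<noteq> \<infinity>)"
      proof (intro exI[of _ "insert (- unit_disc) (whitney_shadow ` Q)"] conjI)
        show "\<Union> (insert (- unit_disc) (whitney_shadow ` Q)) = space \<mu>"
          using Q space by auto
        have "emeasure \<mu> (whitney_shadow u) \<noteq> \<infinity>" if "u \<in> Q" for u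
        proof -
          have "T (cmod u) < \<infinity>" using that Q by (intro T_less_top) auto
          then have "ennreal K * (T (cmod u) * ennreal (1 - cmod u)) < \<infinity>"
            by (simp add: ennreal_mult_less_top)
          moreover have "u \<in> unit_disc" using that Q(2) by blast
          ultimately have "emeasure \<mu> (whitney_shadow u) < \<infinity>"
            using carl le_less_trans by blast
          then show ?thesis by simp
        qed
        with null show "\<forall>a\<in>insert (- unit_disc) (whitney_shadow ` Q). emeasure \<mu> a \<noteq> \<infinity>"
          by auto
      qed (use Q \<mu> in auto)
    qed
    interpret pair_sigma_finite \<mu> lborel ..
    let ?S = "{x::complex \<times> complex. dist (fst x) (snd x) < (1 - cmod (fst x)) / 2}"
    have "(\<integral>\<^sup>+w\<in>unit_disc. whitney_mean p f w \<partial>\<mu>) =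
        (\<integral>\<^sup>+w. \<integral>\<^sup>+u. ennreal (1 / (1 - cmod w)\<^sup>2) * (disc_powr p f u * indicator ?S (w, u)) * indicator unit_disc w \<partial>lborel \<partial>\<mu>)"
    proof (rule nn_integral_cong)
      fix w :: complex
      have "(\<integral>\<^sup>+u. disc_powr p f u * indicator (whitney_ball w) u \<partial>lborel) =
          (\<integral>\<^sup>+u. disc_powr p f u * indicator ?S (w, u) \<partial>lborel)"
        by (intro nn_integral_cong) (auto simp: whitney_ball_def indicator_def)
      then show "whitney_mean p f w * indicator unit_disc w = (\<integral>\<^sup>+u. ennreal (1 / (1 - cmod w)\<^sup>2) *
          (disc_powr p f u * indicator ?S (w, u)) * indicator unit_disc w \<partial>lborel)"
        by (subst nn_integral_multc, measurable, subst nn_integral_cmult, measurable) (simp add: whitney_mean_def)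
    qed
    also have "\<dots> = (\<integral>\<^sup>+u. \<integral>\<^sup>+w. ennreal (1 / (1 - cmod w)\<^sup>2) * (disc_powr p f u * indicator ?S (w, u)) * indicator unit_disc w \<partial>\<mu> \<partial>lborel)"
      by (rule Fubini'[symmetric]) measurable
    also have "\<dots> \<le> (\<integral>\<^sup>+u. ennreal (9 / 4 * K) * (disc_powr p f u * (T (cmod u) * ennreal (1 / (1 - cmod u)))) \<partial>lborel)"
    proof (rule nn_integral_mono)
      fix u :: complex
      show "(\<integral>\<^sup>+w. ennreal (1 / (1 - cmod w)\<^sup>2) * (disc_powr p f u * indicator ?S (w, u)) * indicator unit_disc w \<partial>\<mu>)
        \<le> ennreal (9 / 4 * K) * (disc_powr p f u * (T (cmod u) * ennreal (1 / (1 - cmod u))))"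
      proof (cases "u \<in> unit_disc")
        case True
        define d where "d = 1 - cmod u"
        have d: "d > 0" using True by (simp add: d_def)
        have "(\<integral>\<^sup>+w. ennreal (1 / (1 - cmod w)\<^sup>2) * (disc_powr p f u * indicator ?S (w, u)) * indicator unit_disc w \<partial>\<mu>)
          \<le> (\<integral>\<^sup>+w. (ennreal (9 / 4 / d\<^sup>2) * disc_powr p f u) * indicator (whitney_shadow u) w \<partial>\<mu>)"
        proof (rule nn_integral_mono)
          fix w :: complex
          show "ennreal (1 / (1 - cmod w)\<^sup>2) * (disc_powr p f u * indicator ?S (w, u)) * indicator unit_disc w
            \<le> (ennreal (9 / 4 / d\<^sup>2) * disc_powr p f u) * indicator (whitney_shadow u) w"
          proof (cases "w \<in> whitney_shadow u")
            case w: True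
            \<comment> \<open>On the shadow 1 - |u| < 3 / 2 * (1 - |w|); squaring the ratio gives
              the constant 9 / 4.\<close>
            have "(2 / 3 * d)\<^sup>2 \<le> (1 - cmod w)\<^sup>2"
              using whitney_shadowD[OF w] d by (intro power_mono) (auto simp: d_def)
            then have "1 / (1 - cmod w)\<^sup>2 \<le> 1 / (2 / 3 * d)\<^sup>2"
              using d by (intro divide_left_mono mult_pos_pos) (use whitney_shadowD(1)[OF w] in auto)
            also have "\<dots> = 9 / 4 / d\<^sup>2"
              by (simp add: power_mult_distrib power_divide)
            finally have "ennreal (1 / (1 - cmod w)\<^sup>2) * disc_powr p f u \<le> ennreal (9 / 4 / d\<^sup>2) * disc_powr p f u"
              by (intro mult_right_mono ennreal_leI) auto
            then show ?thesis using w by (simp add: indicator_def)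
          next
            case False
            then have "\<not> (dist w u < (1 - cmod w) / 2 \<and> w \<in> unit_disc)"
              by (auto simp: whitney_shadow_def whitney_ball_def)
            then show ?thesis by (auto simp: indicator_def)
          qed
        qed
        also have "\<dots> = (ennreal (9 / 4 / d\<^sup>2) * disc_powr p f u) * emeasure \<mu> (whitney_shadow u)"
          by (rule nn_integral_cmult_indicator) measurable
        also have "\<dots> \<le> (ennreal (9 / 4 / d\<^sup>2) * disc_powr p f u) * (ennreal K * (T (cmod u) * ennreal d))"
          unfolding d_def by (intro mult_left_mono carl True) simp
        also have "\<dots> = (ennreal (9 / 4 / d\<^sup>2) * ennreal K * ennreal d) * (disc_powr p f u * T (cmod u))"
          by (simp add: ac_simps)
        also have "ennreal (9 / 4 / d\<^sup>2) * ennreal K * ennreal d = ennreal (9 / 4 * K) * ennreal (1 / d)"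
          using d K by (simp add: power2_eq_square flip: ennreal_mult')
        finally show ?thesis by (simp add: d_def ac_simps)
      qed (simp add: disc_powr_def)
    qed
    also have "\<dots> = ennreal (9 / 4 * K) * (\<integral>\<^sup>+u. disc_powr p f u * (T (cmod u) * ennreal (1 / (1 - cmod u))) \<partial>lborel)"
      by (rule nn_integral_cmult) measurable
    also have "\<dots> \<le> ennreal (9 / 4 * K) * (ennreal c * mass p f)"
      by (intro mult_left_mono c(2) p f) simp
    also have "\<dots> = ennreal (9 / 4 * c * K) * mass p f"
    proof -
      have "ennreal (9 / 4 * c * K) = ennreal (9 / 4 * K) * ennreal c"
        using K c(1) by (simp add: ac_simps flip: ennreal_mult')
      then show ?thesis by (simp only: mult.assoc)
    qed
    finally show "(\<integral>\<^sup>+w\<in>unit_disc. whitney_mean p f w \<partial>\<mu>) \<le>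
      ennreal (9 / 4 * c * K) * mass p f" .
  qed (use c in simp)
qed

end

section \<open>Test functions\<close>

lemma borel_measure_on_disc_measurable:
  assumes \<nu>: "borel_measure_on_disc \<nu>"
  shows "space \<nu> = unit_disc"
    and "h holomorphic_on unit_disc \<Longrightarrow> h \<in> borel_measurable \<nu>"
proof -
  have s: "sets \<nu> = sets (restrict_space borel unit_disc)"
    using \<nu> by (simp add: borel_measure_on_disc_def)
  show "space \<nu> = unit_disc"
    using sets_eq_imp_space_eq[OF s] by (simp add: space_restrict_space)
  assume "h holomorphic_on unit_disc"
  then have "h \<in> borel_measurable (restrict_space borel unit_disc)"
    by (intro borel_measurable_continuous_on_restrict holomorphic_on_imp_continuous_on)
  then show "h \<in> borel_measurable \<nu>"
    using measurable_cong_sets[OF s refl] by blast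
qed

lemma analytic_self_mapD:
  assumes "analytic_self_map \<phi>"
  shows "\<phi> holomorphic_on unit_disc" "z \<in> unit_disc \<Longrightarrow> \<phi> z \<in> unit_disc"
    "h holomorphic_on unit_disc \<Longrightarrow> (\<lambda>z. h (\<phi> z)) holomorphic_on unit_disc"
  using assms holomorphic_on_compose_gen[of \<phi> unit_disc h unit_disc]
  by (auto simp: analytic_self_map_def o_def image_subset_iff)

abbreviation dist_powr :: "real \<Rightarrow> (complex \<Rightarrow> complex) \<Rightarrow> (complex \<Rightarrow> complex) \<Rightarrow> complex \<Rightarrow> real" where
  "dist_powr p \<phi> \<psi> \<equiv> (\<lambda>z. pseudohyperbolic_dist (\<phi> z) (\<psi> z) powr p)"

text \<open>The integral is the mass of the shadow under the push-forward of \<open>s\<close> d\<nu>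
  by \<open>\<phi>\<close>. The right side has the order of the weighted area of a Carleson square
  at \<open>u\<close>.\<close>

definition carleson_bound ::
    "(real \<Rightarrow> ennreal) \<Rightarrow> complex measure \<Rightarrow> (complex \<Rightarrow> real) \<Rightarrow> (complex \<Rightarrow> complex) \<Rightarrow> real \<Rightarrow> bool" where
  "carleson_bound T \<nu> s \<phi> K \<longleftrightarrow> (\<forall>u\<in>unit_disc.
     (\<integral>\<^sup>+z. ennreal (s z) * indicator (whitney_shadow u) (\<phi> z) \<partial>\<nu>) \<le> ennreal K * (T (cmod u) * ennreal (1 - cmod u)))"

text \<open>The exponent is divided by \<open>p\<close> so that the p-th power of the modulus is
  free of \<open>p\<close>. On the disc 1 - cnj a * w has positive real part, so the principal
  branch is holomorphic.\<close>

definition kernel_fun :: "real \<Rightarrow> real \<Rightarrow> complex \<Rightarrow> complex \<Rightarrow> complex" where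
  "kernel_fun \<gamma> p a w = (1 - cnj a * w) powr of_real (- (\<gamma> + 1) / p)"

lemma kernel_fun_norm:
  assumes "p > 0"
  shows "cmod (kernel_fun \<gamma> p a w) powr p = cmod (1 - cnj a * w) powr - (\<gamma> + 1)"
  using assms by (simp add: kernel_fun_def norm_powr_real_powr' powr_powr)

lemma kernel_fun_holomorphic:
  assumes "cmod a < 1"
  shows "kernel_fun \<gamma> p a holomorphic_on unit_disc"
proof -
  have "1 - cnj a * w \<notin> \<real>\<^sub>\<le>\<^sub>0" if "w \<in> unit_disc" for w
  proof -
    have "cmod (cnj a * w) < 1"
      using that assms mult_strict_mono'[of "cmod a" 1 "cmod w" 1] by (simp add: norm_mult)
    then have "Re (cnj a * w) < 1"
      using complex_Re_le_cmod[of "cnj a * w"] by linarith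
    then show ?thesis by (auto simp: complex_nonpos_Reals_iff)
  qed
  then show ?thesis
    unfolding kernel_fun_def by (intro holomorphic_intros) auto
qed

lemma one_minus_cnj_mult_nonzero:
  assumes "cmod a < 1" "cmod w < 1"
  shows "1 - cnj a * w \<noteq> 0"
  using cmod_one_minus_cnj_mult_ge[OF assms] assms by auto

lemma moebius_norm_le_one:
  assumes a: "cmod a < 1" and w: "cmod w < 1"
  shows "cmod ((a - w) / (1 - cnj a * w)) \<le> 1"
proof -
  have "(cmod (a - w))\<^sup>2 + (1 - (cmod a)\<^sup>2) * (1 - (cmod w)\<^sup>2) = (cmod (1 - cnj a * w))\<^sup>2"
    by (simp add: cmod_power2) (simp add: power2_eq_square algebra_simps)
  moreover have "(1 - (cmod a)\<^sup>2) * (1 - (cmod w)\<^sup>2) \<ge> 0"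
    using a w by (intro mult_nonneg_nonneg) (auto simp: power_le_one)
  ultimately have "(cmod (a - w))\<^sup>2 \<le> (cmod (1 - cnj a * w))\<^sup>2" by linarith
  then have "cmod (a - w) \<le> cmod (1 - cnj a * w)"
    by (rule power2_le_imp_le) simp
  then show ?thesis
    using one_minus_cnj_mult_nonzero[OF a w] by (simp add: norm_divide)
qed

text \<open>For \<open>v\<close> close to \<open>a\<close>, the automorphism \<open>m\<close> separates \<open>v\<close> from \<open>w\<close> by a multiple of their pseudohyperbolic
  distance, and \<open>F v (m v - m w) = (F v m v - F w m w) - m w (F v - F w)\<close>.\<close>

lemma pseudohyperbolic_dist_test_le:
  assumes v: "v \<in> whitney_shadow a" and w: "cmod w < 1"
  defines "m \<equiv> \<lambda>w. (a - w) / (1 - cnj a * w)"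
  shows "pseudohyperbolic_dist v w * cmod (F v) \<le> 9 / 2 * (cmod (F v * m v - F w * m w) + cmod (F v - F w))"
proof -
  note sh = whitney_shadowD[OF v]
  have a: "cmod a < 1" and v1: "cmod v < 1" using sh by auto
  have nz: "1 - cnj a * v \<noteq> 0" "1 - cnj a * w \<noteq> 0" "1 - cnj v * w \<noteq> 0"
    using one_minus_cnj_mult_nonzero a v1 w by auto
  have m1: "cmod (m w) \<le> 1"
    unfolding m_def by (rule moebius_norm_le_one[OF a w])
  have "m v - m w = (1 - a * cnj a) * (w - v) / ((1 - cnj a * v) * (1 - cnj a * w))"
    using nz by (simp add: m_def field_simps)
  also have "1 - a * cnj a = of_real (1 - (cmod a)\<^sup>2)"
    by (simp only: of_real_diff of_real_1 complex_norm_square)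
  finally have "cmod (m v - m w) = \<bar>1 - (cmod a)\<^sup>2\<bar> * dist v w / (cmod (1 - cnj a * v) * cmod (1 - cnj a * w))"
    by (simp only: norm_mult norm_divide norm_of_real dist_norm norm_minus_commute)
  also have "\<bar>1 - (cmod a)\<^sup>2\<bar> = (1 - cmod a) * (1 + cmod a)"
    using a power_le_one[of "cmod a" 2] by (simp add: power2_eq_square algebra_simps)
  finally have md: "cmod (m v - m w) = (1 - cmod a) * (1 + cmod a) * dist v w / (cmod (1 - cnj a * v) * cmod (1 - cnj a * w))" .
  \<comment> \<open>As \<open>v\<close> lies near \<open>a\<close>, replacing \<open>a\<close> by
    \<open>v\<close> in the kernel costs at most |a - v| < (1 - |v|) / 2, which is half of a lower
    bound for the new kernel.\<close>
  have den: "cmod (1 - cnj a * w) \<le> 3 / 2 * cmod (1 - cnj v * w)"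
  proof -
    have "1 - cnj a * w = (1 - cnj v * w) + cnj (v - a) * w" by (simp add: algebra_simps)
    then have "cmod (1 - cnj a * w) \<le> cmod (1 - cnj v * w) + cmod (cnj (v - a) * w)"
      by (metis norm_triangle_ineq)
    also have "cmod (cnj (v - a) * w) \<le> dist a v * 1"
      unfolding norm_mult complex_mod_cnj using w by (intro mult_mono) (auto simp: dist_norm norm_minus_commute)
    also have "dist a v * 1 \<le> 1 / 2 * cmod (1 - cnj v * w)"
      using sh(3) cmod_one_minus_cnj_mult_ge[OF v1 w] by simp
    finally show ?thesis by simp
  qed
  \<comment> \<open>Of the two denominators in \<open>md\<close>, one is at most 3 * (1 - |a|) and
    the other at most 3 / 2 times the denominator of the pseudohyperbolic distance; this gives 9 /
    2, and the factor 1 - |a| cancels.\<close>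
  have "pseudohyperbolic_dist v w \<le> 9 / 2 * cmod (m v - m w)"
  proof -
    have "cmod (1 - cnj a * v) * cmod (1 - cnj a * w) \<le> (3 * (1 - cmod a)) * (3 / 2 * cmod (1 - cnj v * w))"
      using sh(6) den a by (intro mult_mono) auto
    also have "\<dots> \<le> 9 / 2 * ((1 - cmod a) * (1 + cmod a)) * cmod (1 - cnj v * w)"
    proof -
      have "(1 - cmod a) * 1 \<le> (1 - cmod a) * (1 + cmod a)"
        using a by (intro mult_left_mono) auto
      then have "9 / 2 * cmod (1 - cnj v * w) * ((1 - cmod a) * 1) \<le>
          9 / 2 * cmod (1 - cnj v * w) * ((1 - cmod a) * (1 + cmod a))"
        by (rule mult_left_mono) simp
      moreover have "3 * x * (3 / 2 * y) = 9 / 2 * y * (x * 1)" "9 / 2 * z * y = 9 / 2 * y * z" for x y z :: real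
        by simp_all
      ultimately show ?thesis by metis
    qed
    finally have "dist v w * (cmod (1 - cnj a * v) * cmod (1 - cnj a * w)) \<le>
        dist v w * (9 / 2 * ((1 - cmod a) * (1 + cmod a)) * cmod (1 - cnj v * w))"
      by (rule mult_left_mono) simp
    then show ?thesis
      unfolding md pseudohyperbolic_dist_eq using nz by (simp add: divide_simps ac_simps)
  qed
  then have "pseudohyperbolic_dist v w * cmod (F v) \<le> 9 / 2 * cmod (m v - m w) * cmod (F v)"
    by (rule mult_right_mono) simp
  also have "\<dots> = 9 / 2 * cmod ((F v * m v - F w * m w) - m w * (F v - F w))"
    by (simp add: algebra_simps flip: norm_mult)
  also have "\<dots> \<le> 9 / 2 * (cmod (F v * m v - F w * m w) + cmod (F v - F w))"
  proof (intro mult_left_mono)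
    have "cmod ((F v * m v - F w * m w) - m w * (F v - F w)) \<le> cmod (F v * m v - F w * m w) + cmod (m w) * cmod (F v - F w)"
      by (metis norm_triangle_ineq4 norm_mult)
    also have "cmod (m w) * cmod (F v - F w) \<le> 1 * cmod (F v - F w)"
      using m1 by (rule mult_right_mono) simp
    finally show "cmod ((F v * m v - F w * m w) - m w * (F v - F w)) \<le> cmod (F v * m v - F w * m w) + cmod (F v - F w)"
      by simp
  qed simp
  finally show ?thesis .
qed

lemma pseudohyperbolic_dist_nonneg [simp]: "pseudohyperbolic_dist v w \<ge> 0"
  by (simp add: pseudohyperbolic_dist_def)

lemma pseudohyperbolic_dist_commute: "pseudohyperbolic_dist v w = pseudohyperbolic_dist w v"
proof -
  have "cmod (1 - cnj v * w) = cmod (cnj (1 - cnj v * w))" by (rule complex_mod_cnj[symmetric])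
  also have "cnj (1 - cnj v * w) = 1 - cnj w * v" by simp
  finally show ?thesis by (simp add: pseudohyperbolic_dist_eq dist_commute)
qed

section \<open>From the Carleson condition to norm estimates\<close>

context doubling_weight
begin

text \<open>Change of variables: the estimate for Whitney means is applied to the push-forward
  measure, which gives no mass to the complement of the disc.\<close>

lemma carleson_composition:
  obtains c where "c > 0"
    "\<And>p f \<nu> s \<phi> K. p > 0 \<Longrightarrow> f holomorphic_on unit_disc \<Longrightarrow> borel_measure_on_disc \<nu> \<Longrightarrow> analytic_self_map \<phi> \<Longrightarrow>
      s \<in> borel_measurable \<nu> \<Longrightarrow> K \<ge> 0 \<Longrightarrow> carleson_bound T \<nu> s \<phi> K \<Longrightarrow>
      (\<integral>\<^sup>+z. ennreal (s z) * whitney_mean p f (\<phi> z) \<partial>\<nu>) \<le> ennreal (c * K) * mass p f"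
proof -
  obtain c where c: "c > 0"
    "\<And>p f \<mu> K. p > 0 \<Longrightarrow> f holomorphic_on unit_disc \<Longrightarrow> sets \<mu> = sets borel \<Longrightarrow> K \<ge> 0 \<Longrightarrow>
      emeasure \<mu> (- unit_disc) = 0 \<Longrightarrow>
      (\<And>u. u \<in> unit_disc \<Longrightarrow> emeasure \<mu> (whitney_shadow u) \<le> ennreal K * (T (cmod u) * ennreal (1 - cmod u))) \<Longrightarrow>
      (\<integral>\<^sup>+w\<in>unit_disc. whitney_mean p f w \<partial>\<mu>) \<le> ennreal (c * K) * mass p f"
    by (rule carleson_whitney_mean) blast
  show ?thesis
  proof (rule that[OF c(1)])
    fix p :: real and f :: "complex \<Rightarrow> complex" and \<nu> :: "complex measure" and s \<phi> K
    assume p: "p > 0" and f: "f holomorphic_on unit_disc" and \<nu>: "borel_measure_on_disc \<nu>"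
      and \<phi>: "analytic_self_map \<phi>" and s[measurable]: "s \<in> borel_measurable \<nu>" and K: "K \<ge> 0"
      and carl: "carleson_bound T \<nu> s \<phi> K"
    have [measurable]: "\<phi> \<in> borel_measurable \<nu>"
      by (intro borel_measure_on_disc_measurable[OF \<nu>] analytic_self_mapD[OF \<phi>])
    note [measurable] = whitney_mean_measurable[OF f]
    have \<phi>1: "\<phi> z \<in> unit_disc" if "z \<in> space \<nu>" for z
      using analytic_self_mapD(2)[OF \<phi>] that borel_measure_on_disc_measurable(1)[OF \<nu>] by simp
    define \<mu> where "\<mu> = distr (density \<nu> (\<lambda>z. ennreal (s z))) borel \<phi>"
    have int: "(\<integral>\<^sup>+w. h w \<partial>\<mu>) = (\<integral>\<^sup>+z. ennreal (s z) * h (\<phi> z) \<partial>\<nu>)"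
      if [measurable]: "h \<in> borel_measurable borel" for h
      unfolding \<mu>_def by (simp add: nn_integral_distr nn_integral_density)
    have emeas: "emeasure \<mu> X = (\<integral>\<^sup>+z. ennreal (s z) * indicator X (\<phi> z) \<partial>\<nu>)" if "X \<in> sets borel" for X
      using int[of "indicator X"] that by (simp add: \<mu>_def)
    have "(\<integral>\<^sup>+z. ennreal (s z) * whitney_mean p f (\<phi> z) \<partial>\<nu>) =
        (\<integral>\<^sup>+z. ennreal (s z) * (whitney_mean p f (\<phi> z) * indicator unit_disc (\<phi> z)) \<partial>\<nu>)"
      using \<phi>1 by (intro nn_integral_cong) simp
    also have "\<dots> = (\<integral>\<^sup>+w\<in>unit_disc. whitney_mean p f w \<partial>\<mu>)"
      by (subst int) simp_all
    also have "\<dots> \<le> ennreal (c * K) * mass p f"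
    proof (rule c(2)[OF p f _ K])
      show "sets \<mu> = sets borel" by (simp add: \<mu>_def)
      have "emeasure \<mu> (- unit_disc) = (\<integral>\<^sup>+z. ennreal (s z) * indicator (- unit_disc) (\<phi> z) \<partial>\<nu>)"
        by (intro emeas) simp
      also have "\<dots> = (\<integral>\<^sup>+z. 0 \<partial>\<nu>)"
        using \<phi>1 by (intro nn_integral_cong) simp
      finally show "emeasure \<mu> (- unit_disc) = 0" by simp
      show "emeasure \<mu> (whitney_shadow u) \<le> ennreal K * (T (cmod u) * ennreal (1 - cmod u))" if "u \<in> unit_disc" for u
        using carl that by (simp add: emeas carleson_bound_def)
    qed
    finally show "(\<integral>\<^sup>+z. ennreal (s z) * whitney_mean p f (\<phi> z) \<partial>\<nu>) \<le> ennreal (c * K) * mass p f" .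
  qed
qed

end

context doubling_weight
begin

lemma weighted_composition_le:
  assumes p: "p > 0"
  obtains c where "c > 0"
    "\<And>f \<nu> s \<phi> K. f holomorphic_on unit_disc \<Longrightarrow> borel_measure_on_disc \<nu> \<Longrightarrow> analytic_self_map \<phi> \<Longrightarrow>
      s \<in> borel_measurable \<nu> \<Longrightarrow> (\<And>z. s z \<ge> 0) \<Longrightarrow> K \<ge> 0 \<Longrightarrow> carleson_bound T \<nu> s \<phi> K \<Longrightarrow>
      (\<integral>\<^sup>+z. ennreal (s z * cmod (f (\<phi> z)) powr p) \<partial>\<nu>) \<le> ennreal (c * K) * mass p f"
proof -
  obtain c where c: "c > 0"
    "\<And>p f \<nu> s \<phi> K. p > 0 \<Longrightarrow> f holomorphic_on unit_disc \<Longrightarrow> borel_measure_on_disc \<nu> \<Longrightarrow> analytic_self_map \<phi> \<Longrightarrow>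
      s \<in> borel_measurable \<nu> \<Longrightarrow> K \<ge> 0 \<Longrightarrow> carleson_bound T \<nu> s \<phi> K \<Longrightarrow>
      (\<integral>\<^sup>+z. ennreal (s z) * whitney_mean p f (\<phi> z) \<partial>\<nu>) \<le> ennreal (c * K) * mass p f"
    by (rule carleson_composition) blast
  show ?thesis
  proof (rule that[of "16 / pi * c"])
    fix f :: "complex \<Rightarrow> complex" and \<nu> :: "complex measure" and s \<phi> K
    assume f: "f holomorphic_on unit_disc" and \<nu>: "borel_measure_on_disc \<nu>"
      and \<phi>: "analytic_self_map \<phi>" and s[measurable]: "s \<in> borel_measurable \<nu>" and s0: "\<And>z. s z \<ge> 0"
      and K: "K \<ge> 0" and carl: "carleson_bound T \<nu> s \<phi> K"
    have [measurable]: "\<phi> \<in> borel_measurable \<nu>"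
      by (intro borel_measure_on_disc_measurable[OF \<nu>] analytic_self_mapD[OF \<phi>])
    note [measurable] = whitney_mean_measurable[OF f]
    have "(\<integral>\<^sup>+z. ennreal (s z * cmod (f (\<phi> z)) powr p) \<partial>\<nu>) \<le>
        (\<integral>\<^sup>+z. ennreal (16 / pi) * (ennreal (s z) * whitney_mean p f (\<phi> z)) \<partial>\<nu>)"
    proof (rule nn_integral_mono)
      fix z assume "z \<in> space \<nu>"
      then have z: "cmod (\<phi> z) < 1"
        using analytic_self_mapD(2)[OF \<phi>, of z] borel_measure_on_disc_measurable(1)[OF \<nu>] by simp
      have "ennreal (s z * cmod (f (\<phi> z)) powr p) = ennreal (s z) * ennreal (cmod (f (\<phi> z)) powr p)"
        using s0 by (simp add: ennreal_mult)
      also have "\<dots> \<le> ennreal (s z) * (ennreal (16 / pi) * whitney_mean p f (\<phi> z))"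
        using z by (intro mult_left_mono norm_powr_le_whitney_mean[OF f p z]) auto
      finally show "ennreal (s z * cmod (f (\<phi> z)) powr p) \<le> ennreal (16 / pi) * (ennreal (s z) * whitney_mean p f (\<phi> z))"
        by (simp only: mult.left_commute)
    qed
    also have "\<dots> = ennreal (16 / pi) * (\<integral>\<^sup>+z. ennreal (s z) * whitney_mean p f (\<phi> z) \<partial>\<nu>)"
      by (rule nn_integral_cmult) measurable
    also have "\<dots> \<le> ennreal (16 / pi) * (ennreal (c * K) * mass p f)"
      by (intro mult_left_mono c(2)[OF p f \<nu> \<phi> s K carl]) simp
    also have "\<dots> = ennreal (16 / pi * c * K) * mass p f"
    proof -
      have "ennreal (16 / pi * c * K) = ennreal (16 / pi) * ennreal (c * K)"
        using c(1) K by (simp add: mult.assoc flip: ennreal_mult')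
      then show ?thesis by (simp only: mult.assoc)
    qed
    finally show "(\<integral>\<^sup>+z. ennreal (s z * cmod (f (\<phi> z)) powr p) \<partial>\<nu>) \<le> ennreal (16 / pi * c * K) * mass p f" .
  qed (use c in simp)
qed

lemma pseudohyperbolic_dist_measurable:
  assumes "borel_measure_on_disc \<nu>" "analytic_self_map \<phi>" "analytic_self_map \<psi>"
  shows "(dist_powr p \<phi> \<psi>) \<in> borel_measurable \<nu>"
proof -
  have [measurable]: "\<phi> \<in> borel_measurable \<nu>" "\<psi> \<in> borel_measurable \<nu>"
    using assms by (auto intro!: borel_measure_on_disc_measurable analytic_self_mapD)
  have [measurable]: "cnj \<in> borel_measurable borel"
    by (intro borel_measurable_continuous_onI continuous_intros)
  show ?thesis
    unfolding pseudohyperbolic_dist_def by measurable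
qed

text \<open>The pointwise difference estimate reduces this to two Whitney means, one along each map.
  The constant is linear in \<open>K\<close> and \<open>c\<close> is chosen before the maps and the
  measure, as a comparison of norms demands.\<close>

lemma difference_le:
  assumes p: "p > 0"
  obtains c where "c > 0"
    "\<And>f \<nu> \<phi> \<psi> K. f holomorphic_on unit_disc \<Longrightarrow> borel_measure_on_disc \<nu> \<Longrightarrow> analytic_self_map \<phi> \<Longrightarrow>
      analytic_self_map \<psi> \<Longrightarrow> K \<ge> 0 \<Longrightarrow>
      carleson_bound T \<nu> (dist_powr p \<phi> \<psi>) \<phi> K \<Longrightarrow>
      carleson_bound T \<nu> (dist_powr p \<phi> \<psi>) \<psi> K \<Longrightarrow>
      (\<integral>\<^sup>+z. ennreal (cmod (f (\<phi> z) - f (\<psi> z)) powr p) \<partial>\<nu>) \<le> ennreal (c * K) * mass p f"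
proof -
  obtain c where c: "c > 0"
    "\<And>p f \<nu> s \<phi> K. p > 0 \<Longrightarrow> f holomorphic_on unit_disc \<Longrightarrow> borel_measure_on_disc \<nu> \<Longrightarrow> analytic_self_map \<phi> \<Longrightarrow>
      s \<in> borel_measurable \<nu> \<Longrightarrow> K \<ge> 0 \<Longrightarrow> carleson_bound T \<nu> s \<phi> K \<Longrightarrow>
      (\<integral>\<^sup>+z. ennreal (s z) * whitney_mean p f (\<phi> z) \<partial>\<nu>) \<le> ennreal (c * K) * mass p f"
    by (rule carleson_composition) blast
  define b where "b = 34 powr p * 16 / pi"
  have b: "b > 0" by (simp add: b_def)
  show ?thesis
  proof (rule that[of "2 * b * c"])
    fix f :: "complex \<Rightarrow> complex" and \<nu> :: "complex measure" and \<phi> \<psi> and K :: real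
    assume f: "f holomorphic_on unit_disc" and \<nu>: "borel_measure_on_disc \<nu>"
      and \<phi>: "analytic_self_map \<phi>" and \<psi>: "analytic_self_map \<psi>" and K: "K \<ge> 0"
    define s where "s = (dist_powr p \<phi> \<psi>)"
    assume "carleson_bound T \<nu> (dist_powr p \<phi> \<psi>) \<phi> K"
      "carleson_bound T \<nu> (dist_powr p \<phi> \<psi>) \<psi> K"
    then have carl: "carleson_bound T \<nu> s \<phi> K" "carleson_bound T \<nu> s \<psi> K"
      by (simp_all add: s_def)
    have s[measurable]: "s \<in> borel_measurable \<nu>"
      unfolding s_def by (rule pseudohyperbolic_dist_measurable[OF \<nu> \<phi> \<psi>])
    have [measurable]: "\<phi> \<in> borel_measurable \<nu>" "\<psi> \<in> borel_measurable \<nu>"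
      using \<nu> \<phi> \<psi> by (auto intro!: borel_measure_on_disc_measurable analytic_self_mapD)
    note [measurable] = whitney_mean_measurable[OF f]
    have "(\<integral>\<^sup>+z. ennreal (cmod (f (\<phi> z) - f (\<psi> z)) powr p) \<partial>\<nu>) \<le>
        (\<integral>\<^sup>+z. ennreal b * (ennreal (s z) * whitney_mean p f (\<phi> z) + ennreal (s z) * whitney_mean p f (\<psi> z)) \<partial>\<nu>)"
    proof (rule nn_integral_mono)
      fix z assume "z \<in> space \<nu>"
      then have z: "cmod (\<phi> z) < 1" "cmod (\<psi> z) < 1"
        using analytic_self_mapD(2)[OF \<phi>, of z] analytic_self_mapD(2)[OF \<psi>, of z]
          borel_measure_on_disc_measurable(1)[OF \<nu>] by simp_all
      show "ennreal (cmod (f (\<phi> z) - f (\<psi> z)) powr p) \<le>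
        ennreal b * (ennreal (s z) * whitney_mean p f (\<phi> z) + ennreal (s z) * whitney_mean p f (\<psi> z))"
        using powr_diff_le_whitney_mean[OF f p z] by (simp add: b_def s_def distrib_left)
    qed
    also have "\<dots> = ennreal b * ((\<integral>\<^sup>+z. ennreal (s z) * whitney_mean p f (\<phi> z) \<partial>\<nu>) +
        (\<integral>\<^sup>+z. ennreal (s z) * whitney_mean p f (\<psi> z) \<partial>\<nu>))"
      by (subst nn_integral_cmult, measurable, subst nn_integral_add) auto
    also have "\<dots> \<le> ennreal b * (ennreal (c * K) * mass p f + ennreal (c * K) * mass p f)"
      by (intro mult_left_mono add_mono c(2)[OF p f \<nu> \<phi> s K carl(1)] c(2)[OF p f \<nu> \<psi> s K carl(2)]) simp
    also have "\<dots> = (ennreal b * (ennreal (c * K) + ennreal (c * K))) * mass p f"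
      by (simp only: distrib_right distrib_left mult.assoc)
    also have "ennreal b * (ennreal (c * K) + ennreal (c * K)) = ennreal (2 * b * c * K)"
      using b c(1) K by (simp add: ac_simps flip: ennreal_plus ennreal_mult)
    finally show "(\<integral>\<^sup>+z. ennreal (cmod (f (\<phi> z) - f (\<psi> z)) powr p) \<partial>\<nu>) \<le> ennreal (2 * b * c * K) * mass p f" .
  qed (use b c in simp)
qed

section \<open>From norm estimates back to the Carleson condition\<close>

lemma mass_mono:
  assumes "\<And>z. z \<in> unit_disc \<Longrightarrow> cmod (f z) \<le> cmod (g z)" "p > 0"
  shows "mass p f \<le> mass p g"
proof -
  have "disc_powr p f z \<le> disc_powr p g z" for z
    using assms by (cases "z \<in> unit_disc") (auto simp: disc_powr_def intro!: ennreal_leI powr_mono2)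
  then show ?thesis
    unfolding mass_def by (intro nn_integral_mono mult_right_mono) auto
qed

lemma kernel_fun_mass:
  assumes "p > 0"
  shows "mass p (kernel_fun \<gamma> p a) =
    (\<integral>\<^sup>+z\<in>unit_disc. ennreal (cmod (1 - cnj a * z) powr - (\<gamma> + 1)) * G (cmod z) \<partial>lborel)"
  unfolding mass_def disc_powr_def kernel_fun_norm[OF assms] by (simp add: ac_simps)

lemma kernel_finite:
  assumes "a \<in> unit_disc" "m \<le> ennreal A * (T (cmod a) * ennreal x)"
  shows "m < \<infinity>"
proof -
  have "T (cmod a) < \<infinity>" using assms(1) by (intro T_less_top) auto
  then have "ennreal A * (T (cmod a) * ennreal x) < \<infinity>"
    by (simp add: ennreal_mult_less_top)
  with assms(2) show ?thesis by (rule le_less_trans)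
qed

text \<open>3 * d bounds |1 - cnj a * w| on the shadow of \<open>a\<close> when d = 1 - |a|.
  Multiplying the kernel bound by this power leaves one factor d, the one in the Carleson
  condition.\<close>

lemma kernel_powr_cancel:
  fixes d :: real
  assumes "d > 0"
  shows "(3 * d) powr (\<gamma> + 1) * d powr - \<gamma> = 3 powr (\<gamma> + 1) * d"
  using assms by (simp add: powr_mult mult.assoc flip: powr_add)

text \<open>Only \<open>\<phi> z\<close> is confined to the shadow of \<open>a\<close>;
  \<open>\<psi> z\<close> may be anywhere in the disc. In the constant, 2 counts the test functions,
  9 powr p is (9 / 2) powr p times the 2 powr p lost in splitting a sum, and 3 powr (\<gamma> + 1)
  is the size of the kernel on the shadow.\<close>

lemma carleson_bound_of_difference:
  assumes p: "p > 0" and \<gamma>: "\<gamma> \<ge> 0" and A: "A \<ge> 0"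
    and kern: "\<And>a. a \<in> unit_disc \<Longrightarrow> mass p (kernel_fun \<gamma> p a) \<le> ennreal A * kernel_bound \<gamma> a"
    and N: "N \<ge> 0"
    and diff: "\<And>h. h holomorphic_on unit_disc \<Longrightarrow> mass p h < \<infinity> \<Longrightarrow>
      (\<integral>\<^sup>+z. ennreal (cmod (h (\<phi> z) - h (\<psi> z)) powr p) \<partial>\<nu>) \<le> ennreal N * mass p h"
    and \<nu>: "borel_measure_on_disc \<nu>" and \<phi>: "analytic_self_map \<phi>" and \<psi>: "analytic_self_map \<psi>"
  shows "carleson_bound T \<nu> (dist_powr p \<phi> \<psi>) \<phi> (2 * 9 powr p * 3 powr (\<gamma> + 1) * A * N)"
  unfolding carleson_bound_def
proof
  fix a :: complex assume a: "a \<in> unit_disc"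
  define d where "d = 1 - cmod a"
  have d: "d > 0" using a by (simp add: d_def)
  define f where "f = kernel_fun \<gamma> p a"
  define m where "m = (\<lambda>w. (a - w) / (1 - cnj a * w))"
  define g where "g = (\<lambda>w. f w * m w)"
  let ?R = "T (cmod a) * ennreal (d powr - \<gamma>)"
  have f: "f holomorphic_on unit_disc"
    unfolding f_def using a by (intro kernel_fun_holomorphic) simp
  have "1 - cnj a * w \<noteq> 0" if "w \<in> unit_disc" for w
    using a that by (intro one_minus_cnj_mult_nonzero) auto
  then have g: "g holomorphic_on unit_disc"
    unfolding g_def m_def by (intro holomorphic_intros f)
  have massf: "mass p f \<le> ennreal A * ?R"
    using kern[OF a] by (simp add: f_def d_def)
  have "mass p g \<le> mass p f"
  proof (rule mass_mono[OF _ p])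
    fix z :: complex assume "z \<in> unit_disc"
    then have "cmod (m z) \<le> 1"
      unfolding m_def using a by (intro moebius_norm_le_one) auto
    then show "cmod (g z) \<le> cmod (f z)"
      by (simp add: g_def norm_mult mult_left_le)
  qed
  with massf have massg: "mass p g \<le> ennreal A * ?R" by (rule order_trans[rotated])
  let ?D = "\<lambda>h z. ennreal (cmod (h (\<phi> z) - h (\<psi> z)) powr p)"
  have D: "(\<integral>\<^sup>+z. ?D h z \<partial>\<nu>) \<le> ennreal N * (ennreal A * ?R)"
    if "h holomorphic_on unit_disc" "mass p h \<le> ennreal A * ?R" for h
  proof -
    have "(\<integral>\<^sup>+z. ?D h z \<partial>\<nu>) \<le> ennreal N * mass p h"
      using that kernel_finite[OF a] by (intro diff) auto
    also have "\<dots> \<le> ennreal N * (ennreal A * ?R)"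
      by (intro mult_left_mono that) simp
    finally show ?thesis .
  qed
  have meas: "(\<lambda>z. cmod (h (\<phi> z) - h (\<psi> z)) powr p) \<in> borel_measurable \<nu>" if "h holomorphic_on unit_disc" for h
  proof -
    have [measurable]: "(\<lambda>z. h (\<phi> z)) \<in> borel_measurable \<nu>" "(\<lambda>z. h (\<psi> z)) \<in> borel_measurable \<nu>"
      using borel_measure_on_disc_measurable(2)[OF \<nu> analytic_self_mapD(3)[OF \<phi> that]]
        borel_measure_on_disc_measurable(2)[OF \<nu> analytic_self_mapD(3)[OF \<psi> that]] by simp_all
    show ?thesis by measurable
  qed
  note [measurable] = meas[OF f] meas[OF g]
  let ?c = "(3 * d) powr (\<gamma> + 1) * 9 powr p"
  have "(\<integral>\<^sup>+z. ennreal (pseudohyperbolic_dist (\<phi> z) (\<psi> z) powr p) * indicator (whitney_shadow a) (\<phi> z) \<partial>\<nu>) \<le>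
      (\<integral>\<^sup>+z. ennreal ?c * (?D g z + ?D f z) \<partial>\<nu>)"
  proof (rule nn_integral_mono)
    fix z assume "z \<in> space \<nu>"
    then have z: "cmod (\<psi> z) < 1"
      using analytic_self_mapD(2)[OF \<psi>, of z] borel_measure_on_disc_measurable(1)[OF \<nu>] by simp
    show "ennreal (pseudohyperbolic_dist (\<phi> z) (\<psi> z) powr p) * indicator (whitney_shadow a) (\<phi> z) \<le>
        ennreal ?c * (?D g z + ?D f z)"
    proof (cases "\<phi> z \<in> whitney_shadow a")
      case True
      let ?s = "pseudohyperbolic_dist (\<phi> z) (\<psi> z)"
      let ?x = "cmod (g (\<phi> z) - g (\<psi> z))" and ?y = "cmod (f (\<phi> z) - f (\<psi> z))"
      note sh = whitney_shadowD[OF True]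
      have nz: "0 < cmod (1 - cnj a * \<phi> z)"
        using one_minus_cnj_mult_nonzero[of a "\<phi> z"] sh by simp
      \<comment> \<open>The test function is large on the shadow, which lets its modulus be removed
        from the left side of the pointwise test estimate.\<close>
      have "(3 * d) powr - (\<gamma> + 1) \<le> cmod (f (\<phi> z)) powr p"
        unfolding f_def kernel_fun_norm[OF p] using sh(6) \<gamma> nz by (intro powr_mono2') (auto simp: d_def)
      then have "(3 * d) powr (\<gamma> + 1) * (3 * d) powr - (\<gamma> + 1) \<le> (3 * d) powr (\<gamma> + 1) * cmod (f (\<phi> z)) powr p"
        by (rule mult_left_mono) simp
      also have "(3 * d) powr (\<gamma> + 1) * (3 * d) powr - (\<gamma> + 1) = 1"
        using d by (simp flip: powr_add)
      finally have "?s powr p * 1 \<le> ?s powr p * ((3 * d) powr (\<gamma> + 1) * cmod (f (\<phi> z)) powr p)"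
        by (rule mult_left_mono) simp
      also have "\<dots> = (3 * d) powr (\<gamma> + 1) * (?s * cmod (f (\<phi> z))) powr p"
        by (simp add: powr_mult)
      also have "\<dots> \<le> (3 * d) powr (\<gamma> + 1) * (9 / 2 * (?x + ?y)) powr p"
        using pseudohyperbolic_dist_test_le[OF True z, of f] p
        by (intro mult_left_mono powr_mono2) (auto simp: g_def m_def)
      also have "\<dots> \<le> (3 * d) powr (\<gamma> + 1) * ((9 / 2) powr p * (2 powr p * (?x powr p + ?y powr p)))"
        unfolding powr_mult[of "9 / 2"] using p by (intro mult_left_mono add_powr_le) auto
      also have "\<dots> = ?c * (?x powr p + ?y powr p)"
        by (simp add: powr_divide)
      finally have "ennreal (?s powr p) \<le> ennreal ?c * (?D g z + ?D f z)"
        by (simp add: ennreal_leI flip: ennreal_plus ennreal_mult)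
      then show ?thesis using True by simp
    qed simp
  qed
  also have "\<dots> = ennreal ?c * ((\<integral>\<^sup>+z. ?D g z \<partial>\<nu>) + (\<integral>\<^sup>+z. ?D f z \<partial>\<nu>))"
    by (subst nn_integral_cmult, measurable, subst nn_integral_add) auto
  also have "\<dots> \<le> ennreal ?c * (ennreal N * (ennreal A * ?R) + ennreal N * (ennreal A * ?R))"
    by (intro mult_left_mono add_mono D f g massf massg) simp
  also have "\<dots> = (ennreal ?c * (ennreal N * ennreal A + ennreal N * ennreal A) * ennreal (d powr - \<gamma>)) * T (cmod a)"
    by (simp only: distrib_left distrib_right ac_simps)
  also have "ennreal ?c * (ennreal N * ennreal A + ennreal N * ennreal A) * ennreal (d powr - \<gamma>) =
      ennreal (?c * (2 * N * A) * d powr - \<gamma>)"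
    using N A by (simp flip: ennreal_mult ennreal_plus)
  also have "?c * (2 * N * A) * d powr - \<gamma> = 2 * 9 powr p * A * N * ((3 * d) powr (\<gamma> + 1) * d powr - \<gamma>)"
    by simp
  also have "\<dots> = 2 * 9 powr p * 3 powr (\<gamma> + 1) * A * N * d"
    unfolding kernel_powr_cancel[OF d] by simp
  also have "ennreal \<dots> * T (cmod a) = ennreal (2 * 9 powr p * 3 powr (\<gamma> + 1) * A * N) * (T (cmod a) * ennreal d)"
    using A N d by (subst ennreal_mult) (auto simp: ac_simps)
  finally show "(\<integral>\<^sup>+z. ennreal (pseudohyperbolic_dist (\<phi> z) (\<psi> z) powr p) * indicator (whitney_shadow a) (\<phi> z) \<partial>\<nu>) \<le>
      ennreal (2 * 9 powr p * 3 powr (\<gamma> + 1) * A * N) * (T (cmod a) * ennreal (1 - cmod a))"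
    by (simp only: d_def)
qed

text \<open>On the shadow of \<open>a\<close> the kernel is at least (3 * (1 - |a|)) powr -(\<gamma>
  + 1), so Chebyshev's argument gives the bound.\<close>

lemma carleson_bound_of_kernel:
  assumes \<gamma>: "\<gamma> \<ge> 0" and K: "K \<ge> 0" and s: "s \<in> borel_measurable \<nu>" "\<And>z. s z \<ge> 0"
    and kern: "\<And>a. a \<in> unit_disc \<Longrightarrow> (\<integral>\<^sup>+z. ennreal (s z / cmod (1 - cnj a * \<phi> z) powr (\<gamma> + 1)) \<partial>\<nu>)
      \<le> ennreal K * kernel_bound \<gamma> a"
    and \<nu>: "borel_measure_on_disc \<nu>" and \<phi>: "analytic_self_map \<phi>"
  shows "carleson_bound T \<nu> s \<phi> (3 powr (\<gamma> + 1) * K)"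
  unfolding carleson_bound_def
proof
  fix a :: complex assume a: "a \<in> unit_disc"
  define d where "d = 1 - cmod a"
  have d: "d > 0" using a by (simp add: d_def)
  have [measurable]: "\<phi> \<in> borel_measurable \<nu>"
    by (intro borel_measure_on_disc_measurable[OF \<nu>] analytic_self_mapD[OF \<phi>])
  note [measurable] = s(1)
  have "(\<integral>\<^sup>+z. ennreal (s z) * indicator (whitney_shadow a) (\<phi> z) \<partial>\<nu>) \<le>
      (\<integral>\<^sup>+z. ennreal ((3 * d) powr (\<gamma> + 1)) * ennreal (s z / cmod (1 - cnj a * \<phi> z) powr (\<gamma> + 1)) \<partial>\<nu>)"
  proof (rule nn_integral_mono)
    fix z
    show "ennreal (s z) * indicator (whitney_shadow a) (\<phi> z) \<le>
      ennreal ((3 * d) powr (\<gamma> + 1)) * ennreal (s z / cmod (1 - cnj a * \<phi> z) powr (\<gamma> + 1))"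
    proof (cases "\<phi> z \<in> whitney_shadow a")
      case True
      note sh = whitney_shadowD[OF True]
      have nz: "0 < cmod (1 - cnj a * \<phi> z)"
        using one_minus_cnj_mult_nonzero[of a "\<phi> z"] sh by simp
      have "cmod (1 - cnj a * \<phi> z) powr (\<gamma> + 1) \<le> (3 * d) powr (\<gamma> + 1)"
        using sh(6) \<gamma> by (intro powr_mono2) (auto simp: d_def)
      then have "s z * cmod (1 - cnj a * \<phi> z) powr (\<gamma> + 1) \<le> s z * (3 * d) powr (\<gamma> + 1)"
        using s(2) by (intro mult_left_mono)
      then have "s z \<le> (3 * d) powr (\<gamma> + 1) * (s z / cmod (1 - cnj a * \<phi> z) powr (\<gamma> + 1))"
        using nz by (simp add: field_simps)
      then show ?thesis
        using True by (simp add: ennreal_leI flip: ennreal_mult')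
    qed simp
  qed
  also have "\<dots> = ennreal ((3 * d) powr (\<gamma> + 1)) * (\<integral>\<^sup>+z. ennreal (s z / cmod (1 - cnj a * \<phi> z) powr (\<gamma> + 1)) \<partial>\<nu>)"
    by (rule nn_integral_cmult) measurable
  also have "\<dots> \<le> ennreal ((3 * d) powr (\<gamma> + 1)) * (ennreal K * (T (cmod a) * ennreal (d powr - \<gamma>)))"
    unfolding d_def by (intro mult_left_mono kern a) simp
  also have "\<dots> = (ennreal ((3 * d) powr (\<gamma> + 1)) * ennreal (d powr - \<gamma>)) * (ennreal K * T (cmod a))"
    by (simp only: ac_simps)
  also have "ennreal ((3 * d) powr (\<gamma> + 1)) * ennreal (d powr - \<gamma>) = ennreal (3 powr (\<gamma> + 1)) * ennreal d"
    using d by (simp add: kernel_powr_cancel[OF d] flip: ennreal_mult')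
  also have "ennreal (3 powr (\<gamma> + 1)) * ennreal d * (ennreal K * T (cmod a)) =
      ennreal (3 powr (\<gamma> + 1) * K) * (T (cmod a) * ennreal d)"
    using K by (simp add: ennreal_mult ac_simps)
  finally show "(\<integral>\<^sup>+z. ennreal (s z) * indicator (whitney_shadow a) (\<phi> z) \<partial>\<nu>) \<le>
      ennreal (3 powr (\<gamma> + 1) * K) * (T (cmod a) * ennreal (1 - cmod a))"
    by (simp only: d_def)
qed

end

section \<open>Boundedness and operator norms\<close>

lemma epowr_ennreal: "x \<ge> 0 \<Longrightarrow> epowr (ennreal x) a = ennreal (x powr a)"
  by (simp add: epowr_def)

lemma epowr_less_top_iff: "epowr x a < \<infinity> \<longleftrightarrow> x < \<infinity>"
  by (cases x) (auto simp: epowr_ennreal epowr_def)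

lemma epowr_mono:
  assumes "x \<le> y" "a > 0"
  shows "epowr x a \<le> epowr y a"
proof (cases y)
  case (real s)
  then obtain r where "x = ennreal r" "0 \<le> r" "r \<le> s"
    using assms by (cases x) (auto simp: top_unique)
  then show ?thesis
    using real assms(2) by (auto simp: epowr_ennreal intro!: ennreal_leI powr_mono2)
qed (simp add: epowr_def)

lemma epowr_cmult:
  assumes "c \<ge> 0" "a > 0" "x < \<infinity>"
  shows "epowr (ennreal c * x) a = ennreal (c powr a) * epowr x a"
  using assms by (cases x) (auto simp: epowr_ennreal powr_mult simp flip: ennreal_mult)

lemma epowr_epowr_inverse:
  assumes "p > 0"
  shows "epowr (epowr x (1 / p)) p = x" "epowr (epowr x p) (1 / p) = x"
  using assms by (cases x; simp add: epowr_ennreal powr_powr epowr_def)+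

lemma epowr_le_one:
  assumes "a > 0"
  shows "epowr x a \<le> 1 \<longleftrightarrow> x \<le> 1"
proof (cases x)
  case (real r)
  have "r powr a \<le> 1 \<longleftrightarrow> r \<le> 1"
  proof (cases "r \<le> 1")
    case True
    then show ?thesis using real assms powr_mono2[of a r 1] by simp
  next
    case False
    then have "1 powr a < r powr a" using assms by (intro powr_less_mono2) auto
    then show ?thesis using False by simp
  qed
  then show ?thesis using real by (simp add: epowr_ennreal)
qed (simp add: epowr_def)

text \<open>Links the profile to the weight itself. The integral identity is restricted to Borel
  functions on the plane; the functions in question are brought into this form by cutting them off
  at the disc.\<close>

locale doubling_disc_weight = doubling_weight G T for G T +
  fixes \<omega> :: "complex \<Rightarrow> real"
  assumes \<omega>_nonneg: "\<And>z. z \<in> unit_disc \<Longrightarrow> 0 \<le> \<omega> z"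
    and \<omega>_integral: "\<And>h. h \<in> borel_measurable borel \<Longrightarrow>
      (\<integral>\<^sup>+z. h z * ennreal (\<omega> z) \<partial>area_measure) = ennreal (1 / pi) * (\<integral>\<^sup>+z\<in>unit_disc. h z * G (cmod z) \<partial>lborel)"
    and tail_eq: "\<And>z. z \<in> unit_disc \<Longrightarrow> tail_integral \<omega> z = T (cmod z)"
    and T_pos: "\<And>r. r \<in> {0..<1} \<Longrightarrow> 0 < T r"
begin

lemma bergman_norm_eq:
  assumes f: "f holomorphic_on unit_disc"
  shows "bergman_norm p \<omega> f = epowr (ennreal (1 / pi) * mass p f) (1 / p)"
proof -
  have "(\<integral>\<^sup>+z. ennreal (cmod (f z) powr p * \<omega> z) \<partial>area_measure) =
      (\<integral>\<^sup>+z. disc_powr p f z * ennreal (\<omega> z) \<partial>area_measure)"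
  proof (rule nn_integral_cong)
    fix z assume "z \<in> space area_measure"
    then have "z \<in> unit_disc"
      by (simp add: area_measure_def space_scale_measure space_restrict_space)
    then show "ennreal (cmod (f z) powr p * \<omega> z) = disc_powr p f z * ennreal (\<omega> z)"
      by (simp add: disc_powr_def ennreal_mult \<omega>_nonneg)
  qed
  also have "\<dots> = ennreal (1 / pi) * (\<integral>\<^sup>+z\<in>unit_disc. disc_powr p f z * G (cmod z) \<partial>lborel)"
    by (rule \<omega>_integral) (rule disc_powr_measurable[OF f])
  also have "(\<integral>\<^sup>+z\<in>unit_disc. disc_powr p f z * G (cmod z) \<partial>lborel) = mass p f"
    unfolding mass_def by (intro nn_integral_cong) (auto simp: disc_powr_def indicator_def)
  finally show ?thesis by (simp add: bergman_norm_def)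
qed

lemma scaled_less_top_iff: "ennreal (1 / pi) * x < \<infinity> \<longleftrightarrow> x < \<infinity>"
  by (cases x) (auto simp: ennreal_mult_top ennreal_mult_less_top)

lemma bergman_space_iff:
  "f \<in> bergman_space p \<omega> \<longleftrightarrow> f holomorphic_on unit_disc \<and> mass p f < \<infinity>"
  unfolding bergman_space_def mem_Collect_eq
  using bergman_norm_eq epowr_less_top_iff scaled_less_top_iff by auto

text \<open>Boundedness raised to the power p, with \<open>mass\<close> for the norm: roots
  disappear and the constant scales like the Carleson constant.\<close>

definition power_bound :: "real \<Rightarrow> complex measure \<Rightarrow> fun_operator \<Rightarrow> real \<Rightarrow> bool" where
  "power_bound p \<nu> Op N \<longleftrightarrow> (\<forall>f. f holomorphic_on unit_disc \<longrightarrow> mass p f < \<infinity> \<longrightarrow>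
     (\<integral>\<^sup>+z. ennreal (cmod (Op f z) powr p) \<partial>\<nu>) \<le> ennreal N * mass p f)"

text \<open>The constants correspond by N = C powr p / pi. Measurability of the image is a separate
  hypothesis because membership in the Lebesgue space includes it.\<close>

lemma bounded_op_iff:
  assumes p: "p > 0" and meas: "\<And>f. f holomorphic_on unit_disc \<Longrightarrow> Op f \<in> borel_measurable \<nu>"
  shows "bounded_op p \<omega> \<nu> Op \<longleftrightarrow> (\<exists>N\<ge>0. power_bound p \<nu> Op N)"
proof
  assume "bounded_op p \<omega> \<nu> Op"
  then obtain C where C: "C \<ge> 0" "\<And>f. f \<in> bergman_space p \<omega> \<Longrightarrow> Lp_norm p \<nu> (Op f) \<le> ennreal C * bergman_norm p \<omega> f"
    by (auto simp: bounded_op_def)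
  have "power_bound p \<nu> Op (C powr p * (1 / pi))"
    unfolding power_bound_def
  proof (intro allI impI)
    fix f assume f: "f holomorphic_on unit_disc" "mass p f < \<infinity>"
    let ?I = "\<integral>\<^sup>+z. ennreal (cmod (Op f z) powr p) \<partial>\<nu>"
    have fin: "ennreal (1 / pi) * mass p f < \<infinity>"
      using f(2) scaled_less_top_iff by blast
    have "epowr ?I (1 / p) \<le> ennreal C * epowr (ennreal (1 / pi) * mass p f) (1 / p)"
      using C(2)[of f] f by (simp add: bergman_space_iff Lp_norm_def bergman_norm_eq)
    then have "epowr (epowr ?I (1 / p)) p \<le> epowr (ennreal C * epowr (ennreal (1 / pi) * mass p f) (1 / p)) p"
      using p by (rule epowr_mono)
    also have "\<dots> = ennreal (C powr p) * epowr (epowr (ennreal (1 / pi) * mass p f) (1 / p)) p"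
      using C(1) p fin by (intro epowr_cmult) (simp_all only: epowr_less_top_iff)
    finally have "?I \<le> ennreal (C powr p) * (ennreal (1 / pi) * mass p f)"
      using p by (simp only: epowr_epowr_inverse)
    also have "\<dots> = ennreal (C powr p * (1 / pi)) * mass p f"
      by (subst ennreal_mult) (auto simp: mult.assoc)
    finally show "?I \<le> ennreal (C powr p * (1 / pi)) * mass p f" .
  qed
  then show "\<exists>N\<ge>0. power_bound p \<nu> Op N"
    by (intro exI[of _ "C powr p * (1 / pi)"]) simp
next
  assume "\<exists>N\<ge>0. power_bound p \<nu> Op N"
  then obtain N where N: "N \<ge> 0" "power_bound p \<nu> Op N" by blast
  show "bounded_op p \<omega> \<nu> Op"
    unfolding bounded_op_def
  proof (intro exI[of _ "(N * pi) powr (1 / p)"] conjI ballI)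
    fix f assume "f \<in> bergman_space p \<omega>"
    then have f: "f holomorphic_on unit_disc" "mass p f < \<infinity>"
      by (simp_all add: bergman_space_iff)
    have fin: "ennreal (1 / pi) * mass p f < \<infinity>"
      using f(2) scaled_less_top_iff by blast
    let ?I = "\<integral>\<^sup>+z. ennreal (cmod (Op f z) powr p) \<partial>\<nu>"
    have "?I \<le> ennreal N * mass p f"
      using N(2) f by (simp add: power_bound_def)
    also have "ennreal N = ennreal (N * pi) * ennreal (1 / pi)"
      using N(1) by (simp flip: ennreal_mult')
    finally have "?I \<le> ennreal (N * pi) * (ennreal (1 / pi) * mass p f)"
      by (simp only: mult.assoc)
    then have "epowr ?I (1 / p) \<le> epowr (ennreal (N * pi) * (ennreal (1 / pi) * mass p f)) (1 / p)"
      using p by (intro epowr_mono) auto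
    also have "\<dots> = ennreal ((N * pi) powr (1 / p)) * bergman_norm p \<omega> f"
      unfolding bergman_norm_eq[OF f(1)] using N(1) p fin by (intro epowr_cmult) auto
    finally show le: "Lp_norm p \<nu> (Op f) \<le> ennreal ((N * pi) powr (1 / p)) * bergman_norm p \<omega> f"
      by (simp add: Lp_norm_def)
    have "bergman_norm p \<omega> f < \<infinity>"
      unfolding bergman_norm_eq[OF f(1)] epowr_less_top_iff by (rule fin)
    then have "ennreal ((N * pi) powr (1 / p)) * bergman_norm p \<omega> f < \<infinity>"
      by (simp add: ennreal_mult_less_top)
    with le have "Lp_norm p \<nu> (Op f) < \<infinity>" by (rule le_less_trans)
    then show "Op f \<in> Lp_space p \<nu>"
      using meas[OF f(1)] by (simp add: Lp_space_def)
  qed simp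
qed

lemma op_norm_le_of_power_bound:
  assumes p: "p > 0" and N: "N \<ge> 0" "power_bound p \<nu> Op N"
  shows "epowr (op_norm p \<omega> \<nu> Op) p \<le> ennreal (N * pi)"
proof -
  have "op_norm p \<omega> \<nu> Op \<le> epowr (ennreal (N * pi)) (1 / p)"
    unfolding op_norm_def
  proof (rule SUP_least)
    fix f assume "f \<in> {f \<in> bergman_space p \<omega>. bergman_norm p \<omega> f \<le> 1}"
    then have f: "f holomorphic_on unit_disc" "mass p f < \<infinity>" and "bergman_norm p \<omega> f \<le> 1"
      by (simp_all add: bergman_space_iff)
    then have one: "ennreal (1 / pi) * mass p f \<le> 1"
      using p by (simp add: bergman_norm_eq epowr_le_one)
    have "(\<integral>\<^sup>+z. ennreal (cmod (Op f z) powr p) \<partial>\<nu>) \<le> ennreal N * mass p f"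
      using N(2) f by (simp add: power_bound_def)
    also have "ennreal N = ennreal (N * pi) * ennreal (1 / pi)"
      using N(1) by (simp flip: ennreal_mult')
    also have "ennreal (N * pi) * ennreal (1 / pi) * mass p f \<le> ennreal (N * pi) * 1"
      unfolding mult.assoc by (intro mult_left_mono one) simp
    finally have "epowr (\<integral>\<^sup>+z. ennreal (cmod (Op f z) powr p) \<partial>\<nu>) (1 / p) \<le> epowr (ennreal (N * pi)) (1 / p)"
      using p by (intro epowr_mono) auto
    then show "Lp_norm p \<nu> (Op f) \<le> epowr (ennreal (N * pi)) (1 / p)"
      by (simp add: Lp_norm_def)
  qed
  then have "epowr (op_norm p \<omega> \<nu> Op) p \<le> epowr (epowr (ennreal (N * pi)) (1 / p)) p"
    using p by (rule epowr_mono)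
  then show ?thesis using p by (simp only: epowr_epowr_inverse)
qed

text \<open>Functions of norm \<open>0\<close> are handled by letting the scaling factor grow without bound.\<close>

lemma power_bound_of_op_norm:
  assumes p: "p > 0" and N: "N \<ge> 0" "epowr (op_norm p \<omega> \<nu> Op) p \<le> ennreal N"
    and hom: "\<And>f c z. Op (\<lambda>w. of_real c * f w) z = of_real c * Op f z"
    and meas: "\<And>f. f holomorphic_on unit_disc \<Longrightarrow> Op f \<in> borel_measurable \<nu>"
  shows "power_bound p \<nu> Op N"
  unfolding power_bound_def
proof (intro allI impI)
  fix f assume f: "f holomorphic_on unit_disc" and fin: "mass p f < \<infinity>"
  note [measurable] = disc_powr_measurable[OF f] meas[OF f]
  let ?I = "\<lambda>f. \<integral>\<^sup>+z. ennreal (cmod (Op f z) powr p) \<partial>\<nu>"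
  obtain x where x: "x \<ge> 0" "mass p f = ennreal x"
    using fin by (cases "mass p f") auto
  \<comment> \<open>The multiple of \<open>f\<close> by r powr (1 / p) has mass r * x, so r * x
    \<le> pi says exactly that it lies in the unit ball.\<close>
  have scale: "ennreal r * ?I f \<le> ennreal N" if r: "r > 0" "r * x \<le> pi" for r
  proof -
    define c where "c = r powr (1 / p)"
    have c: "c > 0" "c powr p = r" using r p by (auto simp: c_def powr_powr)
    let ?g = "\<lambda>w. of_real c * f w"
    have g: "?g holomorphic_on unit_disc" by (intro holomorphic_intros f)
    have "disc_powr p ?g z = ennreal r * disc_powr p f z" for z
      using c by (auto simp: disc_powr_def norm_mult powr_mult indicator_def simp flip: ennreal_mult')
    then have "mass p ?g = (\<integral>\<^sup>+z. ennreal r * (disc_powr p f z * G (cmod z)) \<partial>lborel)"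
      unfolding mass_def by (simp add: mult.assoc)
    also have "\<dots> = ennreal r * mass p f"
      unfolding mass_def by (rule nn_integral_cmult) measurable
    finally have mg: "mass p ?g = ennreal (r * x)"
      using x r by (simp flip: ennreal_mult)
    have "ennreal (1 / pi) * mass p ?g \<le> 1"
    proof -
      have "1 / pi * (r * x) \<le> 1" using r(2) by (simp add: field_simps)
      then show ?thesis
        unfolding mg by (simp add: ennreal_le_1 flip: ennreal_mult' del: times_divide_eq_left)
    qed
    then have "bergman_norm p \<omega> ?g \<le> 1"
      unfolding bergman_norm_eq[OF g] using p by (simp add: epowr_le_one)
    moreover have "?g \<in> bergman_space p \<omega>"
      using g by (simp add: bergman_space_iff mg)
    ultimately have "Lp_norm p \<nu> (Op ?g) \<le> op_norm p \<omega> \<nu> Op"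
      unfolding op_norm_def by (intro SUP_upper) auto
    then have "epowr (Lp_norm p \<nu> (Op ?g)) p \<le> epowr (op_norm p \<omega> \<nu> Op) p"
      using p by (rule epowr_mono)
    then have "?I ?g \<le> ennreal N"
      using N(2) unfolding Lp_norm_def epowr_epowr_inverse(1)[OF p] by (rule order_trans)
    also have "?I ?g = (\<integral>\<^sup>+z. ennreal r * ennreal (cmod (Op f z) powr p) \<partial>\<nu>)"
      using c r(1) by (intro nn_integral_cong) (simp add: hom norm_mult powr_mult ennreal_mult')
    also have "\<dots> = ennreal r * ?I f"
      by (rule nn_integral_cmult) measurable
    finally show ?thesis .
  qed
  show "?I f \<le> ennreal N * mass p f"
  proof (cases "x = 0")
    case True
    have "?I f = 0"
    proof (rule ccontr)
      assume nz: "?I f \<noteq> 0"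
      have "?I f \<noteq> \<infinity>" using scale[of 1] True by (auto simp: top_unique)
      then obtain i where i: "?I f = ennreal i" "i > 0"
        using nz by (cases "?I f") (auto simp: ennreal_eq_0_iff)
      \<comment> \<open>For x = 0 every r > 0 is admissible; this one would make the scaled integral
        equal to N + 1.\<close>
      have "ennreal ((N + 1) / i) * ?I f \<le> ennreal N"
        using True i N(1) by (intro scale) auto
      then have "N + 1 \<le> N"
        using i N(1) by (simp flip: ennreal_mult')
      then show False by simp
    qed
    then show ?thesis by simp
  next
    case False
    then have xp: "x > 0" using x by simp
    have "?I f = ennreal x * (ennreal (1 / x) * ?I f)"
      using xp by (simp flip: mult.assoc ennreal_mult')
    also have "\<dots> \<le> ennreal x * ennreal N"
      using xp pi_ge_two by (intro mult_left_mono scale) auto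
    finally show ?thesis using x by (simp add: mult.commute)
  qed
qed

end

section \<open>The kernel functions as test functions\<close>

context doubling_weight
begin

text \<open>The threshold and \<open>A\<close> come before \<open>p\<close>, since the mass of the
  kernel function is an integral without \<open>p\<close>. This is what makes the threshold a
  function of the weight only.\<close>

lemma kernel_fun_mass_le:
  obtains \<gamma>\<^sub>0 where "\<gamma>\<^sub>0 \<ge> 0" "\<And>\<gamma>. \<gamma> > \<gamma>\<^sub>0 \<Longrightarrow> \<exists>A>0. \<forall>p>0. \<forall>a\<in>unit_disc.
    mass p (kernel_fun \<gamma> p a) \<le> ennreal A * kernel_bound \<gamma> a"
proof -
  obtain \<gamma>\<^sub>0 where g: "\<gamma>\<^sub>0 \<ge> 0" "\<And>\<gamma>. \<gamma> > \<gamma>\<^sub>0 \<Longrightarrow> \<exists>A>0. \<forall>a\<in>unit_disc.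
    (\<integral>\<^sup>+z\<in>unit_disc. ennreal (cmod (1 - cnj a * z) powr - (\<gamma> + 1)) * G (cmod z) \<partial>lborel)
      \<le> ennreal A * kernel_bound \<gamma> a"
    by (rule kernel_integral_le) blast
  show ?thesis
  proof (rule that[OF g(1)])
    fix \<gamma> assume "\<gamma> > \<gamma>\<^sub>0"
    then obtain A where "A > 0" "\<And>a. a \<in> unit_disc \<Longrightarrow>
      (\<integral>\<^sup>+z\<in>unit_disc. ennreal (cmod (1 - cnj a * z) powr - (\<gamma> + 1)) * G (cmod z) \<partial>lborel)
        \<le> ennreal A * kernel_bound \<gamma> a"
      using g(2) by blast
    then show "\<exists>A>0. \<forall>p>0. \<forall>a\<in>unit_disc.
        mass p (kernel_fun \<gamma> p a) \<le> ennreal A * kernel_bound \<gamma> a"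
      by (intro exI[of _ A] conjI allI impI ballI) (simp_all only: kernel_fun_mass)
  qed
qed

text \<open>The kernel function is inserted into the weighted composition estimate; \<open>c\<close>
  is independent of \<gamma>, \<open>A\<close> and \<open>a\<close>.\<close>

lemma kernel_bound_of_carleson:
  assumes p: "p > 0"
  obtains c where "c > 0"
    "\<And>\<gamma> A \<nu> s \<phi> K a. A \<ge> 0 \<Longrightarrow> a \<in> unit_disc \<Longrightarrow>
      mass p (kernel_fun \<gamma> p a) \<le> ennreal A * kernel_bound \<gamma> a \<Longrightarrow>
      borel_measure_on_disc \<nu> \<Longrightarrow> analytic_self_map \<phi> \<Longrightarrow>
      s \<in> borel_measurable \<nu> \<Longrightarrow> (\<And>z. s z \<ge> 0) \<Longrightarrow> K \<ge> 0 \<Longrightarrow> carleson_bound T \<nu> s \<phi> K \<Longrightarrow>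
      (\<integral>\<^sup>+z. ennreal (s z / cmod (1 - cnj a * \<phi> z) powr (\<gamma> + 1)) \<partial>\<nu>)
        \<le> ennreal (c * K * A) * kernel_bound \<gamma> a"
proof -
  obtain c where c: "c > 0"
    "\<And>f \<nu> s \<phi> K. f holomorphic_on unit_disc \<Longrightarrow> borel_measure_on_disc \<nu> \<Longrightarrow> analytic_self_map \<phi> \<Longrightarrow>
      s \<in> borel_measurable \<nu> \<Longrightarrow> (\<And>z. s z \<ge> 0) \<Longrightarrow> K \<ge> 0 \<Longrightarrow> carleson_bound T \<nu> s \<phi> K \<Longrightarrow>
      (\<integral>\<^sup>+z. ennreal (s z * cmod (f (\<phi> z)) powr p) \<partial>\<nu>) \<le> ennreal (c * K) * mass p f"
    by (rule weighted_composition_le[OF p]) blast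
  show ?thesis
  proof (rule that[OF c(1)])
    fix \<gamma> A :: real and \<nu> :: "complex measure" and s \<phi> and K :: real and a :: complex
    assume A: "A \<ge> 0" and a: "a \<in> unit_disc"
      and mass: "mass p (kernel_fun \<gamma> p a) \<le> ennreal A * kernel_bound \<gamma> a"
      and *: "borel_measure_on_disc \<nu>" "analytic_self_map \<phi>" "s \<in> borel_measurable \<nu>" "\<And>z. s z \<ge> 0"
        "K \<ge> 0" "carleson_bound T \<nu> s \<phi> K"
    have "(\<integral>\<^sup>+z. ennreal (s z / cmod (1 - cnj a * \<phi> z) powr (\<gamma> + 1)) \<partial>\<nu>) =
        (\<integral>\<^sup>+z. ennreal (s z * cmod (kernel_fun \<gamma> p a (\<phi> z)) powr p) \<partial>\<nu>)"
      unfolding kernel_fun_norm[OF p] powr_minus_divide by simp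
    also have "\<dots> \<le> ennreal (c * K) * mass p (kernel_fun \<gamma> p a)"
      using a by (intro c(2) * kernel_fun_holomorphic) simp
    also have "\<dots> \<le> ennreal (c * K) * (ennreal A * kernel_bound \<gamma> a)"
      by (intro mult_left_mono mass) simp
    also have "\<dots> = ennreal (c * K * A) * kernel_bound \<gamma> a"
      using A c(1) *(5) by (simp add: ennreal_mult mult.assoc)
    finally show "(\<integral>\<^sup>+z. ennreal (s z / cmod (1 - cnj a * \<phi> z) powr (\<gamma> + 1)) \<partial>\<nu>)
        \<le> ennreal (c * K * A) * kernel_bound \<gamma> a" .
  qed
qed

end

section \<open>Equivalence of boundedness and comparison of norms\<close>

lemma difference_op_eq: "difference_op \<phi> \<psi> f z = f (\<phi> z) - f (\<psi> z)"
  by (simp add: difference_op_def composition_op_def)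

lemma difference_op_measurable:
  assumes "borel_measure_on_disc \<nu>" "analytic_self_map \<phi>" "analytic_self_map \<psi>" "f holomorphic_on unit_disc"
  shows "difference_op \<phi> \<psi> f \<in> borel_measurable \<nu>"
  unfolding difference_op_eq[abs_def]
  by (rule borel_measure_on_disc_measurable(2)[OF assms(1)])
    (intro holomorphic_intros analytic_self_mapD(3)[OF assms(2,4)] analytic_self_mapD(3)[OF assms(3,4)])

lemma weighted_composition_op_measurable:
  assumes "borel_measure_on_disc \<nu>" "analytic_self_map \<phi>" "f holomorphic_on unit_disc" "s \<in> borel_measurable \<nu>"
  shows "weighted_composition_op s \<phi> f \<in> borel_measurable \<nu>"
proof -
  have [measurable]: "(\<lambda>z. f (\<phi> z)) \<in> borel_measurable \<nu>"
    by (rule borel_measure_on_disc_measurable(2)[OF assms(1) analytic_self_mapD(3)[OF assms(2,3)]])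
  note [measurable] = assms(4)
  show ?thesis unfolding weighted_composition_op_def o_def by measurable
qed

context doubling_disc_weight
begin

lemma weighted_power_bound_iff:
  assumes "\<And>z. \<sigma> z \<ge> 0"
  shows "power_bound p \<nu> (weighted_composition_op \<sigma> \<phi>) N \<longleftrightarrow> (\<forall>f. f holomorphic_on unit_disc \<longrightarrow> mass p f < \<infinity> \<longrightarrow>
    (\<integral>\<^sup>+z. ennreal (\<sigma> z powr p * cmod (f (\<phi> z)) powr p) \<partial>\<nu>) \<le> ennreal N * mass p f)"
  using assms by (simp add: power_bound_def weighted_composition_op_def norm_mult powr_mult)

text \<open>The testing lemma bounds its first map only. Exchanging the maps gives the second bound,
  as |h(\<phi>) - h(\<psi>)| and the pseudohyperbolic distance are symmetric.\<close>

lemma carleson_of_power_bound: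
  assumes p: "p > 0" and \<gamma>: "\<gamma> \<ge> 0" and A: "A \<ge> 0"
    and kern: "\<And>a. a \<in> unit_disc \<Longrightarrow> mass p (kernel_fun \<gamma> p a) \<le> ennreal A * kernel_bound \<gamma> a"
    and N: "N \<ge> 0" and bound: "power_bound p \<nu> (difference_op \<phi> \<psi>) N"
    and \<nu>: "borel_measure_on_disc \<nu>" and \<phi>: "analytic_self_map \<phi>" and \<psi>: "analytic_self_map \<psi>"
  shows "carleson_bound T \<nu> (dist_powr p \<phi> \<psi>) \<phi> (2 * 9 powr p * 3 powr (\<gamma> + 1) * A * N)"
    and "carleson_bound T \<nu> (dist_powr p \<phi> \<psi>) \<psi> (2 * 9 powr p * 3 powr (\<gamma> + 1) * A * N)"
proof -
  have H: "(\<integral>\<^sup>+z. ennreal (cmod (h (\<phi> z) - h (\<psi> z)) powr p) \<partial>\<nu>) \<le> ennreal N * mass p h"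
    if "h holomorphic_on unit_disc" "mass p h < \<infinity>" for h
    using bound that by (simp add: power_bound_def difference_op_eq)
  show "carleson_bound T \<nu> (dist_powr p \<phi> \<psi>) \<phi> (2 * 9 powr p * 3 powr (\<gamma> + 1) * A * N)"
    by (rule carleson_bound_of_difference[OF p \<gamma> A kern N H \<nu> \<phi> \<psi>])
  have H': "(\<integral>\<^sup>+z. ennreal (cmod (h (\<psi> z) - h (\<phi> z)) powr p) \<partial>\<nu>) \<le> ennreal N * mass p h"
    if "h holomorphic_on unit_disc" "mass p h < \<infinity>" for h
    using H[OF that] by (simp add: norm_minus_commute)
  show "carleson_bound T \<nu> (dist_powr p \<phi> \<psi>) \<psi> (2 * 9 powr p * 3 powr (\<gamma> + 1) * A * N)"
    using carleson_bound_of_difference[OF p \<gamma> A kern N H' \<nu> \<psi> \<phi>]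
    by (simp only: pseudohyperbolic_dist_commute[of "\<psi> _"])
qed

text \<open>Each side is equivalent to Carleson bounds along both maps: the difference operator by
  the two test functions, each weighted operator by the kernel function alone.\<close>

lemma bounded_difference_iff:
  fixes \<phi> \<psi> :: "complex \<Rightarrow> complex"
  assumes p: "p > 0" and \<nu>: "borel_measure_on_disc \<nu>" and \<phi>: "analytic_self_map \<phi>" and \<psi>: "analytic_self_map \<psi>"
  defines "\<sigma> \<equiv> \<lambda>z. pseudohyperbolic_dist (\<phi> z) (\<psi> z)"
  shows "bounded_op p \<omega> \<nu> (difference_op \<phi> \<psi>) \<longleftrightarrow>
    bounded_op p \<omega> \<nu> (weighted_composition_op \<sigma> \<phi>) \<and> bounded_op p \<omega> \<nu> (weighted_composition_op \<sigma> \<psi>)"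
proof -
  obtain \<gamma>\<^sub>0 where \<gamma>0: "\<gamma>\<^sub>0 \<ge> 0" "\<And>\<gamma>. \<gamma> > \<gamma>\<^sub>0 \<Longrightarrow> \<exists>A>0. \<forall>p>0. \<forall>a\<in>unit_disc.
    mass p (kernel_fun \<gamma> p a) \<le> ennreal A * kernel_bound \<gamma> a"
    by (rule kernel_fun_mass_le) blast
  \<comment> \<open>The statement contains no exponent, so any admissible value will do.\<close>
  define \<gamma> where "\<gamma> = \<gamma>\<^sub>0 + 1"
  have \<gamma>: "\<gamma> \<ge> 0" "\<gamma> > \<gamma>\<^sub>0" using \<gamma>0(1) by (auto simp: \<gamma>_def)
  obtain A where A: "A > 0" and kern: "\<And>a. a \<in> unit_disc \<Longrightarrow>
      mass p (kernel_fun \<gamma> p a) \<le> ennreal A * kernel_bound \<gamma> a"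
    using \<gamma>0(2)[OF \<gamma>(2)] p by blast
  have \<sigma>0: "\<sigma> z \<ge> 0" for z by (simp add: \<sigma>_def)
  have s: "(\<lambda>z. \<sigma> z powr p) \<in> borel_measurable \<nu>" for p
    unfolding \<sigma>_def by (rule pseudohyperbolic_dist_measurable[OF \<nu> \<phi> \<psi>])
  have \<sigma>m: "\<sigma> \<in> borel_measurable \<nu>"
    using s[of 1] \<sigma>0 by simp
  have w_iff: "bounded_op p \<omega> \<nu> (weighted_composition_op \<sigma> \<eta>) \<longleftrightarrow> (\<exists>N\<ge>0. power_bound p \<nu> (weighted_composition_op \<sigma> \<eta>) N)"
    if "analytic_self_map \<eta>" for \<eta>
    by (intro bounded_op_iff p weighted_composition_op_measurable \<nu> that \<sigma>m)
  have d_iff: "bounded_op p \<omega> \<nu> (difference_op \<phi> \<psi>) \<longleftrightarrow> (\<exists>N\<ge>0. power_bound p \<nu> (difference_op \<phi> \<psi>) N)"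
    by (intro bounded_op_iff p difference_op_measurable \<nu> \<phi> \<psi>)
  have to_weighted: "\<exists>N\<ge>0. power_bound p \<nu> (weighted_composition_op \<sigma> \<eta>) N"
    if \<eta>: "analytic_self_map \<eta>" and K: "K \<ge> 0" "carleson_bound T \<nu> (\<lambda>z. \<sigma> z powr p) \<eta> K" for \<eta> K
  proof -
    obtain c where c: "c > 0"
      "\<And>f \<nu> s \<phi> K. f holomorphic_on unit_disc \<Longrightarrow> borel_measure_on_disc \<nu> \<Longrightarrow> analytic_self_map \<phi> \<Longrightarrow>
        s \<in> borel_measurable \<nu> \<Longrightarrow> (\<And>z. s z \<ge> 0) \<Longrightarrow> K \<ge> 0 \<Longrightarrow> carleson_bound T \<nu> s \<phi> K \<Longrightarrow>
        (\<integral>\<^sup>+z. ennreal (s z * cmod (f (\<phi> z)) powr p) \<partial>\<nu>) \<le> ennreal (c * K) * mass p f"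
      by (rule weighted_composition_le[OF p]) blast
    have "power_bound p \<nu> (weighted_composition_op \<sigma> \<eta>) (c * K)"
      unfolding weighted_power_bound_iff[OF \<sigma>0]
      by (intro allI impI c(2)[OF _ \<nu> \<eta> s _ K]) auto
    then show ?thesis using c(1) K(1) by (intro exI[of _ "c * K"]) simp
  qed
  have to_carleson: "carleson_bound T \<nu> (\<lambda>z. \<sigma> z powr p) \<eta> (3 powr (\<gamma> + 1) * (N * A))"
    if \<eta>: "analytic_self_map \<eta>" and N: "N \<ge> 0" "power_bound p \<nu> (weighted_composition_op \<sigma> \<eta>) N" for \<eta> N
  proof (rule carleson_bound_of_kernel[OF \<gamma>(1) _ s _ _ \<nu> \<eta>])
    fix a :: complex assume a: "a \<in> unit_disc"
    let ?f = "kernel_fun \<gamma> p a"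
    have "(\<integral>\<^sup>+z. ennreal (\<sigma> z powr p / cmod (1 - cnj a * \<eta> z) powr (\<gamma> + 1)) \<partial>\<nu>) =
        (\<integral>\<^sup>+z. ennreal (\<sigma> z powr p * cmod (?f (\<eta> z)) powr p) \<partial>\<nu>)"
      unfolding kernel_fun_norm[OF p] powr_minus_divide by simp
    also have "\<dots> \<le> ennreal N * mass p ?f"
      using N(2) a kernel_finite[OF a kern[OF a]] kernel_fun_holomorphic[of a \<gamma> p]
      unfolding weighted_power_bound_iff[OF \<sigma>0] by simp
    also have "\<dots> \<le> ennreal N * (ennreal A * kernel_bound \<gamma> a)"
      by (intro mult_left_mono kern a) simp
    also have "\<dots> = ennreal (N * A) * kernel_bound \<gamma> a"
      using A N(1) by (simp add: ennreal_mult mult.assoc)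
    finally show "(\<integral>\<^sup>+z. ennreal (\<sigma> z powr p / cmod (1 - cnj a * \<eta> z) powr (\<gamma> + 1)) \<partial>\<nu>)
        \<le> ennreal (N * A) * kernel_bound \<gamma> a" .
  qed (use N A in auto)
  show ?thesis
    unfolding d_iff w_iff[OF \<phi>] w_iff[OF \<psi>]
  proof
    assume "\<exists>N\<ge>0. power_bound p \<nu> (difference_op \<phi> \<psi>) N"
    then obtain N where N: "N \<ge> 0" "power_bound p \<nu> (difference_op \<phi> \<psi>) N" by blast
    have K: "0 \<le> 2 * 9 powr p * 3 powr (\<gamma> + 1) * A * N" using A N(1) by simp
    show "(\<exists>N\<ge>0. power_bound p \<nu> (weighted_composition_op \<sigma> \<phi>) N) \<and> (\<exists>N\<ge>0. power_bound p \<nu> (weighted_composition_op \<sigma> \<psi>) N)"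
      by (intro conjI to_weighted[OF \<phi> K] to_weighted[OF \<psi> K]; unfold \<sigma>_def)
        (intro carleson_of_power_bound[OF p \<gamma>(1) less_imp_le[OF A] kern N \<nu> \<phi> \<psi>]; assumption)+
  next
    assume "(\<exists>N\<ge>0. power_bound p \<nu> (weighted_composition_op \<sigma> \<phi>) N) \<and> (\<exists>N\<ge>0. power_bound p \<nu> (weighted_composition_op \<sigma> \<psi>) N)"
    then obtain N\<^sub>1 N\<^sub>2 where N: "N\<^sub>1 \<ge> 0" "power_bound p \<nu> (weighted_composition_op \<sigma> \<phi>) N\<^sub>1"
      "N\<^sub>2 \<ge> 0" "power_bound p \<nu> (weighted_composition_op \<sigma> \<psi>) N\<^sub>2" by blast
    \<comment> \<open>One constant for both operators, since \<open>difference_le\<close> takes the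
      same Carleson constant for both maps.\<close>
    define N where "N = max N\<^sub>1 N\<^sub>2"
    have mono: "power_bound p \<nu> Op N" if "power_bound p \<nu> Op M" "M \<le> N" for Op M
      using that unfolding power_bound_def by (meson ennreal_leI mult_right_mono order_trans zero_le)
    have N': "N \<ge> 0" "power_bound p \<nu> (weighted_composition_op \<sigma> \<phi>) N" "power_bound p \<nu> (weighted_composition_op \<sigma> \<psi>) N"
      using N by (auto simp: N_def intro!: mono[unfolded N_def])
    define K where "K = 3 powr (\<gamma> + 1) * (N * A)"
    have K: "K \<ge> 0" using N'(1) A by (simp add: K_def)
    have carl: "carleson_bound T \<nu> (\<lambda>z. \<sigma> z powr p) \<phi> K" "carleson_bound T \<nu> (\<lambda>z. \<sigma> z powr p) \<psi> K"
      unfolding K_def by (intro to_carleson \<phi> \<psi> N')+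
    obtain c where c: "c > 0"
      "\<And>f \<nu> \<phi> \<psi> K. f holomorphic_on unit_disc \<Longrightarrow> borel_measure_on_disc \<nu> \<Longrightarrow> analytic_self_map \<phi> \<Longrightarrow>
        analytic_self_map \<psi> \<Longrightarrow> K \<ge> 0 \<Longrightarrow>
        carleson_bound T \<nu> (dist_powr p \<phi> \<psi>) \<phi> K \<Longrightarrow>
        carleson_bound T \<nu> (dist_powr p \<phi> \<psi>) \<psi> K \<Longrightarrow>
        (\<integral>\<^sup>+z. ennreal (cmod (f (\<phi> z) - f (\<psi> z)) powr p) \<partial>\<nu>) \<le> ennreal (c * K) * mass p f"
      by (rule difference_le[OF p]) blast
    have "power_bound p \<nu> (difference_op \<phi> \<psi>) (c * K)"
      unfolding power_bound_def difference_op_eq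
      by (intro allI impI c(2)[OF _ \<nu> \<phi> \<psi> K carl[unfolded \<sigma>_def]])
    then show "\<exists>N\<ge>0. power_bound p \<nu> (difference_op \<phi> \<psi>) N"
      using c(1) K by (intro exI[of _ "c * K"]) simp
  qed
qed

definition kernel_sup :: "real \<Rightarrow> complex measure \<Rightarrow> (complex \<Rightarrow> real) \<Rightarrow> (complex \<Rightarrow> complex) \<Rightarrow> (complex \<Rightarrow> complex) \<Rightarrow> ennreal" where
  "kernel_sup \<gamma> \<nu> s \<phi> \<psi> = (SUP a\<in>unit_disc. ennreal ((1 - cmod a) powr \<gamma>) / tail_integral \<omega> a *
     (\<integral>\<^sup>+z. ennreal (s z / cmod (1 - cnj a * \<phi> z) powr (\<gamma> + 1) + s z / cmod (1 - cnj a * \<psi> z) powr (\<gamma> + 1)) \<partial>\<nu>))"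

text \<open>The factor in front of the integral is a positive real r and \<open>kernel_bound\<close>
  is 1 / r. Positivity and finiteness of the tail keep extended division and cancellation
  regular.\<close>

lemma kernel_weight_le_iff:
  assumes a: "a \<in> unit_disc" and K: "K \<ge> 0"
  shows "ennreal ((1 - cmod a) powr \<gamma>) / tail_integral \<omega> a * I \<le> ennreal K \<longleftrightarrow>
    I \<le> ennreal K * kernel_bound \<gamma> a"
proof -
  define d where "d = 1 - cmod a"
  have d: "d > 0" using a by (simp add: d_def)
  have "0 < T (cmod a)" "T (cmod a) < \<infinity>"
    using a by (auto intro!: T_pos T_less_top simp del: infinity_ennreal_def)
  then obtain t where t: "t > 0" "T (cmod a) = ennreal t"
    by (cases "T (cmod a)") auto
  define r where "r = d powr \<gamma> / t"
  have r: "r > 0" using t d by (simp add: r_def)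
  have 1: "ennreal (d powr \<gamma>) / tail_integral \<omega> a = ennreal r"
    unfolding tail_eq[OF a] t(2) r_def using t(1) by (simp add: divide_ennreal)
  have 2: "T (cmod a) * ennreal (d powr - \<gamma>) = ennreal (1 / r)"
    using t d by (simp add: r_def powr_minus field_simps flip: ennreal_mult')
  have "ennreal r * I \<le> ennreal K \<longleftrightarrow> I \<le> ennreal K * ennreal (1 / r)"
  proof
    assume "ennreal r * I \<le> ennreal K"
    then have "ennreal (1 / r) * (ennreal r * I) \<le> ennreal (1 / r) * ennreal K"
      by (rule mult_left_mono) simp
    then show "I \<le> ennreal K * ennreal (1 / r)"
      using r by (simp add: mult.commute[of _ "ennreal K"] flip: mult.assoc ennreal_mult')
  next
    assume "I \<le> ennreal K * ennreal (1 / r)"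
    then have "ennreal r * I \<le> ennreal r * (ennreal K * ennreal (1 / r))"
      by (rule mult_left_mono) simp
    also have "\<dots> = ennreal K"
      using r K by (simp flip: ennreal_mult')
    finally show "ennreal r * I \<le> ennreal K" .
  qed
  then show ?thesis
    unfolding d_def[symmetric] 1 2 .
qed

text \<open>Both quantities are linked through the Carleson constant, to which each is bounded
  linearly. An infinite bounding quantity makes its inequality trivial because
  \<open>C\<^sub>1\<close> and \<open>C\<^sub>2\<close> are positive.\<close>

lemma op_norm_comparable:
  obtains \<gamma>\<^sub>0 where "\<And>p \<gamma>. p > 0 \<Longrightarrow> \<gamma> > \<gamma>\<^sub>0 \<Longrightarrow> \<exists>C>0. \<forall>\<nu> \<phi> \<psi>.
    borel_measure_on_disc \<nu> \<and> analytic_self_map \<phi> \<and> analytic_self_map \<psi> \<longrightarrow>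
    comparable C (epowr (op_norm p \<omega> \<nu> (difference_op \<phi> \<psi>)) p)
      (kernel_sup \<gamma> \<nu> (dist_powr p \<phi> \<psi>) \<phi> \<psi>)"
proof -
  obtain \<gamma>\<^sub>0 where \<gamma>0: "\<gamma>\<^sub>0 \<ge> 0" "\<And>\<gamma>. \<gamma> > \<gamma>\<^sub>0 \<Longrightarrow> \<exists>A>0. \<forall>p>0. \<forall>a\<in>unit_disc.
    mass p (kernel_fun \<gamma> p a) \<le> ennreal A * kernel_bound \<gamma> a"
    by (rule kernel_fun_mass_le) blast
  show ?thesis
  proof (rule that[of \<gamma>\<^sub>0])
    fix p \<gamma> :: real assume p: "p > 0" and "\<gamma> > \<gamma>\<^sub>0"
    then have \<gamma>: "\<gamma> \<ge> 0" using \<gamma>0(1) by simp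
    obtain A where A: "A > 0" and kern: "\<And>a. a \<in> unit_disc \<Longrightarrow>
        mass p (kernel_fun \<gamma> p a) \<le> ennreal A * kernel_bound \<gamma> a"
      using \<gamma>0(2)[OF \<open>\<gamma> > \<gamma>\<^sub>0\<close>] p by blast
    obtain c\<^sub>1 where c1: "c\<^sub>1 > 0"
      "\<And>f \<nu> \<phi> \<psi> K. f holomorphic_on unit_disc \<Longrightarrow> borel_measure_on_disc \<nu> \<Longrightarrow> analytic_self_map \<phi> \<Longrightarrow>
        analytic_self_map \<psi> \<Longrightarrow> K \<ge> 0 \<Longrightarrow>
        carleson_bound T \<nu> (dist_powr p \<phi> \<psi>) \<phi> K \<Longrightarrow>
        carleson_bound T \<nu> (dist_powr p \<phi> \<psi>) \<psi> K \<Longrightarrow>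
        (\<integral>\<^sup>+z. ennreal (cmod (f (\<phi> z) - f (\<psi> z)) powr p) \<partial>\<nu>) \<le> ennreal (c\<^sub>1 * K) * mass p f"
      by (rule difference_le[OF p]) blast
    obtain c\<^sub>2 where c2: "c\<^sub>2 > 0"
      "\<And>\<gamma> A \<nu> s \<phi> K a. A \<ge> 0 \<Longrightarrow> a \<in> unit_disc \<Longrightarrow>
        mass p (kernel_fun \<gamma> p a) \<le> ennreal A * kernel_bound \<gamma> a \<Longrightarrow>
        borel_measure_on_disc \<nu> \<Longrightarrow> analytic_self_map \<phi> \<Longrightarrow>
        s \<in> borel_measurable \<nu> \<Longrightarrow> (\<And>z. s z \<ge> 0) \<Longrightarrow> K \<ge> 0 \<Longrightarrow> carleson_bound T \<nu> s \<phi> K \<Longrightarrow>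
        (\<integral>\<^sup>+z. ennreal (s z / cmod (1 - cnj a * \<phi> z) powr (\<gamma> + 1)) \<partial>\<nu>)
          \<le> ennreal (c\<^sub>2 * K * A) * kernel_bound \<gamma> a"
      by (rule kernel_bound_of_carleson[OF p]) blast
    \<comment> \<open>\<open>C\<^sub>1\<close> composes kernel to Carleson to operator, with pi from
      the normalized area; \<open>C\<^sub>2\<close> composes operator to Carleson to kernel, doubled
      for the two maps.\<close>
    define C\<^sub>1 where "C\<^sub>1 = c\<^sub>1 * 3 powr (\<gamma> + 1) * pi"
    define C\<^sub>2 where "C\<^sub>2 = 2 * c\<^sub>2 * (2 * 9 powr p * 3 powr (\<gamma> + 1) * A) * A"
    have C12: "C\<^sub>1 > 0" "C\<^sub>2 > 0" using c1(1) c2(1) A by (auto simp: C\<^sub>1_def C\<^sub>2_def)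
    show "\<exists>C>0. \<forall>\<nu> \<phi> \<psi>. borel_measure_on_disc \<nu> \<and> analytic_self_map \<phi> \<and> analytic_self_map \<psi> \<longrightarrow>
      comparable C (epowr (op_norm p \<omega> \<nu> (difference_op \<phi> \<psi>)) p)
        (kernel_sup \<gamma> \<nu> (dist_powr p \<phi> \<psi>) \<phi> \<psi>)"
    proof (intro exI[of _ "max C\<^sub>1 C\<^sub>2"] conjI allI impI)
      show "max C\<^sub>1 C\<^sub>2 > 0" using C12 by simp
      fix \<nu> \<phi> \<psi> assume "borel_measure_on_disc \<nu> \<and> analytic_self_map \<phi> \<and> analytic_self_map \<psi>"
      then have \<nu>: "borel_measure_on_disc \<nu>" and \<phi>: "analytic_self_map \<phi>" and \<psi>: "analytic_self_map \<psi>" by auto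
      define s where "s = (dist_powr p \<phi> \<psi>)"
      have s0: "s z \<ge> 0" for z by (simp add: s_def)
      have s[measurable]: "s \<in> borel_measurable \<nu>"
        unfolding s_def by (rule pseudohyperbolic_dist_measurable[OF \<nu> \<phi> \<psi>])
      have [measurable]: "\<phi> \<in> borel_measurable \<nu>" "\<psi> \<in> borel_measurable \<nu>"
        using \<nu> \<phi> \<psi> by (auto intro!: borel_measure_on_disc_measurable analytic_self_mapD)
      define X where "X = epowr (op_norm p \<omega> \<nu> (difference_op \<phi> \<psi>)) p"
      define Y where "Y = kernel_sup \<gamma> \<nu> s \<phi> \<psi>"
      let ?k = "\<lambda>\<eta> a z. s z / cmod (1 - cnj a * \<eta> z) powr (\<gamma> + 1)"
      have sum: "(\<integral>\<^sup>+z. ennreal (?k \<phi> a z + ?k \<psi> a z) \<partial>\<nu>) = (\<integral>\<^sup>+z. ennreal (?k \<phi> a z) \<partial>\<nu>) + (\<integral>\<^sup>+z. ennreal (?k \<psi> a z) \<partial>\<nu>)" for a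
        using s0 by (subst nn_integral_add[symmetric]) (auto simp: ennreal_plus)
      have XY: "X \<le> ennreal C\<^sub>1 * Y"
      proof (cases Y)
        case (real K)
        have le: "(\<integral>\<^sup>+z. ennreal (?k \<phi> a z) \<partial>\<nu>) + (\<integral>\<^sup>+z. ennreal (?k \<psi> a z) \<partial>\<nu>)
            \<le> ennreal K * kernel_bound \<gamma> a" if a: "a \<in> unit_disc" for a
        proof -
          have "ennreal ((1 - cmod a) powr \<gamma>) / tail_integral \<omega> a * (\<integral>\<^sup>+z. ennreal (?k \<phi> a z + ?k \<psi> a z) \<partial>\<nu>) \<le> ennreal K"
            unfolding real(2)[symmetric] Y_def kernel_sup_def by (rule SUP_upper[OF a])
          then show ?thesis
            unfolding kernel_weight_le_iff[OF a real(1)] sum .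
        qed
        have carl: "carleson_bound T \<nu> s \<phi> (3 powr (\<gamma> + 1) * K)" "carleson_bound T \<nu> s \<psi> (3 powr (\<gamma> + 1) * K)"
          by (intro carleson_bound_of_kernel[OF \<gamma> real(1) s s0 _ \<nu>] \<phi> \<psi>; rule order_trans[OF _ le]; simp)+
        have K: "3 powr (\<gamma> + 1) * K \<ge> 0" using real(1) by simp
        have "power_bound p \<nu> (difference_op \<phi> \<psi>) (c\<^sub>1 * (3 powr (\<gamma> + 1) * K))"
          unfolding power_bound_def difference_op_eq
          by (intro allI impI c1(2)[OF _ \<nu> \<phi> \<psi> K carl[unfolded s_def]])
        then have "X \<le> ennreal (c\<^sub>1 * (3 powr (\<gamma> + 1) * K) * pi)"
          unfolding X_def using c1(1) K by (intro op_norm_le_of_power_bound[OF p]) auto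
        also have "\<dots> = ennreal C\<^sub>1 * Y"
          using C12(1) real by (simp add: C\<^sub>1_def ac_simps flip: ennreal_mult')
        finally show ?thesis .
      next
        case top
        then show ?thesis using C12(1) by (simp add: ennreal_mult_top ennreal_eq_0_iff)
      qed
      have YX: "Y \<le> ennreal C\<^sub>2 * X"
      proof (cases X)
        case (real N)
        have "power_bound p \<nu> (difference_op \<phi> \<psi>) N"
          using real(2) unfolding X_def
          by (intro power_bound_of_op_norm[OF p real(1)] difference_op_measurable[OF \<nu> \<phi> \<psi>])
            (auto simp: difference_op_eq right_diff_distrib)
        define K where "K = 2 * 9 powr p * 3 powr (\<gamma> + 1) * A * N"
        have K: "K \<ge> 0" using A real(1) by (simp add: K_def)
        have carl: "carleson_bound T \<nu> s \<phi> K" "carleson_bound T \<nu> s \<psi> K"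
          unfolding s_def K_def
          by (intro carleson_of_power_bound[OF p \<gamma> less_imp_le[OF A] kern real(1)
              \<open>power_bound p \<nu> (difference_op \<phi> \<psi>) N\<close> \<nu> \<phi> \<psi>]; assumption)+
        show ?thesis
          unfolding Y_def kernel_sup_def
        proof (rule SUP_least)
          fix a :: complex assume a: "a \<in> unit_disc"
          let ?R = "T (cmod a) * ennreal ((1 - cmod a) powr - \<gamma>)"
          have "(\<integral>\<^sup>+z. ennreal (?k \<phi> a z + ?k \<psi> a z) \<partial>\<nu>) \<le> ennreal (c\<^sub>2 * K * A) * ?R + ennreal (c\<^sub>2 * K * A) * ?R"
            unfolding sum
            by (intro add_mono c2(2)[OF less_imp_le[OF A] a kern[OF a] \<nu> \<phi> s s0 K carl(1)]
                c2(2)[OF less_imp_le[OF A] a kern[OF a] \<nu> \<psi> s s0 K carl(2)])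
          also have "\<dots> = ennreal (C\<^sub>2 * N) * ?R"
          proof -
            have "ennreal (C\<^sub>2 * N) = ennreal (c\<^sub>2 * K * A) + ennreal (c\<^sub>2 * K * A)"
            proof -
              have "C\<^sub>2 * N = c\<^sub>2 * K * A + c\<^sub>2 * K * A"
                by (simp add: C\<^sub>2_def K_def)
              moreover have "0 \<le> c\<^sub>2 * K * A" using c2(1) K A by simp
              ultimately show ?thesis by (simp only: ennreal_plus)
            qed
            then show ?thesis by (simp only: distrib_right)
          qed
          finally have "ennreal ((1 - cmod a) powr \<gamma>) / tail_integral \<omega> a * (\<integral>\<^sup>+z. ennreal (?k \<phi> a z + ?k \<psi> a z) \<partial>\<nu>) \<le> ennreal (C\<^sub>2 * N)"
            using C12(2) real(1) by (subst kernel_weight_le_iff[OF a]) auto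
          also have "\<dots> = ennreal C\<^sub>2 * X"
            using C12(2) real by (simp add: ennreal_mult)
          finally show "ennreal ((1 - cmod a) powr \<gamma>) / tail_integral \<omega> a * (\<integral>\<^sup>+z. ennreal (?k \<phi> a z + ?k \<psi> a z) \<partial>\<nu>) \<le> ennreal C\<^sub>2 * X" .
        qed
      next
        case top
        then show ?thesis using C12(2) by (simp add: ennreal_mult_top ennreal_eq_0_iff)
      qed
      define C where "C = max C\<^sub>1 C\<^sub>2"
      have C: "C > 0" "C\<^sub>1 \<le> C" "C\<^sub>2 \<le> C" using C12 by (auto simp: C_def)
      have "ennreal (1 / C) * Y \<le> ennreal (1 / C) * (ennreal C * X)"
        using C by (intro mult_left_mono order_trans[OF YX] mult_right_mono ennreal_leI) auto
      also have "\<dots> = X"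
        using C(1) by (simp flip: mult.assoc ennreal_mult')
      finally have "ennreal (1 / C) * Y \<le> X" .
      moreover have "X \<le> ennreal C * Y"
        using C by (intro order_trans[OF XY] mult_right_mono ennreal_leI) auto
      ultimately show "comparable (max C\<^sub>1 C\<^sub>2) (epowr (op_norm p \<omega> \<nu> (difference_op \<phi> \<psi>)) p)
        (kernel_sup \<gamma> \<nu> (dist_powr p \<phi> \<psi>) \<phi> \<psi>)"
        by (simp add: comparable_def X_def Y_def s_def C_def)
    qed
  qed
qed

end

text \<open>The point is finiteness of the tail at 0. Integrability over the disc controls the tail
  only away from the origin, where the Jacobian is bounded below; \<open>D_hat\<close> at r = 0 then
  carries finiteness from 1 / 2 to 0.\<close>

lemma doubling_disc_weightI:
  assumes \<omega>: "\<omega> \<in> D_hat \<inter> D_check" and pos: "\<forall>z\<in>unit_disc. 0 < tail_integral \<omega> z"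
  obtains G where "doubling_disc_weight G (\<lambda>r. tail_integral \<omega> (complex_of_real r)) \<omega>"
proof -
  have rad: "radial_weight \<omega>" using \<omega> by (simp add: D_hat_def)
  obtain G :: "real \<Rightarrow> ennreal" where G[measurable]: "G \<in> borel_measurable borel"
    and int: "\<And>h. h \<in> borel_measurable borel \<Longrightarrow>
      (\<integral>\<^sup>+z. h z * ennreal (\<omega> z) \<partial>area_measure) = ennreal (1 / pi) * (\<integral>\<^sup>+z\<in>unit_disc. h z * G (cmod z) \<partial>lborel)"
    and tail: "\<And>z. tail_integral \<omega> z = (\<integral>\<^sup>+s\<in>{cmod z<..<1}. G s \<partial>lborel)"
    by (rule radial_weight_profile[OF rad]) blast
  have hat: "\<exists>C\<ge>1. \<forall>r\<in>{0..<1}. tail_integral \<omega> (complex_of_real r) \<le> ennreal C * tail_integral \<omega> (complex_of_real ((1 + r) / 2))"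
    using \<omega> by (simp add: D_hat_def)
  have half: "tail_integral \<omega> (complex_of_real (1 / 2)) < \<infinity>"
  proof -
    have "tail_integral \<omega> (complex_of_real (1 / 2)) \<le> (\<integral>\<^sup>+r\<in>{0<..<1}. ennreal (2 * pi * r) * G r \<partial>lborel)"
      unfolding tail
    proof (rule nn_integral_mono)
      fix r :: real
      \<comment> \<open>For r > 1 / 2 the Jacobian 2 * pi * r exceeds 1.\<close>
      have "1 * G r \<le> ennreal (2 * pi * r) * G r" if "1 / 2 < r"
      proof (rule mult_right_mono)
        have "1 * (1 / 2) \<le> (2 * pi) * r"
          using that pi_ge_two by (intro mult_mono) auto
        then have "1 \<le> 2 * pi * r" using that pi_ge_two mult_mono[of 2 "2 * pi" "1 / 2" r] by simp
        then show "1 \<le> ennreal (2 * pi * r)" by (simp add: ennreal_ge_1)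
      qed simp
      then show "G r * indicator {cmod (complex_of_real (1 / 2))<..<1} r \<le> ennreal (2 * pi * r) * G r * indicator {0<..<1} r"
        by (auto simp: indicator_def)
    qed
    also have "\<dots> = (\<integral>\<^sup>+z\<in>unit_disc. G (cmod z) \<partial>lborel)"
      by (rule nn_integral_cmod_disc[symmetric]) measurable
    also have "\<dots> = ennreal pi * (ennreal (1 / pi) * (\<integral>\<^sup>+z\<in>unit_disc. 1 * G (cmod z) \<partial>lborel))"
      by (simp flip: mult.assoc ennreal_mult')
    also have "\<dots> = ennreal pi * (\<integral>\<^sup>+z. 1 * ennreal (\<omega> z) \<partial>area_measure)"
      by (subst int) simp_all
    also have "\<dots> < \<infinity>"
    proof -
      have "integrable area_measure \<omega>" using rad by (simp add: radial_weight_def)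
      then have "(\<integral>\<^sup>+z. ennreal (norm (\<omega> z)) \<partial>area_measure) < \<infinity>"
        by (simp add: integrable_iff_bounded)
      moreover have "(\<integral>\<^sup>+z. ennreal (\<omega> z) \<partial>area_measure) \<le> (\<integral>\<^sup>+z. ennreal (norm (\<omega> z)) \<partial>area_measure)"
        by (intro nn_integral_mono ennreal_leI) simp
      ultimately have "(\<integral>\<^sup>+z. ennreal (\<omega> z) \<partial>area_measure) < \<infinity>" by (rule le_less_trans[rotated])
      then show ?thesis by (simp add: ennreal_mult_less_top)
    qed
    finally show ?thesis .
  qed
  show ?thesis
  proof (rule that[of G], unfold_locales)
    show "G \<in> borel_measurable borel" by (rule G)
    show "tail_integral \<omega> (complex_of_real r) = (\<integral>\<^sup>+s\<in>{r<..<1}. G s \<partial>lborel)" if "r \<in> {0..<1}" for r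
      using that by (simp add: tail)
    \<comment> \<open>The absolute value appears because the tail integral at a real r starts at
      |r|, and measurability is required on the whole line.\<close>
    have "Measurable.pred (borel \<Otimes>\<^sub>M borel) (\<lambda>x::real \<times> real. \<bar>fst x\<bar> < snd x \<and> snd x < 1)"
      by measurable
    then have [measurable]: "{x::real \<times> real. \<bar>fst x\<bar> < snd x \<and> snd x < 1} \<in> sets (borel \<Otimes>\<^sub>M borel)"
      by (simp add: pred_def space_pair_measure)
    have "(\<lambda>r. tail_integral \<omega> (complex_of_real r)) =
        (\<lambda>r. \<integral>\<^sup>+s. G s * indicator {x::real \<times> real. \<bar>fst x\<bar> < snd x \<and> snd x < 1} (r, s) \<partial>lborel)"
      by (auto simp: tail fun_eq_iff indicator_def intro!: nn_integral_cong)
    also have "\<dots> \<in> borel_measurable borel" by measurable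
    finally show "(\<lambda>r. tail_integral \<omega> (complex_of_real r)) \<in> borel_measurable borel" .
    obtain C where "tail_integral \<omega> (complex_of_real 0) \<le> ennreal C * tail_integral \<omega> (complex_of_real ((1 + 0) / 2))"
      using hat by force
    then have "tail_integral \<omega> (complex_of_real 0) \<le> ennreal C * tail_integral \<omega> (complex_of_real (1 / 2))" by simp
    also have "\<dots> < \<infinity>" using half by (simp add: ennreal_mult_less_top)
    finally show "tail_integral \<omega> (complex_of_real 0) < \<infinity>" .
    show "\<exists>C\<ge>1. \<forall>r\<in>{0..<1}. tail_integral \<omega> (complex_of_real r) \<le> ennreal C * tail_integral \<omega> (complex_of_real ((1 + r) / 2))"
      by (rule hat)
    show "\<exists>K>1. \<exists>C>1. \<forall>r\<in>{0..<1}. ennreal C * tail_integral \<omega> (complex_of_real (1 - (1 - r) / K)) \<le> tail_integral \<omega> (complex_of_real r)"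
      using \<omega> by (simp add: D_check_def)
    show "0 \<le> \<omega> z" if "z \<in> unit_disc" for z
      using rad that unfolding radial_weight_def by blast
    show "(\<integral>\<^sup>+z. h z * ennreal (\<omega> z) \<partial>area_measure) = ennreal (1 / pi) * (\<integral>\<^sup>+z\<in>unit_disc. h z * G (cmod z) \<partial>lborel)"
      if "h \<in> borel_measurable borel" for h
      using that by (rule int)
    show "tail_integral \<omega> z = tail_integral \<omega> (complex_of_real (cmod z))" for z
      by (simp add: tail_integral_def)
    show "0 < tail_integral \<omega> (complex_of_real r)" if "r \<in> {0..<1}" for r
      using pos that by auto
  qed
qed

theorem proposition13:
  fixes \<omega> :: "complex \<Rightarrow> real"
  assumes "\<omega> \<in> D_hat \<inter> D_check"
    and "\<forall>z\<in>unit_disc. 0 < tail_integral \<omega> z"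
  shows
    "(\<forall>p>0. \<forall>\<nu> \<phi> \<psi>.
        borel_measure_on_disc \<nu> \<and> analytic_self_map \<phi> \<and> analytic_self_map \<psi> \<longrightarrow>
        (let \<sigma> = (\<lambda>z. pseudohyperbolic_dist (\<phi> z) (\<psi> z)) in
          bounded_op p \<omega> \<nu> (difference_op \<phi> \<psi>) \<longleftrightarrow>
            bounded_op p \<omega> \<nu> (weighted_composition_op \<sigma> \<phi>) \<and>
            bounded_op p \<omega> \<nu> (weighted_composition_op \<sigma> \<psi>))) \<and>
     (\<exists>\<gamma>\<^sub>0::real. \<forall>p>0. \<forall>\<gamma>>\<gamma>\<^sub>0. \<exists>C>0. \<forall>\<nu> \<phi> \<psi>.
        borel_measure_on_disc \<nu> \<and> analytic_self_map \<phi> \<and> analytic_self_map \<psi> \<longrightarrow>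
        (let \<sigma> = (\<lambda>z. pseudohyperbolic_dist (\<phi> z) (\<psi> z)) in
          comparable C
            (epowr (op_norm p \<omega> \<nu> (difference_op \<phi> \<psi>)) p)
            (SUP a\<in>unit_disc.
               ennreal ((1 - cmod a) powr \<gamma>) / tail_integral \<omega> a *
               (\<integral>\<^sup>+ z. ennreal
                   (\<sigma> z powr p / cmod (1 - cnj a * \<phi> z) powr (\<gamma> + 1) +
                    \<sigma> z powr p / cmod (1 - cnj a * \<psi> z) powr (\<gamma> + 1)) \<partial>\<nu>))))"
proof -
  obtain G where "doubling_disc_weight G (\<lambda>r. tail_integral \<omega> (complex_of_real r)) \<omega>"
    using doubling_disc_weightI[OF assms] by blast
  then interpret doubling_disc_weight G "\<lambda>r. tail_integral \<omega> (complex_of_real r)" \<omega> .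
  obtain \<gamma>\<^sub>0 where \<gamma>\<^sub>0: "\<And>p \<gamma>. p > 0 \<Longrightarrow> \<gamma> > \<gamma>\<^sub>0 \<Longrightarrow> \<exists>C>0. \<forall>\<nu> \<phi> \<psi>.
    borel_measure_on_disc \<nu> \<and> analytic_self_map \<phi> \<and> analytic_self_map \<psi> \<longrightarrow>
    comparable C (epowr (op_norm p \<omega> \<nu> (difference_op \<phi> \<psi>)) p)
      (kernel_sup \<gamma> \<nu> (dist_powr p \<phi> \<psi>) \<phi> \<psi>)"
    by (rule op_norm_comparable) blast
  show ?thesis
    unfolding Let_def
  proof (intro conjI allI impI)
    show "\<exists>\<gamma>\<^sub>0::real. \<forall>p>0. \<forall>\<gamma>>\<gamma>\<^sub>0. \<exists>C>0. \<forall>\<nu> \<phi> \<psi>.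
        borel_measure_on_disc \<nu> \<and> analytic_self_map \<phi> \<and> analytic_self_map \<psi> \<longrightarrow>
          comparable C
            (epowr (op_norm p \<omega> \<nu> (difference_op \<phi> \<psi>)) p)
            (SUP a\<in>unit_disc.
               ennreal ((1 - cmod a) powr \<gamma>) / tail_integral \<omega> a *
               (\<integral>\<^sup>+ z. ennreal
                   (pseudohyperbolic_dist (\<phi> z) (\<psi> z) powr p / cmod (1 - cnj a * \<phi> z) powr (\<gamma> + 1) +
                    pseudohyperbolic_dist (\<phi> z) (\<psi> z) powr p / cmod (1 - cnj a * \<psi> z) powr (\<gamma> + 1)) \<partial>\<nu>))"
      by (rule exI[of _ \<gamma>\<^sub>0], intro allI impI) (rule \<gamma>\<^sub>0[unfolded kernel_sup_def])
  qed (intro bounded_difference_iff; blast)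
qed

end
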